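(* Let a hyperelliptic curve of genus $g$ (in the canonical form described in the context) have all branch points real. Let $\upsilon\in\mathbb{R}^g$ be fixed and such that $\wp_{1,1,2i-1}(\imath\upsilon)=0$ for $i=1,\dots,g$, that is, $\imath\upsilon$ is a half-period. Then for all $u\in\mathbb{R}^g$ (at which they are defined) the functions $\wp_{1,2i-1}(u+\imath\upsilon)$ and $\wp_{1,1,2i-1}(u+\imath\upsilon)$, $i=1,\dots,g$, are real-valued.
   Context: The curve is non-degenerate, $y^2=\Lambda(x)=x^{2g+1}+\sum_{i=0}^{2g}\lambda_{2i+2}x^{2g-i}$, with real branch points (roots of $\Lambda$) $e_1<e_2<\dots<e_{2g+1}$. Cuts are made between $e_{2k-1}$ and $e_{2k}$, $k=1,\dots,g$, and from $e_{2g+1}$ to $\infty$; $\mathfrak{a}_k$ encircles the cut $(e_{2k-1},e_{2k})$, and $\mathfrak{b}_k$ emerges from the cut $(e_{2k-1},e_{2k})$ and enters the cut $(e_{2g+1},\infty)$. Differentials (with $\lambda_0=1$): $$\mathrm{d}u_{2n-1}=\frac{x^{g-n}\mathrm{d}x}{-2y},\qquad \mathrm{d}r_{2n-1}=\frac{\mathrm{d}x}{-2y}\sum_{j=0}^{2n-2}(2n-1-j)\lambda_{2j}x^{g+n-1-j},\qquad n=1,\dots,g,$$ $\mathrm{d}u=(\mathrm{d}u_1,\mathrm{d}u_3,\dots,\mathrm{d}u_{2g-1})^t$, $\mathrm{d}r=(\mathrm{d}r_1,\mathrm{d}r_3,\dots,\mathrm{d}r_{2g-1})^t$. The matrices $\omega,\omega',\eta$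 have columns $$\omega_k=\oint_{\mathfrak{a}_k}\mathrm{d}u=2\int_{e_{2k-1}}^{e_{2k}}\mathrm{d}u,\quad \omega'_k=\oint_{\mathfrak{b}_k}\mathrm{d}u=2\sum_{i=k}^{g}\int_{e_{2i}}^{e_{2i+1}}\mathrm{d}u,\quad \eta_k=\oint_{\mathfrak{a}_k}\mathrm{d}r=2\int_{e_{2k-1}}^{e_{2k}}\mathrm{d}r,$$ the integrals being along the real axis, with $y$ the boundary values from the upper half-plane of one fixed analytic branch of $\sqrt{\Lambda}$. Here $\omega$ is real and $\omega'$ purely imaginary; $\tau=\omega^{-1}\omega'$ is symmetric with $\operatorname{Im}\tau>0$; $\varkappa=\eta\omega^{-1}$ is symmetric. A half-period is a point $\tfrac12\omega\varepsilon+\tfrac12\omega'\varepsilon'$ with $\varepsilon,\varepsilon'\in\mathbb{Z}^g$. Theta function: $\theta(v;\tau)=\sum_{n\in\mathbb{Z}^g}\exp(\imath\pi n^t\tau n+2\imath\pi n^tv)$; with characteristic $[\varepsilon]=(\varepsilon',\varepsilon)^t$: $$\theta[\varepsilon](v;\tau)=\exp\big(\imath\pi(\varepsilon'^t/2)\tau(\varepsilon'/2)+2\imath\pi(v+\varepsilon/2)^t\varepsilon'/2\big)\,\theta(v+\varepsilon/2+\tau\varepsilon'/2;\tau).$$ The characteristic $[K]$ of the vector of Riemann constants (with these cycles and base-point infinity) has $\varepsilon'_k=1$ and $\varepsilon_k\equiv g-k+1\pmod 2$, $k=1,\dots,g$. The sigma function is $\sigma(u)=C\exp(-\tfrac12u^t\varkappa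 u)\,\theta[K](\omega^{-1}u;\omega^{-1}\omega')$ with a nonzero constant $C$, $u=(u_1,u_3,\dots,u_{2g-1})^t\in\mathbb{C}^g$, and $$\wp_{i,j}(u)=-\frac{\partial^2\log\sigma(u)}{\partial u_i\partial u_j},\qquad \wp_{i,j,k}(u)=-\frac{\partial^3\log\sigma(u)}{\partial u_i\partial u_j\partial u_k}.$$ These are meromorphic functions on $\mathbb{C}^g$, periodic with respect to the lattice generated by the columns of $\omega$ and $\omega'$. *)

theory Defs
  imports "HOL-Analysis.Analysis"
begin

text \<open>
  The genus \<open>g\<close> is the cardinality of a finite linearly ordered index type \<open>'g\<close>, whose elements are
  numbered \<open>1, \<dots>, g\<close> in increasing order by \<open>pos\<close>. The component of \<open>u :: complex ^ 'g\<close> at the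
  index \<open>i\<close> with \<open>pos i = n\<close> is the variable written \<open>u\<^sub>2\<^sub>n\<^sub>-\<^sub>1\<close>; similarly for
  \<open>du\<^sub>2\<^sub>n\<^sub>-\<^sub>1\<close> and \<open>dr\<^sub>2\<^sub>n\<^sub>-\<^sub>1\<close>.
\<close>

definition pos :: "'g::{finite,linorder} \<Rightarrow> nat" where
  "pos i = card {..i}"

definition first_ix :: "'g::{finite,linorder}" where
  "first_ix = Min UNIV"

lemma pos_first_ix: "pos (first_ix :: 'g::{finite,linorder}) = 1"
proof -
  have "{..first_ix} = {first_ix :: 'g}"
    unfolding first_ix_def by (auto intro: antisym)
  then show "pos (first_ix :: 'g) = 1" by (simp add: pos_def)
qed

lemma pos_strict_mono: "i < j \<Longrightarrow> pos i < pos j"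
  unfolding pos_def by (rule psubset_card_mono) auto

lemma bij_betw_pos: "bij_betw pos (UNIV :: 'g::{finite,linorder} set) {1..CARD('g)}"
proof -
  have inj: "inj (pos :: 'g \<Rightarrow> nat)"
    by (metis injI linorder_neqE nat_neq_iff pos_strict_mono)
  have "range (pos :: 'g \<Rightarrow> nat) \<subseteq> {1..CARD('g)}"
    by (auto simp: pos_def Suc_le_eq card_gt_0_iff intro!: card_mono)
  then have "range (pos :: 'g \<Rightarrow> nat) = {1..CARD('g)}"
    by (intro card_subset_eq) (simp_all add: card_image[OF inj])
  with inj show ?thesis by (simp add: bij_betw_def)
qed


text \<open>The coefficients are \<open>lam (2 * i)\<close>; the values of \<open>lam\<close> at odd arguments are never used.\<close>

definition Lambda :: "nat \<Rightarrow> (nat \<Rightarrow> complex) \<Rightarrow> complex \<Rightarrow> complex" where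
  "Lambda g lam x = x ^ (2 * g + 1) + (\<Sum>i = 0..2 * g. lam (2 * i + 2) * x ^ (2 * g - i))"

text \<open>
  The \<open>2 * g + 1\<close> roots are real and pairwise distinct, which includes non-degeneracy of the curve.
\<close>

definition real_branch_points :: "nat \<Rightarrow> (nat \<Rightarrow> complex) \<Rightarrow> (nat \<Rightarrow> real) \<Rightarrow> bool" where
  "real_branch_points g lam e \<longleftrightarrow>
     strict_mono_on {1..2 * g + 1} e \<and>
     {x. Lambda g lam x = 0} = (\<lambda>k. of_real (e k)) ` {1..2 * g + 1}"

text \<open>
  A branch of \<open>sqrt \<Lambda>\<close> on the open upper half-plane together with its boundary values on the
  real axis.
\<close>

definition upper_branch :: "(complex \<Rightarrow> complex) \<Rightarrow> (complex \<Rightarrow> complex) \<Rightarrow> bool" where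
  "upper_branch L y \<longleftrightarrow>
     y holomorphic_on {z. Im z > 0} \<and> continuous_on {z. Im z \<ge> 0} y \<and>
     (\<forall>z. Im z \<ge> 0 \<longrightarrow> (y z)\<^sup>2 = L z)"

definition du_coeff :: "nat \<Rightarrow> (complex \<Rightarrow> complex) \<Rightarrow> nat \<Rightarrow> complex \<Rightarrow> complex" where
  "du_coeff g y n x = x ^ (g - n) / (- 2 * y x)"

definition dr_coeff ::
    "nat \<Rightarrow> (nat \<Rightarrow> complex) \<Rightarrow> (complex \<Rightarrow> complex) \<Rightarrow> nat \<Rightarrow> complex \<Rightarrow> complex" where
  "dr_coeff g lam y n x =
     1 / (- 2 * y x) *
     (\<Sum>j = 0..2 * n - 2. of_nat (2 * n - 1 - j) * lam (2 * j) * x ^ (g + n - 1 - j))"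

definition edge_integral :: "(nat \<Rightarrow> real) \<Rightarrow> (complex \<Rightarrow> complex) \<Rightarrow> nat \<Rightarrow> complex" where
  "edge_integral e f k = integral {e k..e (k + 1)} (\<lambda>x. f (of_real x))"

text \<open>In \<open>A $ i $ k\<close> the index \<open>i\<close> is the row and \<open>k\<close> the column (the number of the cycle).\<close>

definition omega ::
    "(nat \<Rightarrow> real) \<Rightarrow> (complex \<Rightarrow> complex) \<Rightarrow>
     complex ^ 'g::{finite,linorder} ^ 'g::{finite,linorder}" where
  "omega e y = (\<chi> i k. 2 * edge_integral e (du_coeff CARD('g) y (pos i)) (2 * pos k - 1))"

definition omega' ::
    "(nat \<Rightarrow> real) \<Rightarrow> (complex \<Rightarrow> complex) \<Rightarrow>
     complex ^ 'g::{finite,linorder} ^ 'g::{finite,linorder}" where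
  "omega' e y =
     (\<chi> i k. 2 * (\<Sum>j = pos k..CARD('g). edge_integral e (du_coeff CARD('g) y (pos i)) (2 * j)))"

definition eta ::
    "(nat \<Rightarrow> complex) \<Rightarrow> (nat \<Rightarrow> real) \<Rightarrow> (complex \<Rightarrow> complex) \<Rightarrow>
     complex ^ 'g::{finite,linorder} ^ 'g::{finite,linorder}" where
  "eta lam e y =
     (\<chi> i k. 2 * edge_integral e (dr_coeff CARD('g) lam y (pos i)) (2 * pos k - 1))"

definition tau ::
    "(nat \<Rightarrow> real) \<Rightarrow> (complex \<Rightarrow> complex) \<Rightarrow>
     complex ^ 'g::{finite,linorder} ^ 'g::{finite,linorder}" where
  "tau e y = matrix_inv (omega e y) ** omega' e y"

definition kappa ::
    "(nat \<Rightarrow> complex) \<Rightarrow> (nat \<Rightarrow> real) \<Rightarrow> (complex \<Rightarrow> complex) \<Rightarrow>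
     complex ^ 'g::{finite,linorder} ^ 'g::{finite,linorder}" where
  "kappa lam e y = eta lam e y ** matrix_inv (omega e y)"

definition int_vec :: "int ^ 'g \<Rightarrow> complex ^ 'g" where
  "int_vec n = (\<chi> i. of_int (n $ i))"

definition real_vec :: "real ^ 'g \<Rightarrow> complex ^ 'g" where
  "real_vec v = (\<chi> i. of_real (v $ i))"

definition half_period :: "(nat \<Rightarrow> real) \<Rightarrow> (complex \<Rightarrow> complex) \<Rightarrow> complex ^ 'g::{finite,linorder} \<Rightarrow> bool" where
  "half_period e y p \<longleftrightarrow>
     (\<exists>eps eps' :: int ^ 'g::{finite,linorder}.
        p = (1 / 2) *s (omega e y *v int_vec eps) + (1 / 2) *s (omega' e y *v int_vec eps'))"


text \<open>The bilinear product \<open>x\<^sup>t y\<close>, without complex conjugation.\<close>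

definition bdot :: "complex ^ 'g \<Rightarrow> complex ^ 'g \<Rightarrow> complex" where
  "bdot x y = (\<Sum>i\<in>UNIV. x $ i * y $ i)"

definition theta :: "complex ^ 'g \<Rightarrow> complex ^ 'g ^ 'g \<Rightarrow> complex" where
  "theta v T =
     (\<Sum>\<^sub>\<infinity>n\<in>(UNIV :: (int ^ 'g) set).
        exp (\<i> * of_real pi * bdot (int_vec n) (T *v int_vec n) +
             2 * \<i> * of_real pi * bdot (int_vec n) v))"

definition theta_char ::
    "int ^ 'g \<Rightarrow> int ^ 'g \<Rightarrow> complex ^ 'g \<Rightarrow> complex ^ 'g ^ 'g \<Rightarrow> complex" where
  "theta_char eps' eps v T =
     (let a = (1 / 2) *s int_vec eps'; b = (1 / 2) *s int_vec eps
      in exp (\<i> * of_real pi * bdot a (T *v a) + 2 * \<i> * of_real pi * bdot (v + b) a) *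
         theta (v + b + T *v a) T)"

text \<open>
  The second half of the characteristic of the vector of Riemann constants is determined only
  modulo 2, hence a predicate; the choice affects the theta function by a sign only.
\<close>

definition riemann_char :: "int ^ 'g::{finite,linorder} \<Rightarrow> int ^ 'g::{finite,linorder} \<Rightarrow> bool" where
  "riemann_char eps' eps \<longleftrightarrow>
     (\<forall>k. eps' $ k = 1) \<and>
     (\<forall>k. eps $ k mod 2 = (int CARD('g) - int (pos k) + 1) mod 2)"

definition sigma_fun ::
    "(nat \<Rightarrow> complex) \<Rightarrow> (nat \<Rightarrow> real) \<Rightarrow> (complex \<Rightarrow> complex) \<Rightarrow> complex \<Rightarrow>
     int ^ 'g::{finite,linorder} \<Rightarrow> int ^ 'g::{finite,linorder} \<Rightarrow> complex ^ 'g::{finite,linorder} \<Rightarrow> complex" where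
  "sigma_fun lam e y C eps' eps u =
     C * exp (- (1 / 2) * bdot u (kappa lam e y *v u)) *
     theta_char eps' eps (matrix_inv (omega e y) *v u) (tau e y)"

definition partial_deriv :: "'g \<Rightarrow> (complex ^ 'g \<Rightarrow> complex) \<Rightarrow> complex ^ 'g \<Rightarrow> complex" where
  "partial_deriv i f u = deriv (\<lambda>z. f (u + axis i z)) 0"

text \<open>
  The logarithm of \<open>s\<close> is multivalued; its first partial derivatives are the single-valued
  logarithmic derivatives, from which the higher ones are obtained. They are meaningful at the
  points where \<open>s\<close> does not vanish.
\<close>

definition dlog :: "'g \<Rightarrow> (complex ^ 'g \<Rightarrow> complex) \<Rightarrow> complex ^ 'g \<Rightarrow> complex" where
  "dlog i s u = partial_deriv i s u / s u"

definition wp2 :: "(complex ^ 'g \<Rightarrow> complex) \<Rightarrow> 'g \<Rightarrow> 'g \<Rightarrow> complex ^ 'g \<Rightarrow> complex" where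
  "wp2 s i j u = - partial_deriv i (dlog j s) u"

definition wp3 :: "(complex ^ 'g \<Rightarrow> complex) \<Rightarrow> 'g \<Rightarrow> 'g \<Rightarrow> 'g \<Rightarrow> complex ^ 'g \<Rightarrow> complex" where
  "wp3 s i j k u = - partial_deriv i (partial_deriv j (dlog k s)) u"

end

theory Submission
  imports Defs "HOL-Complex_Analysis.Cauchy_Integral_Theorem"
begin

text \<open>
  On the cuts \<open>y\<close> is real and between them it is imaginary, so \<open>\<omega> = A\<close> and \<open>\<omega>' = \<i> B\<close> with real matrices
  \<open>A\<close>, \<open>B\<close>, which are invertible. Cauchy's theorem on closed curves in the upper half-plane that
  approach the real line gives the bilinear relation \<open>A B\<^sup>t = B A\<^sup>t\<close>, hence \<open>\<tau> = \<i> Y\<close> with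
  \<open>Y = A\<^sup>-\<^sup>1 B\<close> symmetric. If sigma does not vanish at some point, the theta series converges there,
  which forces \<open>Y\<close> to be positive semidefinite and thus, being invertible, positive definite.

  At a half-period \<open>w\<close> the quasi-periodicity of theta yields
  \<open>\<sigma>(w + u) = C exp(Q(u)) \<Theta>(u)\<close>, where \<open>Q\<close> is a quadratic polynomial whose second derivatives are
  the real numbers \<open>- (\<kappa> + \<kappa>\<^sup>t)\<^sub>i\<^sub>j / 2\<close>, and \<open>\<Theta>(u)\<close> is the sum of
  \<open>exp(- \<pi> N\<^sup>t Y N + 2 \<pi> \<i> N\<^sup>t (A\<^sup>-\<^sup>1 u + r))\<close> over a translate of the integer lattice that is invariant
  under \<open>N \<mapsto> - N\<close>; here \<open>r\<close> is a real vector. So \<open>\<Theta>\<close> and its derivatives are real at real \<open>u\<close>, and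
  the second and third logarithmic derivatives of \<open>\<sigma>\<close> at \<open>w + u\<close> are real.
\<close>

section \<open>The polynomial of the curve and the sign of its values\<close>

text \<open>The real axis is the place where Cauchy's theorem is not directly available: the forms
  have inverse square root singularities at the branch points, and the path runs through infinity,
  itself a branch point. So the theorem is applied strictly inside the upper half-plane and carried
  to the axis by dominated convergence. The substitution \<open>x = tan t\<close> treats all 2g+2
  branch points alike: up to cosines, x - e_k becomes sin (t - th_k), and infinity becomes t = pi /
  2. One product of inverse square roots of sines then dominates all forms, uniformly in the height
  of the path. The period relation is the imaginary part of an iterated integral over the whole
  line: two forms are both real or both imaginary on each interval, so what happens inside a single
  interval contributes only real terms. Invertibility of the period matrices comes from counting
  roots: a real combination of rows is a differential whose numerator is a polynomial of degree
  below g, and a vanishing integral over an interval forces a root inside it.\<close>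

lemma coeff_mult_Reals:
  fixes p q :: "complex poly"
  assumes "\<And>i. coeff p i \<in> \<real>" and "\<And>i. coeff q i \<in> \<real>"
  shows "coeff (p * q) i \<in> \<real>"
  unfolding coeff_mult using assms by (intro sum_in_Reals Reals_mult) auto

lemma coeff_prod_linear_Reals:
  fixes e :: "'k \<Rightarrow> real"
  assumes "finite S"
  shows "coeff (\<Prod>k\<in>S. [:- complex_of_real (e k), 1:]) i \<in> \<real>"
  using assms
proof (induction S arbitrary: i rule: finite_induct)
  case empty
  then show ?case by (simp add: coeff_1)
next
  case (insert x F)
  have "coeff [:- complex_of_real (e x), 1:] i \<in> \<real>" for i
    by (auto simp: coeff_pCons split: nat.split)
  then show ?case
    using insert by (simp only: prod.insert[OF insert.hyps]) (rule coeff_mult_Reals, auto)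
qed

definition Lambda_poly :: "nat \<Rightarrow> (nat \<Rightarrow> complex) \<Rightarrow> complex poly" where
  "Lambda_poly g lam = monom 1 (2 * g + 1) + (\<Sum>i = 0..2 * g. monom (lam (2 * i + 2)) (2 * g - i))"

lemma poly_Lambda_poly: "poly (Lambda_poly g lam) x = Lambda g lam x"
  by (simp add: Lambda_poly_def Lambda_def poly_monom poly_sum)

lemma coeff_Lambda_poly:
  assumes "i \<le> 2 * g"
  shows "coeff (Lambda_poly g lam) (2 * g - i) = lam (2 * i + 2)"
proof -
  have "(\<Sum>j = 0..2 * g. coeff (monom (lam (2 * j + 2)) (2 * g - j)) (2 * g - i)) =
        (\<Sum>j = 0..2 * g. if j = i then lam (2 * j + 2) else 0)"
    using assms by (intro sum.cong) (auto simp: coeff_monom)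
  with assms show ?thesis
    by (simp add: Lambda_poly_def coeff_monom coeff_sum)
qed

text \<open>Only the set of roots is given, without multiplicities. Two monic polynomials of degree
  2g+1 that agree at 2g+1 distinct points are equal, so every root is simple.\<close>

lemma Lambda_poly_eq_prod:
  assumes "real_branch_points g lam e"
  shows "Lambda_poly g lam = (\<Prod>k\<in>{1..2 * g + 1}. [:- complex_of_real (e k), 1:])" (is "?P = ?Q")
proof (rule poly_eqI_degree_lead_coeff)
  let ?R = "(\<lambda>k. complex_of_real (e k)) ` {1..2 * g + 1}"
  have "inj_on (\<lambda>k. complex_of_real (e k)) {1..2 * g + 1}"
    using assms strict_mono_on_imp_inj_on[of "{1..2*g+1}" e]
    unfolding real_branch_points_def inj_on_def by auto
  then show "2 * g + 1 \<le> card ?R"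
    by (simp add: card_image)
  have degQ: "degree ?Q = 2 * g + 1"
    by (subst degree_prod_eq_sum_degree) auto
  then show "degree ?Q \<le> 2 * g + 1" by simp
  have "lead_coeff ?Q = 1"
    by (subst lead_coeff_prod) simp
  then have "coeff ?Q (2 * g + 1) = 1" using degQ by simp
  moreover have "(\<Sum>i = 0..2 * g. coeff (monom (lam (2 * i + 2)) (2 * g - i)) (2 * g + 1)) = 0"
    by (intro sum.neutral ballI) (simp only: coeff_monom, simp)
  then have "coeff ?P (2 * g + 1) = 1"
    by (simp only: Lambda_poly_def coeff_add coeff_sum) simp
  ultimately show "coeff ?P (2 * g + 1) = coeff ?Q (2 * g + 1)" by simp
  show "degree ?P \<le> 2 * g + 1"
    unfolding Lambda_poly_def
    by (intro degree_add_le degree_sum_le) (auto intro!: order.trans[OF degree_monom_le])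
  fix x assume x: "x \<in> ?R"
  then have "poly ?P x = 0"
    using assms unfolding poly_Lambda_poly real_branch_points_def by auto
  moreover obtain k where k: "k \<in> {1..2 * g + 1}" "x = of_real (e k)"
    using x by auto
  then have "poly ?Q x = 0"
    unfolding poly_prod by (intro prod_zero bexI[OF _ k(1)]) auto
  ultimately show "poly ?P x = poly ?Q x" by simp
qed

lemma Lambda_eq_prod:
  assumes "real_branch_points g lam e"
  shows "Lambda g lam z = (\<Prod>k\<in>{1..2 * g + 1}. z - of_real (e k))"
  unfolding poly_Lambda_poly[symmetric] Lambda_poly_eq_prod[OF assms] poly_prod
  by (intro prod.cong refl) simp

text \<open>The coefficients are complex by type; their reality is a consequence of the real roots.
  It makes the differentials dr, hence \<open>eta\<close> and \<open>kappa\<close>, real.\<close>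

lemma lam_in_Reals:
  assumes "real_branch_points g lam e" and "i \<le> 2 * g"
  shows "lam (2 * i + 2) \<in> \<real>"
  unfolding coeff_Lambda_poly[OF assms(2), symmetric] Lambda_poly_eq_prod[OF assms(1)]
  by (rule coeff_prod_linear_Reals) simp

lemma sgn_prod:
  fixes f :: "'k \<Rightarrow> real"
  shows "sgn (\<Prod>k\<in>S. f k) = (\<Prod>k\<in>S. sgn (f k))"
  by (induction S rule: infinite_finite_induct) (auto simp: sgn_mult)

lemma sgn_prod_diff:
  fixes x :: real
  assumes "m \<le> N" and "\<And>k. k \<in> {1..m} \<Longrightarrow> e k < x" and "\<And>k. k \<in> {m<..N} \<Longrightarrow> x < e k"
  shows "sgn (\<Prod>k\<in>{1..N}. x - e k) = (- 1) ^ (N - m)"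
proof -
  have "{1..N} = {1..m} \<union> {m<..N}" using assms(1) by auto
  moreover have "sgn (\<Prod>k\<in>{1..m} \<union> {m<..N}. x - e k) =
      (\<Prod>k\<in>{1..m}. sgn (x - e k)) * (\<Prod>k\<in>{m<..N}. sgn (x - e k))"
    by (subst prod.union_disjoint) (auto simp: sgn_mult sgn_prod)
  moreover have "(\<Prod>k\<in>{1..m}. sgn (x - e k)) = (\<Prod>k\<in>{1..m}. 1)"
    using assms(2) by (intro prod.cong) (fastforce simp: sgn_if)+
  moreover have "(\<Prod>k\<in>{m<..N}. sgn (x - e k)) = (\<Prod>k\<in>{m<..N}. -1)"
    using assms(3) by (intro prod.cong) (fastforce simp: sgn_if)+
  ultimately show ?thesis by simp
qed

lemma square_eq_pos_imp_real:
  fixes z :: complex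
  assumes "z\<^sup>2 = of_real r" and "r > 0"
  shows "z \<in> \<real>" "z \<noteq> 0"
proof -
  have "(complex_of_real (sqrt r))\<^sup>2 = of_real r"
    using assms by (metis less_imp_le of_real_power real_sqrt_pow2)
  then have "z\<^sup>2 = (of_real (sqrt r))\<^sup>2" using assms by simp
  then have "z = of_real (sqrt r) \<or> z = - of_real (sqrt r)" by (simp add: power2_eq_iff)
  then show "z \<in> \<real>" by auto
  show "z \<noteq> 0" using assms by auto
qed

lemma square_eq_neg_imp_imag:
  fixes z :: complex
  assumes "z\<^sup>2 = of_real r" and "r < 0"
  shows "Re z = 0" "z \<noteq> 0"
proof -
  have "(\<i> * z)\<^sup>2 = of_real (- r)" using assms by (simp add: power_mult_distrib)
  from square_eq_pos_imp_real[OF this] assms show "Re z = 0" "z \<noteq> 0"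
    by (auto simp: complex_is_Real_iff)
qed


section \<open>An integrable majorant\<close>

lemma inverse_sqrt_abs_integrable:
  fixes a b c :: real
  shows "(\<lambda>x. 1 / sqrt \<bar>x - c\<bar>) integrable_on {a..b}"
proof -
  have pos: "(\<lambda>x. 1 / sqrt \<bar>x\<bar>) integrable_on {0..d}" if "d \<ge> 0" for d :: real
  proof (rule integrable_eq)
    show "(\<lambda>x. x powr (- 1 / 2)) integrable_on {0..d}"
      using that by (intro integrable_on_powr_from_0) auto
    fix x :: real assume "x \<in> {0..d}"
    then show "x powr (- 1 / 2) = 1 / sqrt \<bar>x\<bar>"
      using powr_minus_divide[of x "1/2"] by (simp add: powr_half_sqrt)
  qed
  have neg: "(\<lambda>x. 1 / sqrt \<bar>x\<bar>) integrable_on {-d..0}" if "d \<ge> 0" for d :: real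
    using Henstock_Kurzweil_Integration.integrable_reflect_real[of "\<lambda>x. 1 / sqrt \<bar>x\<bar>" d 0] pos[OF that] by simp
  define d where "d = max \<bar>a - c\<bar> \<bar>b - c\<bar>"
  have "(\<lambda>x. 1 / sqrt \<bar>x\<bar>) integrable_on {-d..d}"
    by (rule Henstock_Kurzweil_Integration.integrable_combine[OF _ _ neg pos]) (auto simp: d_def)
  then have "(\<lambda>x. 1 / sqrt \<bar>x - c\<bar>) integrable_on {-d + c..d + c}"
    using has_integral_shift_real_ivl[of "\<lambda>x. 1 / sqrt \<bar>x\<bar>" _ "-d" d "-c"]
    by (auto simp: integrable_on_def)
  then show ?thesis
    by (rule integrable_on_subinterval) (auto simp: d_def)
qed

text \<open>Doubling the angle and using y cos y \<le> sin y at y = x/2 gives sin x \<ge> x cos^2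
  (x/2), and cos^2 (x/2) \<ge> 1/2 because cos x \<ge> 0. Any positive constant in place of 1/2
  would do for the integrability below.\<close>

lemma sin_ge_half:
  fixes x :: real
  assumes "0 \<le> x" "x \<le> pi / 2"
  shows "x / 2 \<le> sin x"
proof -
  have h: "y * cos y \<le> sin y" if "0 \<le> y" "y \<le> pi" for y :: real
  proof -
    have "(\<lambda>y. sin y - y * cos y) 0 \<le> (\<lambda>y. sin y - y * cos y) y"
    proof (rule DERIV_nonneg_imp_nondecreasing[OF that(1)])
      fix z assume z: "0 \<le> z" "z \<le> y"
      show "\<exists>d. ((\<lambda>y. sin y - y * cos y) has_real_derivative d) (at z) \<and> 0 \<le> d"
        using z that by (intro exI[of _ "z * sin z"] conjI)
          (auto intro!: derivative_eq_intros mult_nonneg_nonneg sin_ge_zero)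
    qed
    then show ?thesis by simp
  qed
  have c: "cos x \<ge> 0" using assms by (intro cos_ge_zero) auto
  have "cos x = 2 * (cos (x / 2))\<^sup>2 - 1" using cos_double_cos[of "x / 2"] by simp
  with c have c2: "(cos (x / 2))\<^sup>2 \<ge> 1 / 2" by simp
  have "x / 2 \<le> x * (cos (x / 2))\<^sup>2" using mult_left_mono[OF c2 assms(1)] by simp
  also have "\<dots> = 2 * ((x / 2) * cos (x / 2)) * cos (x / 2)" by (simp add: power2_eq_square)
  also have "\<dots> \<le> 2 * sin (x / 2) * cos (x / 2)"
    using assms h[of "x / 2"] by (intro mult_right_mono cos_ge_zero) auto
  also have "\<dots> = sin x" using sin_double[of "x / 2"] by simp
  finally show ?thesis .
qed

text \<open>Every point of the interval is within pi/2 of one of the zeros -pi, 0, pi of the sine,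
  and there the sine is at least half the distance \<open>w\<close>. The three terms of the bound
  belong to these zeros; at a zero itself both sides are harmless because 1 / 0 = 0.\<close>

lemma inverse_sqrt_abs_sin_integrable: "(\<lambda>u. 1 / sqrt \<bar>sin u\<bar>) integrable_on {-pi..pi}"
proof (rule measurable_bounded_by_integrable_imp_integrable)
  let ?g = "\<lambda>u. sqrt 2 * (1 / sqrt \<bar>u - 0\<bar>) + sqrt 2 * (1 / sqrt \<bar>u - pi\<bar>) + sqrt 2 * (1 / sqrt \<bar>u - (- pi)\<bar>)"
  show "(\<lambda>u. 1 / sqrt \<bar>sin u\<bar> :: real) \<in> borel_measurable (lebesgue_on {-pi..pi})"
    by (intro measurable_restrict_space1 measurable_completion) measurable
  show "?g integrable_on {-pi..pi}"
    by (intro integrable_add integrable_on_mult_right inverse_sqrt_abs_integrable)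
  show "norm (1 / sqrt \<bar>sin u\<bar>) \<le> ?g u" if u: "u \<in> {-pi..pi}" for u
  proof -
    have key: "1 / sqrt \<bar>sin u\<bar> \<le> sqrt 2 * (1 / sqrt \<bar>w\<bar>)" if "\<bar>sin u\<bar> = \<bar>sin w\<bar>" "\<bar>w\<bar> \<le> pi / 2" for w
    proof (cases "w = 0")
      case True then show ?thesis using that by simp
    next
      case False
      have "\<bar>w\<bar> / 2 \<le> sin \<bar>w\<bar>" using that by (intro sin_ge_half) auto
      also have "\<dots> \<le> \<bar>sin w\<bar>" by (auto simp: abs_if)
      finally have "sqrt (\<bar>w\<bar> / 2) \<le> sqrt \<bar>sin u\<bar>" using that by simp
      then have "1 / sqrt \<bar>sin u\<bar> \<le> 1 / sqrt (\<bar>w\<bar> / 2)" using False by (intro divide_left_mono mult_pos_pos) auto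
      then show ?thesis by (simp add: real_sqrt_divide)
    qed
    consider "\<bar>u\<bar> \<le> pi / 2" | "u \<ge> pi / 2" | "u \<le> - pi / 2" by linarith
    then have "1 / sqrt \<bar>sin u\<bar> \<le> ?g u"
    proof cases
      case 1 then show ?thesis using key[of u] by (simp add: add_increasing2)
    next
      case 2 then show ?thesis using key[of "u - pi"] u by (simp add: add_increasing2 add_increasing)
    next
      case 3 then show ?thesis using key[of "u + pi"] u by (simp add: add_increasing2 add_increasing)
    qed
    then show ?thesis by simp
  qed
qed auto

text \<open>At most one factor can be large, the others being at most 1 / sqrt d. Singularities
  therefore never multiply, and a product of inverse square roots is as integrable as their
  sum.\<close>

lemma prod_inverse_sqrt_bound:
  fixes s :: "'k \<Rightarrow> real"
  assumes "finite S" "S \<noteq> {}" "0 < d" "d \<le> 1"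
    and s: "\<And>k. k \<in> S \<Longrightarrow> 0 \<le> s k" "\<And>k. k \<in> S \<Longrightarrow> s k \<le> 1"
    and sep: "\<And>k l. k \<in> S \<Longrightarrow> l \<in> S \<Longrightarrow> k \<noteq> l \<Longrightarrow> s k < d \<Longrightarrow> s l \<ge> d"
  shows "(\<Prod>k\<in>S. 1 / sqrt (s k)) \<le> (1 / sqrt d) ^ card S * (\<Sum>k\<in>S. 1 / sqrt (s k))"
proof -
  have inv: "1 / sqrt (s k) \<le> 1 / sqrt d" if "k \<in> S" "s k \<ge> d" for k
    using that \<open>0 < d\<close> by (intro divide_left_mono mult_pos_pos) auto
  have d1: "1 \<le> 1 / sqrt d" using assms by simp
  show ?thesis
  proof (cases "\<exists>k\<in>S. s k < d")
    case False
    then have big: "\<And>k. k \<in> S \<Longrightarrow> s k \<ge> d" by (auto simp: not_less)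
    have "(\<Prod>k\<in>S. 1 / sqrt (s k)) \<le> (\<Prod>k\<in>S. 1 / sqrt d)"
      using s big inv by (intro prod_mono) auto
    also have "\<dots> = (1 / sqrt d) ^ card S * 1" by simp
    also have "\<dots> \<le> (1 / sqrt d) ^ card S * (\<Sum>k\<in>S. 1 / sqrt (s k))"
    proof (rule mult_left_mono)
      obtain k where k: "k \<in> S" using assms by auto
      have "1 \<le> 1 / sqrt (s k)" using s[OF k] big[OF k] \<open>0 < d\<close> by simp
      also have "\<dots> \<le> (\<Sum>k\<in>S. 1 / sqrt (s k))"
        using k assms by (intro member_le_sum) auto
      finally show "1 \<le> (\<Sum>k\<in>S. 1 / sqrt (s k))" .
    qed (use \<open>0 < d\<close> in auto)
    finally show ?thesis .
  next
    case True
    then obtain k where k: "k \<in> S" "s k < d" by auto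
    have "(\<Prod>k\<in>S. 1 / sqrt (s k)) = 1 / sqrt (s k) * (\<Prod>l\<in>S - {k}. 1 / sqrt (s l))"
      using assms k by (subst prod.remove[of S k]) auto
    also have "\<dots> \<le> 1 / sqrt (s k) * (\<Prod>l\<in>S - {k}. 1 / sqrt d)"
      using s k sep inv by (intro mult_left_mono prod_mono) auto
    also have "\<dots> = (1 / sqrt d) ^ (card S - 1) * (1 / sqrt (s k))"
      using assms k by (simp add: card_Diff_singleton)
    also have "\<dots> \<le> (1 / sqrt d) ^ card S * (\<Sum>k\<in>S. 1 / sqrt (s k))"
      using d1 s k assms by (intro mult_mono power_increasing member_le_sum) auto
    finally show ?thesis .
  qed
qed

text \<open>The interval is one full period of the absolute value of the sine, so -pi/2 and pi/2 are
  the same singularity. The half-open range for \<open>th\<close> makes distinct points distinct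
  modulo pi.\<close>

lemma sqrt_sin_product_integrable:
  fixes th :: "'k \<Rightarrow> real"
  assumes "finite S" "S \<noteq> {}" and inj: "inj_on th S"
    and th: "\<And>k. k \<in> S \<Longrightarrow> - (pi / 2) < th k" "\<And>k. k \<in> S \<Longrightarrow> th k \<le> pi / 2"
  shows "(\<lambda>t. \<Prod>k\<in>S. 1 / sqrt \<bar>sin (t - th k)\<bar>) integrable_on {-(pi / 2)..pi / 2}"
proof -
  \<comment> \<open>By the addition theorem, |sin (th k - th l)| is at most |sin (t - th k)| + |sin
    (t - th l)|; with half of it as threshold, the last two sines cannot both lie below
    \<open>d\<close>. Inserting 1 gives d \<le> 1 and a nonempty set even for a single
    point.\<close>
  define D where "D = insert 1 ((\<lambda>(k, l). \<bar>sin (th k - th l)\<bar> / 2) ` {(k, l) \<in> S \<times> S. k \<noteq> l})"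
  define d where "d = Min D"
  have "finite {(k, l) \<in> S \<times> S. k \<noteq> l}"
    by (rule finite_subset[of _ "S \<times> S"]) (use assms in auto)
  then have finD: "finite D" by (simp add: D_def)
  have posD: "0 < x" if "x \<in> D" for x
  proof -
    have "sin (th k - th l) \<noteq> 0" if "k \<in> S" "l \<in> S" "k \<noteq> l" for k l
    proof -
      have "th k \<noteq> th l" using inj that by (auto simp: inj_on_def)
      moreover have "\<bar>th k - th l\<bar> < pi" using th[OF that(1)] th[OF that(2)] by (auto simp: abs_if)
      ultimately show ?thesis using sin_zero_pi_iff by fastforce
    qed
    then show ?thesis using that by (auto simp: D_def)
  qed
  have d: "0 < d" "d \<le> 1"
    using finD posD Min_in[of D] Min_le[of D 1] by (auto simp: d_def D_def)
  have sep: "\<bar>sin (t - th l)\<bar> \<ge> d" if "k \<in> S" "l \<in> S" "k \<noteq> l" "\<bar>sin (t - th k)\<bar> < d" for k l t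
  proof (rule ccontr)
    assume c: "\<not> ?thesis"
    have "d \<le> \<bar>sin (th k - th l)\<bar> / 2"
      unfolding d_def by (rule Min_le[OF finD]) (use that in \<open>auto simp: D_def\<close>)
    moreover have "\<bar>sin (th k - th l)\<bar> \<le> \<bar>sin (t - th l)\<bar> + \<bar>sin (t - th k)\<bar>"
    proof -
      have "sin (th k - th l) = sin ((t - th l) - (t - th k))" by simp
      also have "\<dots> = sin (t - th l) * cos (t - th k) - cos (t - th l) * sin (t - th k)"
        by (rule sin_diff)
      finally have "\<bar>sin (th k - th l)\<bar> \<le> \<bar>sin (t - th l)\<bar> * \<bar>cos (t - th k)\<bar> + \<bar>cos (t - th l)\<bar> * \<bar>sin (t - th k)\<bar>"
        by (simp add: abs_mult[symmetric])
      also have "\<dots> \<le> \<bar>sin (t - th l)\<bar> * 1 + 1 * \<bar>sin (t - th k)\<bar>"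
        by (intro add_mono mult_left_mono mult_right_mono) auto
      finally show ?thesis by simp
    qed
    ultimately show False using that c by linarith
  qed
  show ?thesis
  proof (rule measurable_bounded_by_integrable_imp_integrable)
    let ?g = "\<lambda>t. (1 / sqrt d) ^ card S * (\<Sum>k\<in>S. 1 / sqrt \<bar>sin (t - th k)\<bar>)"
    show "(\<lambda>t. \<Prod>k\<in>S. 1 / sqrt \<bar>sin (t - th k)\<bar>) \<in> borel_measurable (lebesgue_on {-(pi / 2)..pi / 2})"
      by (intro measurable_restrict_space1 measurable_completion) measurable
    show "?g integrable_on {-(pi / 2)..pi / 2}"
    proof (intro integrable_on_mult_right integrable_sum \<open>finite S\<close>)
      fix k assume k: "k \<in> S"
      obtain I where "((\<lambda>u. 1 / sqrt \<bar>sin u\<bar>) has_integral I) {-pi..pi}"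
        using inverse_sqrt_abs_sin_integrable by auto
      from has_integral_shift_real_ivl[OF this, of "- th k"]
      have "(\<lambda>t. 1 / sqrt \<bar>sin (t - th k)\<bar>) integrable_on {-pi + th k..pi + th k}"
        by auto
      then show "(\<lambda>t. 1 / sqrt \<bar>sin (t - th k)\<bar>) integrable_on {-(pi / 2)..pi / 2}"
        by (rule integrable_on_subinterval) (use th[OF k] in auto)
    qed
    show "norm (\<Prod>k\<in>S. 1 / sqrt \<bar>sin (t - th k)\<bar>) \<le> ?g t" for t
    proof -
      have "0 \<le> (\<Prod>k\<in>S. 1 / sqrt \<bar>sin (t - th k)\<bar>)" by (intro prod_nonneg) auto
      moreover have "(\<Prod>k\<in>S. 1 / sqrt \<bar>sin (t - th k)\<bar>) \<le> ?g t"
        using assms d sep by (intro prod_inverse_sqrt_bound) auto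
      ultimately show ?thesis by simp
    qed
  qed auto
qed


section \<open>Iterated integrals along a partition\<close>

text \<open>Dominated convergence is used twice: the inner integrals are bounded by the total
  integral of \<open>K\<close>, so that this constant times \<open>K\<close> dominates the outer
  integrand. It carries Cauchy's theorem from the shifted paths to the real axis.\<close>

lemma iterated_integral_limit:
  fixes f h :: "nat \<Rightarrow> real \<Rightarrow> complex" and F H :: "real \<Rightarrow> complex" and K :: "real \<Rightarrow> real"
  assumes K: "K integrable_on {a..b}"
    and f: "\<And>n. f n integrable_on {a..b}" "\<And>n t. t \<in> {a..b} \<Longrightarrow> norm (f n t) \<le> K t"
           "\<And>t. t \<in> {a..b} \<Longrightarrow> (\<lambda>n. f n t) \<longlonglongrightarrow> F t"
    and h: "\<And>n t. t \<in> {a..b} \<Longrightarrow> norm (h n t) \<le> K t"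
           "\<And>t. t \<in> {a..b} \<Longrightarrow> (\<lambda>n. h n t) \<longlonglongrightarrow> H t"
    and zero: "\<And>n. integral {a..b} (f n) = 0"
              "\<And>n. ((\<lambda>t. integral {a..t} (f n) * h n t) has_integral 0) {a..b}"
  shows "F integrable_on {a..b}" "integral {a..b} F = 0"
    "((\<lambda>t. integral {a..t} F * H t) has_integral 0) {a..b}"
proof -
  show "F integrable_on {a..b}"
    by (rule dominated_convergence[OF f(1) K f(2) f(3)])
  have "(\<lambda>n. integral {a..b} (f n)) \<longlonglongrightarrow> integral {a..b} F"
    by (rule dominated_convergence[OF f(1) K f(2) f(3)])
  then show "integral {a..b} F = 0"
    using zero by (simp add: LIMSEQ_const_iff)
  show "((\<lambda>t. integral {a..t} F * H t) has_integral 0) {a..b}"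
  proof (rule has_integral_dominated_convergence[OF zero(2)])
    show "(\<lambda>t. integral {a..b} K * K t) integrable_on {a..b}"
      by (rule integrable_on_mult_right[OF K])
    have sub: "K integrable_on {a..t}" "f n integrable_on {a..t}" if "t \<in> {a..b}" for n t
      using that integrable_on_subinterval[OF K] integrable_on_subinterval[OF f(1)] by auto
    have K0: "0 \<le> K t" if "t \<in> {a..b}" for t
      using f(2)[OF that] norm_ge_zero order_trans by blast
    show "\<forall>t\<in>{a..b}. norm (integral {a..t} (f n) * h n t) \<le> integral {a..b} K * K t" for n
    proof
      fix t assume t: "t \<in> {a..b}"
      have "norm (integral {a..t} (f n)) \<le> integral {a..t} K"
        using t f(2) by (intro integral_norm_bound_integral sub) auto
      also have "\<dots> \<le> integral {a..b} K"
        using t K0 by (intro integral_subset_le sub K) auto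
      finally show "norm (integral {a..t} (f n) * h n t) \<le> integral {a..b} K * K t"
        using h(1)[OF t] integral_nonneg[OF K K0] unfolding norm_mult by (intro mult_mono) auto
    qed
    show "\<forall>t\<in>{a..b}. (\<lambda>n. integral {a..t} (f n) * h n t) \<longlonglongrightarrow> integral {a..t} F * H t"
    proof
      fix t assume t: "t \<in> {a..b}"
      have "(\<lambda>n. integral {a..t} (f n)) \<longlonglongrightarrow> integral {a..t} F"
        by (rule dominated_convergence[OF sub(2)[OF t] sub(1)[OF t]]) (use t f in auto)
      then show "(\<lambda>n. integral {a..t} (f n) * h n t) \<longlonglongrightarrow> integral {a..t} F * H t"
        using h(2)[OF t] by (intro tendsto_mult)
    qed
  qed auto
qed

lemma integral_partition:
  fixes f :: "real \<Rightarrow> 'a :: banach" and p :: "nat \<Rightarrow> real"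
  assumes "f integrable_on {p 0..p N}" and "\<And>i j. i \<le> j \<Longrightarrow> j \<le> N \<Longrightarrow> p i \<le> p j" and "m \<le> N"
  shows "integral {p 0..p m} f = (\<Sum>i<m. integral {p i..p (i + 1)} f)"
  using \<open>m \<le> N\<close>
proof (induction m)
  case (Suc m)
  have "integral {p 0..p m} f + integral {p m..p (Suc m)} f = integral {p 0..p (Suc m)} f"
    using Suc.prems assms(2) by (intro Henstock_Kurzweil_Integration.integral_combine integrable_on_subinterval[OF assms(1)]) auto
  with Suc show ?case by simp
qed simp

text \<open>For a function that is not integrable the value is the default 0, which is real too. For
  the differentials dr this allows arguing from the reality of the integrand alone.\<close>

lemma integral_in_Reals:
  fixes f :: "real \<Rightarrow> complex"
  assumes "\<And>t. t \<in> S \<Longrightarrow> f t \<in> \<real>"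
  shows "integral S f \<in> \<real>"
proof (cases "f integrable_on S")
  case True
  then have "Im (integral S f) = integral S (\<lambda>t. Im (f t))"
    by (intro integral_unique[symmetric] has_integral_Im integrable_integral)
  also have "\<dots> = integral S (\<lambda>t. 0)"
    using assms by (intro integral_cong) (simp add: complex_is_Real_iff)
  finally show ?thesis by (simp add: complex_is_Real_iff)
qed (simp add: not_integrable_integral)

lemma Re_integral_eq_0:
  fixes f :: "real \<Rightarrow> complex"
  assumes "\<And>t. t \<in> S \<Longrightarrow> Re (f t) = 0"
  shows "Re (integral S f) = 0"
proof -
  have "integral S (\<lambda>t. \<i> * f t) \<in> \<real>"
    using assms by (intro integral_in_Reals) (simp add: complex_is_Real_iff)
  then show ?thesis by (simp add: complex_is_Real_iff)
qed

text \<open>On one interval the primitive of \<open>f\<close> is its value at the left end plus a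
  local integral. The local integral times \<open>h\<close> is real, as a product of two real or two
  imaginary numbers, so only the left-end values enter the imaginary part.\<close>

lemma Im_iterated_integral_partition:
  fixes f h :: "real \<Rightarrow> complex" and p :: "nat \<Rightarrow> real"
  assumes f: "f integrable_on {p 0..p N}" and h: "h integrable_on {p 0..p N}"
    and p: "\<And>i j. i \<le> j \<Longrightarrow> j \<le> N \<Longrightarrow> p i \<le> p j"
    and zero: "((\<lambda>t. integral {p 0..t} f * h t) has_integral 0) {p 0..p N}"
    and alt: "\<And>i. i < N \<Longrightarrow> (\<forall>t\<in>{p i..p (i + 1)}. f t \<in> \<real> \<and> h t \<in> \<real>) \<or>
                            (\<forall>t\<in>{p i..p (i + 1)}. Re (f t) = 0 \<and> Re (h t) = 0)"
  shows "(\<Sum>i<N. Im ((\<Sum>j<i. integral {p j..p (j + 1)} f) * integral {p i..p (i + 1)} h)) = 0"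
proof -
  let ?G = "\<lambda>t. integral {p 0..t} f * h t"
  have sub: "g integrable_on {p i..p j}" if "i \<le> j" "j \<le> N" "g integrable_on {p 0..p N}"
    for g :: "real \<Rightarrow> complex" and i j
    using that p by (intro integrable_on_subinterval[OF that(3)]) auto
  have G: "?G integrable_on {p 0..p N}" using zero by blast
  have piece: "Im (integral {p i..p (i + 1)} ?G) =
      Im ((\<Sum>j<i. integral {p j..p (j + 1)} f) * integral {p i..p (i + 1)} h)" if i: "i < N" for i
  proof -
    let ?c = "integral {p 0..p i} f"
    have split: "integral {p 0..t} f = ?c + integral {p i..t} f" if "t \<in> {p i..p (i + 1)}" for t
      using that i p[of 0 i] p[of "i + 1" N]
      by (intro Henstock_Kurzweil_Integration.integral_combine[symmetric] integrable_on_subinterval[OF f]) auto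
    have hi: "h integrable_on {p i..p (i + 1)}" and Gi: "?G integrable_on {p i..p (i + 1)}"
      using i by (auto intro!: sub h G)
    \<comment> \<open>Integrability of the local product is inherited from the full integrand by
      subtracting a constant multiple of \<open>h\<close>.\<close>
    have loc: "(\<lambda>t. integral {p i..t} f * h t) integrable_on {p i..p (i + 1)}"
    proof (rule integrable_eq)
      show "(\<lambda>t. ?G t - ?c * h t) integrable_on {p i..p (i + 1)}"
        by (intro integrable_diff Gi integrable_on_mult_right hi)
      fix t assume "t \<in> {p i..p (i + 1)}"
      from split[OF this] show "?G t - ?c * h t = integral {p i..t} f * h t"
        by (simp only: algebra_simps)
    qed
    have "integral {p i..p (i + 1)} ?G = integral {p i..p (i + 1)} (\<lambda>t. ?c * h t + integral {p i..t} f * h t)"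
      by (intro integral_cong) (simp only: split distrib_right)
    also have "\<dots> = ?c * integral {p i..p (i + 1)} h + integral {p i..p (i + 1)} (\<lambda>t. integral {p i..t} f * h t)"
      using loc hi by (subst integral_add) (auto intro: integrable_on_mult_right)
    also have "integral {p i..p (i + 1)} (\<lambda>t. integral {p i..t} f * h t) \<in> \<real>"
    proof (rule integral_in_Reals)
      fix t assume t: "t \<in> {p i..p (i + 1)}"
      from alt[OF i] show "integral {p i..t} f * h t \<in> \<real>"
      proof
        assume "\<forall>t\<in>{p i..p (i + 1)}. f t \<in> \<real> \<and> h t \<in> \<real>"
        then show ?thesis using t by (intro Reals_mult integral_in_Reals) auto
      next
        assume a: "\<forall>t\<in>{p i..p (i + 1)}. Re (f t) = 0 \<and> Re (h t) = 0"
        then have "Re (integral {p i..t} f) = 0" using t by (intro Re_integral_eq_0) auto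
        with a t show ?thesis by (simp add: complex_is_Real_iff)
      qed
    qed
    then have "Im (?c * integral {p i..p (i + 1)} h + integral {p i..p (i + 1)} (\<lambda>t. integral {p i..t} f * h t))
        = Im (?c * integral {p i..p (i + 1)} h)" by (simp add: complex_is_Real_iff)
    also have "?c = (\<Sum>j<i. integral {p j..p (j + 1)} f)"
      using integral_partition[OF f p] i by auto
    finally show ?thesis .
  qed
  have "0 = Im (integral {p 0..p N} ?G)" using zero by (simp add: integral_unique)
  also have "integral {p 0..p N} ?G = (\<Sum>i<N. integral {p i..p (i + 1)} ?G)"
    using integral_partition[OF G p, of N] by simp
  also have "Im \<dots> = (\<Sum>i<N. Im ((\<Sum>j<i. integral {p j..p (j + 1)} f) * integral {p i..p (i + 1)} h))"
    using piece by (simp add: Im_sum)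
  finally show ?thesis by simp
qed

text \<open>
  This is the passage from the vanishing of the integral of \<open>F dG\<close> over the real line, where \<open>c\<close> and
  \<open>d\<close> are the increments of \<open>F\<close> and \<open>G\<close> over consecutive intervals, to a relation between periods.
\<close>

lemma alternating_pairing:
  fixes c d :: "nat \<Rightarrow> complex"
  assumes even: "\<And>k. k \<le> g \<Longrightarrow> Re (c (2 * k)) = 0 \<and> Re (d (2 * k)) = 0"
    and odd: "\<And>k. k \<le> g \<Longrightarrow> Im (c (2 * k + 1)) = 0 \<and> Im (d (2 * k + 1)) = 0"
    and sum0: "(\<Sum>i<2 * g + 2. c i) = 0" "(\<Sum>i<2 * g + 2. d i) = 0"
    and pair: "(\<Sum>i<2 * g + 2. Im ((\<Sum>j<i. c j) * d i)) = 0"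
  shows "(\<Sum>k=1..g. c (2 * k - 1) * (\<Sum>j=k..g. d (2 * j))) =
         (\<Sum>k=1..g. d (2 * k - 1) * (\<Sum>j=k..g. c (2 * j)))"
proof -
  define a where "a = (\<lambda>k. Re (c (2 * k + 1)))"
  define b where "b = (\<lambda>k. Im (c (2 * k)))"
  define a' where "a' = (\<lambda>k. Re (d (2 * k + 1)))"
  define b' where "b' = (\<lambda>k. Im (d (2 * k)))"
  have ce: "c (2 * k) = \<i> * b k" "d (2 * k) = \<i> * b' k" if "k \<le> g" for k
    using even[OF that] by (auto simp: b_def b'_def complex_eq_iff)
  have co: "c (2 * k + 1) = a k" "d (2 * k + 1) = a' k" if "k \<le> g" for k
    using odd[OF that] by (auto simp: a_def a'_def complex_eq_iff)
  have sums: "(\<Sum>i<2 * n. c i) = (\<Sum>k<n. complex_of_real (a k)) + \<i> * (\<Sum>k<n. complex_of_real (b k))"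
    "(\<Sum>i<2 * n. d i) = (\<Sum>k<n. complex_of_real (a' k)) + \<i> * (\<Sum>k<n. complex_of_real (b' k))" if "n \<le> g + 1" for n
    using that
  proof (induction n)
    case (Suc n)
    { case 1 then show ?case using Suc ce[of n] co[of n] by (simp add: algebra_simps) }
    { case 2 then show ?case using Suc ce[of n] co[of n] by (simp add: algebra_simps) }
  qed auto
  have "Im (\<Sum>i<2 * (g + 1). c i) = 0" "Im (\<Sum>i<2 * (g + 1). d i) = 0" using sum0 by auto
  then have B0: "(\<Sum>k\<le>g. b k) = 0" "(\<Sum>k\<le>g. b' k) = 0"
    unfolding sums[OF order.refl] by (simp_all add: lessThan_Suc_atMost Im_sum)
  \<comment> \<open>The intervals are taken in pairs. Against the imaginary \<open>d (2 * k)\<close>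
    only the preceding real increments count; against the real \<open>d (2 * k + 1)\<close> only the
    imaginary ones, by then including index k.\<close>
  have "(\<Sum>i<2 * n. Im ((\<Sum>j<i. c j) * d i)) = (\<Sum>k<n. (\<Sum>j<k. a j) * b' k + (\<Sum>j<k+1. b j) * a' k)"
    if "n \<le> g + 1" for n
    using that
  proof (induction n)
    case (Suc n)
    then have "(\<Sum>i<2 * n. Re (c i)) = (\<Sum>k<n. a k)" "(\<Sum>i<2 * n. Im (c i)) = (\<Sum>k<n. b k)"
      using arg_cong[OF sums(1)[of n], of Re] arg_cong[OF sums(1)[of n], of Im]
      by (simp_all add: Re_sum Im_sum)
    with Suc show ?case using ce[of n] co[of n] by (simp add: algebra_simps)
  qed auto
  from this[of "g + 1"] have "(\<Sum>k\<le>g. (\<Sum>j<k. a j) * b' k) + (\<Sum>k\<le>g. (\<Sum>j\<le>k. b j) * a' k) = 0"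
    using pair by (simp add: lessThan_Suc_atMost sum.distrib)
  \<comment> \<open>Since the total is 0, initial sums of gap integrals become negated tails. This
    removes the unbounded interval left of the first branch point and produces the tails of which
    \<open>omega'\<close> is made.\<close>
  moreover have tail: "(\<Sum>j\<le>k. b j) = - (\<Sum>j=k+1..g. b j)" "(\<Sum>j\<le>k. b' j) = - (\<Sum>j=k+1..g. b' j)" if "k \<le> g" for k
  proof -
    have "{..g} = {..k} \<union> {k+1..g}" using that by auto
    then have "(\<Sum>j\<le>g. f j) = (\<Sum>j\<le>k. f j) + (\<Sum>j=k+1..g. f j)" for f :: "nat \<Rightarrow> real"
      by (simp add: sum.union_disjoint)
    from this[of b] this[of b'] B0 show "(\<Sum>j\<le>k. b j) = - (\<Sum>j=k+1..g. b j)" "(\<Sum>j\<le>k. b' j) = - (\<Sum>j=k+1..g. b' j)"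
      by linarith+
  qed
  moreover have "(\<Sum>k\<le>g. (\<Sum>j\<le>k. b j) * a' k) = - (\<Sum>k\<le>g. a' k * (\<Sum>j=k+1..g. b j))"
    by (simp add: tail sum_negf mult.commute)
  moreover have "(\<Sum>k\<le>g. (\<Sum>j<k. a j) * b' k) = (\<Sum>k\<le>g. a k * (\<Sum>j=k+1..g. b' j))"
  proof -
    have "(\<Sum>k\<le>g. (\<Sum>j<k. a j) * b' k) = (\<Sum>k\<in>{..g}. \<Sum>j\<in>{..<k}. a j * b' k)"
      by (simp add: sum_distrib_right)
    also have "\<dots> = (\<Sum>(k, j)\<in>Sigma {..g} (\<lambda>k. {..<k}). a j * b' k)"
      by (simp add: sum.Sigma)
    also have "\<dots> = (\<Sum>(j, k)\<in>Sigma {..g} (\<lambda>j. {j+1..g}). a j * b' k)"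
      by (rule sum.reindex_bij_witness[of _ prod.swap prod.swap]) auto
    also have "\<dots> = (\<Sum>j\<le>g. \<Sum>k=j+1..g. a j * b' k)"
      by (simp add: sum.Sigma)
    finally show ?thesis by (simp add: sum_distrib_left)
  qed
  ultimately have main: "(\<Sum>k\<le>g. a k * (\<Sum>j=k+1..g. b' j)) = (\<Sum>k\<le>g. a' k * (\<Sum>j=k+1..g. b j))"
    by linarith
  \<comment> \<open>The term with k = g, which comes from the unbounded cut, meets an empty tail and
    drops out. The other g terms are renumbered by the cycles 1 to g.\<close>
  have shift: "(\<Sum>k\<le>g. x k * (\<Sum>j=k+1..g. z j)) = (\<Sum>k=1..g. x (k - 1) * (\<Sum>j=k..g. z j))" for x z :: "nat \<Rightarrow> real"
  proof -
    have "(\<Sum>k\<le>g. x k * (\<Sum>j=k+1..g. z j)) = (\<Sum>k<g. x k * (\<Sum>j=k+1..g. z j))"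
      by (intro sum.mono_neutral_right) auto
    also have "\<dots> = (\<Sum>k=1..g. x (k - 1) * (\<Sum>j=k..g. z j))"
      by (rule sum.reindex_bij_witness[of _ "\<lambda>k. k - 1" "\<lambda>k. k + 1"]) auto
    finally show ?thesis .
  qed
  have conv: "c (2 * k - 1) * (\<Sum>j=k..g. d (2 * j)) = \<i> * of_real (a (k - 1) * (\<Sum>j=k..g. b' j))"
    "d (2 * k - 1) * (\<Sum>j=k..g. c (2 * j)) = \<i> * of_real (a' (k - 1) * (\<Sum>j=k..g. b j))" if "k \<in> {1..g}" for k
  proof -
    have "2 * k - 1 = 2 * (k - 1) + 1" using that by auto
    moreover have "k - 1 \<le> g" using that by auto
    ultimately have "c (2 * k - 1) = a (k - 1)" "d (2 * k - 1) = a' (k - 1)"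
      using co[of "k - 1"] by simp_all
    moreover have "(\<Sum>j=k..g. c (2 * j)) = \<i> * of_real (\<Sum>j=k..g. b j)"
      "(\<Sum>j=k..g. d (2 * j)) = \<i> * of_real (\<Sum>j=k..g. b' j)"
      by (simp_all add: ce sum_distrib_left)
    ultimately show "c (2 * k - 1) * (\<Sum>j=k..g. d (2 * j)) = \<i> * of_real (a (k - 1) * (\<Sum>j=k..g. b' j))"
      "d (2 * k - 1) * (\<Sum>j=k..g. c (2 * j)) = \<i> * of_real (a' (k - 1) * (\<Sum>j=k..g. b j))"
      by simp_all
  qed
  have "(\<Sum>k=1..g. c (2 * k - 1) * (\<Sum>j=k..g. d (2 * j))) = \<i> * of_real (\<Sum>k=1..g. a (k - 1) * (\<Sum>j=k..g. b' j))"
    using conv(1) by (simp add: sum_distrib_left)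
  also have "\<dots> = \<i> * of_real (\<Sum>k=1..g. a' (k - 1) * (\<Sum>j=k..g. b j))"
    using main unfolding shift by simp
  also have "\<dots> = (\<Sum>k=1..g. d (2 * k - 1) * (\<Sum>j=k..g. c (2 * j)))"
    using conv(2) by (simp add: sum_distrib_left)
  finally show ?thesis .
qed


section \<open>The boundary values of the differentials\<close>

lemma norm_sin_squared_sinh: "(norm (sin z))\<^sup>2 = (sin (Re z))\<^sup>2 + (sinh (Im z))\<^sup>2"
proof -
  have s: "Re (sin z) = sin (Re z) * cosh (Im z)" "Im (sin z) = cos (Re z) * sinh (Im z)"
    by (simp_all add: Re_sin Im_sin sinh_def cosh_def)
  show ?thesis
    unfolding cmod_power2 s power_mult_distrib cosh_square_eq cos_squared_eq by (simp add: algebra_simps)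
qed

lemma norm_cos_squared_sinh: "(norm (cos z))\<^sup>2 = (cos (Re z))\<^sup>2 + (sinh (Im z))\<^sup>2"
  using norm_sin_squared_sinh[of "of_real pi / 2 - z"] cos_sin_eq[of z] cos_sin_eq[of "Re z"] by simp

lemma norm_sin_ge: "\<bar>sin (Re z)\<bar> \<le> norm (sin z)"
  by (rule power2_le_imp_le) (simp_all add: norm_sin_squared_sinh)

lemma norm_cos_ge: "\<bar>cos (Re z)\<bar> \<le> norm (cos z)"
  by (rule power2_le_imp_le) (simp_all add: norm_cos_squared_sinh)

lemma norm_sin_cos_le_cosh:
  assumes "0 \<le> Im z" "Im z \<le> 1"
  shows "norm (sin z) \<le> cosh 1" "norm (cos z) \<le> cosh 1"
proof -
  have "(sinh (Im z))\<^sup>2 \<le> (sinh 1)\<^sup>2" using assms by (intro power_mono) auto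
  moreover have "(sin (Re z))\<^sup>2 \<le> 1" "(cos (Re z))\<^sup>2 \<le> 1" by (auto simp: abs_square_le_1)
  moreover have "(cosh (1 :: real))\<^sup>2 = (sinh 1)\<^sup>2 + 1" by (rule cosh_square_eq)
  ultimately have "(norm (sin z))\<^sup>2 \<le> (cosh 1)\<^sup>2" "(norm (cos z))\<^sup>2 \<le> (cosh 1)\<^sup>2"
    unfolding norm_sin_squared_sinh norm_cos_squared_sinh by linarith+
  then show "norm (sin z) \<le> cosh 1" "norm (cos z) \<le> cosh 1"
    by (auto elim!: power2_le_imp_le)
qed

lemma cos_nonzero_of_Im: "Im z \<noteq> 0 \<Longrightarrow> cos z \<noteq> 0"
  using norm_cos_squared_sinh[of z] by (auto simp: sum_power2_eq_zero_iff dest: sym)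

text \<open>Clearing the denominator leaves sinh (Im z) cosh (Im z). Thus a horizontal line above
  the real axis is mapped into the open half-plane where \<open>y\<close> is holomorphic.\<close>

lemma Im_tan_pos:
  assumes "Im z > 0"
  shows "Im (tan z) > 0"
proof -
  have c: "cos z \<noteq> 0" using assms by (intro cos_nonzero_of_Im) auto
  have s: "Re (sin z) = sin (Re z) * cosh (Im z)" "Im (sin z) = cos (Re z) * sinh (Im z)"
      "Re (cos z) = cos (Re z) * cosh (Im z)" "Im (cos z) = - sin (Re z) * sinh (Im z)"
    by (simp_all add: Re_sin Im_sin Re_cos Im_cos sinh_def cosh_def field_simps)
  have "Im (tan z) = (Im (sin z) * Re (cos z) - Re (sin z) * Im (cos z)) / (norm (cos z))\<^sup>2"
    unfolding tan_def by (simp add: Im_divide cmod_power2)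
  also have "Im (sin z) * Re (cos z) - Re (sin z) * Im (cos z) =
      sinh (Im z) * cosh (Im z) * ((sin (Re z))\<^sup>2 + (cos (Re z))\<^sup>2)"
    unfolding s
    by (simp only: power2_eq_square algebra_simps mult_minus_left mult_minus_right diff_minus_eq_add)
  also have "\<dots> = sinh (Im z) * cosh (Im z)" by simp
  finally show ?thesis using assms c by simp
qed

section \<open>The curve, its differentials, and the substitution by the tangent\<close>

locale real_curve =
  fixes g :: nat and lam :: "nat \<Rightarrow> complex" and e :: "nat \<Rightarrow> real" and y :: "complex \<Rightarrow> complex"
  assumes branch_points: "real_branch_points g lam e"
    and branch: "upper_branch (Lambda g lam) y"
    and genus_pos: "g \<ge> 1"
begin

lemma y_squared: "Im z \<ge> 0 \<Longrightarrow> (y z)\<^sup>2 = (\<Prod>k\<in>{1..2 * g + 1}. z - of_real (e k))"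
  using branch Lambda_eq_prod[OF branch_points] by (auto simp: upper_branch_def)

lemma y_at_branch_point:
  assumes k: "k \<in> {1..2 * g + 1}"
  shows "y (of_real (e k)) = 0"
proof -
  have "(y (of_real (e k)))\<^sup>2 = (\<Prod>j\<in>{1..2 * g + 1}. complex_of_real (e k) - of_real (e j))"
    by (rule y_squared) simp
  also have "\<dots> = 0"
    by (rule prod_zero[OF finite_atLeastAtMost bexI[OF _ k]]) simp
  finally show ?thesis by simp
qed

lemma e_strict_mono: "i \<in> {1..2 * g + 1} \<Longrightarrow> j \<in> {1..2 * g + 1} \<Longrightarrow> i < j \<Longrightarrow> e i < e j"
  using branch_points by (auto simp: real_branch_points_def strict_mono_on_def)

text \<open>With p = g - n this is the form du of index 2n - 1; the exponents 0 to g - 1 give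
  exactly the g holomorphic differentials.\<close>

definition diff_form :: "nat \<Rightarrow> complex \<Rightarrow> complex" where
  "diff_form p z = z ^ p / (- 2 * y z)"

lemma y_nonzero: "Im z > 0 \<Longrightarrow> y z \<noteq> 0"
  using y_squared[of z] by (auto simp: prod_zero_iff)

lemma diff_form_holomorphic: "diff_form p holomorphic_on {z. Im z > 0}"
  unfolding diff_form_def
  using branch y_nonzero by (intro holomorphic_intros) (auto simp: upper_branch_def)

text \<open>The substitution \<open>x = tan t\<close> turns infinity into the two ordinary end points \<open>- pi / 2\<close> and \<open>pi / 2\<close>.\<close>

definition th :: "nat \<Rightarrow> real" where
  "th k = (if k = 0 then - (pi / 2) else if k \<le> 2 * g + 1 then arctan (e k) else pi / 2)"

lemma th_less:
  assumes "i < j" "j \<le> 2 * g + 2"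
  shows "th i < th j"
  using assms e_strict_mono[of i j] arctan_bounded[of "e i"] arctan_bounded[of "e j"]
  by (auto simp: th_def arctan_less_iff)

lemma th_mono: "i \<le> j \<Longrightarrow> j \<le> 2 * g + 2 \<Longrightarrow> th i \<le> th j"
  using th_less[of i j] by (cases "i = j") auto

lemma th_ends: "th 0 = - (pi / 2)" "th (2 * g + 2) = pi / 2"
  by (auto simp: th_def)

definition ths :: "real set" where "ths = th ` {0..2 * g + 2}"

lemma finite_ths: "finite ths"
  by (simp add: ths_def)

definition phi :: "nat \<Rightarrow> real \<Rightarrow> complex" where
  "phi p t = diff_form p (of_real (tan t)) / of_real ((cos t)\<^sup>2)"

text \<open>
  The path \<open>t \<mapsto> tan (t + \<i> * d)\<close> is a closed curve in the upper half-plane, so holomorphic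
  integrands have integral 0 along it; \<open>phi\<close> is the limit of \<open>psi d\<close> as \<open>d\<close> tends to 0.
\<close>

definition psi :: "real \<Rightarrow> nat \<Rightarrow> real \<Rightarrow> complex" where
  "psi d p t = (if t \<in> ths then 0 else diff_form p (tan (Complex t d)) / (cos (Complex t d))\<^sup>2)"

text \<open>One factor for each of the 2g+2 branch points. The last, with
  \<open>th (2 * g + 2)\<close> = pi/2, belongs to infinity and equals 1 / sqrt |cos t|; the index 0
  is left out because -pi/2 is the same point modulo pi.\<close>

definition majorant :: "real \<Rightarrow> real" where
  "majorant t = (\<Prod>k\<in>{1..2 * g + 2}. 1 / sqrt \<bar>sin (t - th k)\<bar>)"

lemma majorant_nonneg: "0 \<le> majorant t"
  unfolding majorant_def by (intro prod_nonneg) auto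

lemma majorant_integrable: "majorant integrable_on {-(pi / 2)..pi / 2}"
proof -
  have "inj_on th {1..2 * g + 2}"
    by (intro linorder_inj_onI) (auto dest: th_less)
  moreover have "- (pi / 2) < th k" "th k \<le> pi / 2" if "k \<in> {1..2 * g + 2}" for k
    using that th_less[of 0 k] th_mono[of k "2 * g + 2"] th_ends by auto
  ultimately show ?thesis
    unfolding majorant_def by (intro sqrt_sin_product_integrable) auto
qed

lemma sin_th_nonzero:
  assumes "t \<in> {-(pi / 2)..pi / 2} - ths" "k \<le> 2 * g + 2"
  shows "sin (t - th k) \<noteq> 0"
proof -
  have "th j \<in> ths" if "j \<le> 2 * g + 2" for j using that by (auto simp: ths_def)
  from this[of k] this[of 0] this[of "2 * g + 2"]
  have "th k \<in> ths" "- (pi / 2) \<in> ths" "pi / 2 \<in> ths" using assms unfolding th_ends by auto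
  moreover have "t \<notin> ths" using assms by simp
  ultimately have "t \<noteq> th k" "t \<noteq> - (pi / 2)" "t \<noteq> pi / 2" by metis+
  moreover have "th 0 \<le> th k" "th k \<le> th (2 * g + 2)" using assms by (auto intro: th_mono)
  ultimately show ?thesis
    using assms sin_eq_0_pi[of "t - th k"] unfolding th_ends by auto
qed

text \<open>Writing e_k = tan (th k), each factor obeys (tan z - e_k) cos z cos (th k) = sin (z - th
  k). The poles of the tangent are absorbed by the power of the cosine.\<close>

lemma y_tan_norm:
  assumes "cos z \<noteq> 0" "Im (tan z) \<ge> 0"
  shows "(norm (y (tan z)))\<^sup>2 * (norm (cos z)) ^ (2 * g + 1) =
    (\<Prod>k\<in>{1..2 * g + 1}. norm (sin (z - of_real (th k)))) / (\<Prod>k\<in>{1..2 * g + 1}. cos (th k))"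
proof -
  have 1: "norm (tan z - of_real (e k)) * norm (cos z) = norm (sin (z - of_real (th k))) / cos (th k)"
    if k: "k \<in> {1..2 * g + 1}" for k
  proof -
    have th: "th k = arctan (e k)" using k by (simp add: th_def)
    have c: "cos (th k) > 0" unfolding th by (intro cos_gt_zero_pi arctan_lbound arctan_ubound)
    have ek: "e k = sin (th k) / cos (th k)" using tan_arctan[of "e k"] by (simp add: th tan_def)
    have "(tan z - of_real (e k)) * cos z * of_real (cos (th k)) = sin (z - of_real (th k))"
      unfolding ek sin_diff tan_def using c assms
      by (simp add: field_simps sin_of_real cos_of_real)
    then have "norm (tan z - of_real (e k)) * norm (cos z) * \<bar>cos (th k)\<bar> = norm (sin (z - of_real (th k)))"
      by (metis norm_mult norm_of_real)
    then show ?thesis using c by (simp add: field_simps)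
  qed
  have "(norm (y (tan z)))\<^sup>2 * (norm (cos z)) ^ (2 * g + 1) =
    (\<Prod>k\<in>{1..2 * g + 1}. norm (tan z - of_real (e k)) * norm (cos z))"
    using y_squared[OF assms(2)] by (simp add: norm_power[symmetric] prod_norm prod.distrib)
  also have "\<dots> = (\<Prod>k\<in>{1..2 * g + 1}. norm (sin (z - of_real (th k))) / cos (th k))"
    by (intro prod.cong refl 1)
  finally show ?thesis by (simp add: prod_dividef)
qed

text \<open>Squaring removes the root in \<open>y\<close>. Multiplying by the (2g+2)-nd power of
  |cos z| brings in \<open>y_tan_norm\<close>, and cancelling the power 2p+4 leaves N^2 PS |cos z| =
  PC/4 |sin z|^(2p) |cos z|^(2q) with p + q = g - 1. Here p \<le> g - 1, the holomorphy at infinity,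
  is decisive. The right side is bounded since Im z \<le> 1, and the complex sines in
  \<open>PS\<close> dominate the real ones in \<open>PT\<close>, so the estimate is uniform in
  \<open>d\<close>.\<close>

lemma psi_bound:
  assumes d: "0 < d" "d \<le> 1" and t: "t \<in> {-(pi / 2)..pi / 2}" and p: "p \<le> g - 1"
  shows "norm (psi d p t) \<le> (cosh 1) ^ (g - 1) * majorant t"
proof (cases "t \<in> ths")
  case True
  then show ?thesis using majorant_nonneg[of t] by (simp add: psi_def)
next
  case False
  define z where "z = Complex t d"
  define N where "N = norm (psi d p t)"
  define PS where "PS = (\<Prod>k\<in>{1..2 * g + 1}. norm (sin (z - of_real (th k))))"
  define PC where "PC = (\<Prod>k\<in>{1..2 * g + 1}. cos (th k))"
  define PT where "PT = (\<Prod>k\<in>{1..2 * g + 2}. \<bar>sin (t - th k)\<bar>)"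
  define q where "q = g - 1 - p"
  have gq: "g = p + q + 1" using p genus_pos by (simp add: q_def)
  have c: "cos z \<noteq> 0" using d by (intro cos_nonzero_of_Im) (simp add: z_def)
  have Imt: "Im (tan z) > 0" using d by (intro Im_tan_pos) (simp add: z_def)
  have cth: "0 < cos (th k)" if "k \<in> {1..2 * g + 1}" for k
    using that by (auto intro!: cos_gt_zero_pi arctan_lbound arctan_ubound simp: th_def)
  have PC: "0 < PC" "PC \<le> 1"
    unfolding PC_def by (rule prod_pos[OF cth], assumption) (rule prod_le_1, simp add: less_imp_le[OF cth])
  have y0: "y (tan z) \<noteq> 0" by (rule y_nonzero[OF Imt])
  have PT0: "PT > 0"
    unfolding PT_def using sin_th_nonzero[of t] t False by (intro prod_pos) auto
  have yy: "(norm (y (tan z)))\<^sup>2 * norm (cos z) ^ (2 * g + 1) = PS / PC"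
    using y_tan_norm[OF c less_imp_le[OF Imt]] by (simp add: PS_def PC_def)
  have "N = norm (sin z) ^ p / (norm (cos z) ^ (p + 2) * (2 * norm (y (tan z))))"
  proof -
    have "N = norm (tan z) ^ p / (2 * norm (y (tan z))) / (norm (cos z))\<^sup>2"
      using False by (simp add: N_def psi_def diff_form_def z_def[symmetric] norm_divide norm_mult norm_power)
    moreover have "norm (tan z) = norm (sin z) / norm (cos z)"
      by (simp add: tan_def norm_divide)
    ultimately show ?thesis
      by (simp add: power_divide power_add power2_eq_square)
  qed
  then have "N * (norm (cos z) ^ (p + 2) * (2 * norm (y (tan z)))) = norm (sin z) ^ p"
    using c y0 by simp
  then have "N\<^sup>2 * (norm (cos z) ^ (2 * p + 4) * (4 * (norm (y (tan z)))\<^sup>2)) = norm (sin z) ^ (2 * p)"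
  proof -
    have sq: "(a ^ m)\<^sup>2 = a ^ (2 * m)" for a :: real and m
      by (simp flip: power_mult add: mult.commute)
    have m: "2 * (p + 2) = 2 * p + 4" by simp
    have "N\<^sup>2 * ((norm (cos z) ^ (p + 2))\<^sup>2 * (4 * (norm (y (tan z)))\<^sup>2)) =
      (N * (norm (cos z) ^ (p + 2) * (2 * norm (y (tan z)))))\<^sup>2"
      by (simp only: power_mult_distrib) simp
    also have "\<dots> = (norm (sin z) ^ p)\<^sup>2"
      by (simp only: \<open>N * _ = _\<close>)
    finally show ?thesis unfolding sq by (simp only: m)
  qed
  then have "N\<^sup>2 * (norm (cos z) ^ (2 * p + 4) * (4 * (norm (y (tan z)))\<^sup>2)) * norm (cos z) ^ (2 * g + 1) * norm (cos z) =
     norm (sin z) ^ (2 * p) * norm (cos z) ^ (2 * g + 2)"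
    by simp
  moreover have "N\<^sup>2 * (norm (cos z) ^ (2 * p + 4) * (4 * (norm (y (tan z)))\<^sup>2)) * norm (cos z) ^ (2 * g + 1) * norm (cos z) =
     4 * N\<^sup>2 * (PS / PC) * norm (cos z) * norm (cos z) ^ (2 * p + 4)"
    unfolding yy[symmetric] by (simp add: mult_ac)
  moreover have "norm (cos z) ^ (2 * g + 2) = norm (cos z) ^ (2 * q) * norm (cos z) ^ (2 * p + 4)"
  proof -
    have "2 * g + 2 = 2 * q + (2 * p + 4)" using gq by simp
    then show ?thesis by (simp only: power_add)
  qed
  ultimately have "4 * N\<^sup>2 * (PS / PC) * norm (cos z) * norm (cos z) ^ (2 * p + 4) =
      norm (sin z) ^ (2 * p) * norm (cos z) ^ (2 * q) * norm (cos z) ^ (2 * p + 4)"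
    by (metis mult.assoc)
  then have "4 * N\<^sup>2 * (PS / PC) * norm (cos z) = norm (sin z) ^ (2 * p) * norm (cos z) ^ (2 * q)"
    by (rule mult_right_cancel[THEN iffD1, rotated]) (use c in simp)
  then have "N\<^sup>2 * (PS * norm (cos z)) = PC / 4 * (norm (sin z) ^ (2 * p) * norm (cos z) ^ (2 * q))"
    using PC by (simp add: field_simps)
  also have "\<dots> \<le> 1 * (cosh 1 ^ (2 * p) * cosh 1 ^ (2 * q))"
    using PC d norm_sin_cos_le_cosh[of z]
    by (intro mult_mono power_mono mult_nonneg_nonneg zero_le_power) (auto simp: z_def)
  also have "\<dots> = (cosh 1 ^ (g - 1))\<^sup>2"
    unfolding gq by (simp add: power_add power_mult_distrib power_mult[symmetric] mult.commute)
  finally have A: "N\<^sup>2 * (PS * norm (cos z)) \<le> (cosh 1 ^ (g - 1))\<^sup>2" .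
  have "PT = (\<Prod>k\<in>{1..2 * g + 1}. \<bar>sin (t - th k)\<bar>) * \<bar>sin (t - pi / 2)\<bar>"
  proof -
    have "2 * g + 2 = Suc (2 * g + 1)" by simp
    then have "PT = \<bar>sin (t - th (2 * g + 2))\<bar> * (\<Prod>k\<in>{1..2 * g + 1}. \<bar>sin (t - th k)\<bar>)"
      unfolding PT_def by (simp only:) (rule prod.nat_ivl_Suc', simp)
    then show ?thesis unfolding th_ends by (simp only: mult.commute)
  qed
  also have "\<dots> \<le> PS * norm (cos z)"
    unfolding PS_def
  proof (intro mult_mono prod_mono conjI)
    show "\<bar>sin (t - th k)\<bar> \<le> norm (sin (z - of_real (th k)))" for k
      using norm_sin_ge[of "z - of_real (th k)"] by (simp add: z_def)
    show "\<bar>sin (t - pi / 2)\<bar> \<le> norm (cos z)"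
      using norm_cos_ge[of z] by (simp add: z_def sin_diff)
  qed (rule abs_ge_zero norm_ge_zero prod_nonneg)+
  finally have "N\<^sup>2 * PT \<le> (cosh 1 ^ (g - 1))\<^sup>2"
    using A mult_left_mono[of PT "PS * norm (cos z)" "N\<^sup>2"] by simp
  then have "N\<^sup>2 \<le> (cosh 1 ^ (g - 1))\<^sup>2 * (1 / PT)" using PT0 by (simp add: field_simps)
  also have "1 / PT = (majorant t)\<^sup>2"
  proof -
    have "(majorant t)\<^sup>2 = (\<Prod>k\<in>{1..2 * g + 2}. (1 / sqrt \<bar>sin (t - th k)\<bar>)\<^sup>2)"
      unfolding majorant_def by (rule prod_power_distrib)
    also have "\<dots> = (\<Prod>k\<in>{1..2 * g + 2}. 1 / \<bar>sin (t - th k)\<bar>)"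
      by (intro prod.cong refl) (simp add: power_divide)
    finally show ?thesis unfolding PT_def by (simp only: prod_dividef prod.neutral_const)
  qed
  finally have "N\<^sup>2 \<le> (cosh 1 ^ (g - 1) * majorant t)\<^sup>2" by (simp add: power_mult_distrib)
  then show ?thesis
    unfolding N_def by (rule power2_le_imp_le) (simp add: majorant_nonneg)
qed

text \<open>This is division by zero: \<open>y\<close> vanishes at the finite branch points and the
  cosine at the two ends. It matches the value 0 put into \<open>psi\<close>, so that convergence is
  pointwise on the entire closed interval.\<close>

lemma phi_eq_0:
  assumes "t \<in> ths"
  shows "phi p t = 0"
proof -
  obtain k where k: "k \<le> 2 * g + 2" "t = th k" using assms by (auto simp: ths_def)
  consider "k = 0" | "k \<in> {1..2 * g + 1}" | "k = 2 * g + 2" using k(1) by fastforce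
  then show ?thesis
  proof cases
    case 2
    then have tt: "tan t = e k" by (simp add: k(2) th_def tan_arctan)
    from y_at_branch_point[OF 2] show ?thesis by (simp add: phi_def diff_form_def tt)
  next
    case 1 show ?thesis unfolding k(2) 1 th_ends phi_def by simp
  next
    case 3 show ?thesis unfolding k(2) 3 th_ends phi_def by simp
  qed
qed

lemma psi_limit:
  assumes t: "t \<in> {-(pi / 2)..pi / 2}"
  shows "(\<lambda>n. psi (1 / real (Suc n)) p t) \<longlonglongrightarrow> phi p t"
proof (cases "t \<in> ths")
  case True
  then show ?thesis by (simp add: psi_def phi_eq_0)
next
  case False
  have cost: "cos t \<noteq> 0"
  proof -
    have "sin (t - pi / 2) \<noteq> 0" using sin_th_nonzero[of t "2 * g + 2"] t False unfolding th_ends by auto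
    then show ?thesis by (simp add: sin_diff)
  qed
  have z: "(\<lambda>n. Complex t (1 / real (Suc n))) \<longlonglongrightarrow> of_real t"
    unfolding complex_of_real_def by (intro tendsto_Complex tendsto_const LIMSEQ_Suc[OF lim_1_over_n])
  have co: "(\<lambda>n. cos (Complex t (1 / real (Suc n)))) \<longlonglongrightarrow> of_real (cos t)"
    using tendsto_cos[OF z] by (simp add: cos_of_real)
  have ta: "(\<lambda>n. tan (Complex t (1 / real (Suc n)))) \<longlonglongrightarrow> of_real (tan t)"
    using tendsto_divide[OF tendsto_sin[OF z] tendsto_cos[OF z]] cost
    by (simp add: cos_of_real sin_of_real tan_def)
  have "(\<lambda>n. y (tan (Complex t (1 / real (Suc n))))) \<longlonglongrightarrow> y (of_real (tan t))"
  proof (rule continuous_on_tendsto_compose[OF _ ta])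
    show "continuous_on {z. 0 \<le> Im z} y" using branch by (simp add: upper_branch_def)
    show "\<forall>\<^sub>F n in sequentially. tan (Complex t (1 / real (Suc n))) \<in> {z. 0 \<le> Im z}"
      by (intro always_eventually allI) (simp add: Im_tan_pos less_imp_le)
  qed auto
  moreover have "y (of_real (tan t)) \<noteq> 0"
  proof
    assume "y (of_real (tan t)) = 0"
    then have "(\<Prod>k\<in>{1..2 * g + 1}. complex_of_real (tan t) - of_real (e k)) = 0"
      using y_squared[of "of_real (tan t)"] by simp
    then have "\<exists>k\<in>{1..2 * g + 1}. complex_of_real (tan t) - of_real (e k) = 0"
      by (subst (asm) prod_zero_iff) simp_all
    then obtain k where k: "k \<in> {1..2 * g + 1}" "tan t = e k" by auto
    have "- (pi / 2) \<noteq> t" "t \<noteq> pi / 2" using cost by (metis cos_minus cos_pi_half)+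
    then have "arctan (tan t) = t" using t by (intro arctan_tan) auto
    then have "t = th k" using k by (simp add: th_def)
    then show False using k False by (auto simp: ths_def)
  qed
  ultimately have "(\<lambda>n. diff_form p (tan (Complex t (1 / real (Suc n)))) / (cos (Complex t (1 / real (Suc n))))\<^sup>2)
     \<longlonglongrightarrow> diff_form p (of_real (tan t)) / (of_real (cos t))\<^sup>2"
    unfolding diff_form_def using cost by (intro tendsto_intros ta co) auto
  then show ?thesis using False by (simp add: psi_def phi_def)
qed

section \<open>Cauchy's theorem on the shifted path and its limit on the real axis\<close>

lemma tan_path_has_integral:
  assumes d: "0 < d" and ab: "a \<le> b"
    and G: "\<And>z. Im z > 0 \<Longrightarrow> (G has_field_derivative h z) (at z)"
  shows "((\<lambda>t. if t \<in> ths then 0 else h (tan (Complex t d)) / (cos (Complex t d))\<^sup>2) has_integral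
    G (tan (Complex b d)) - G (tan (Complex a d))) {a..b}"
proof (rule has_integral_spike_finite[OF finite_ths])
  have "((\<lambda>t. G (tan (Complex t d))) has_vector_derivative h (tan (Complex t d)) / (cos (Complex t d))\<^sup>2) (at t)" for t
  proof -
    have C: "Complex s d = of_real s + \<i> * of_real d" for s by (simp add: complex_eq_iff)
    have c: "cos (of_real t + \<i> * of_real d) \<noteq> 0"
      using d by (intro cos_nonzero_of_Im) simp
    have I: "Im (tan (of_real t + \<i> * of_real d)) > 0"
      using d by (intro Im_tan_pos) simp
    have "((\<lambda>z. tan (z + \<i> * of_real d)) has_field_derivative inverse ((cos (of_real t + \<i> * of_real d))\<^sup>2)) (at (of_real t))"
      using c by (auto intro!: derivative_eq_intros)
    from DERIV_chain2[OF G[OF I] this]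
    have "((\<lambda>z. G (tan (z + \<i> * of_real d))) has_field_derivative
        h (tan (of_real t + \<i> * of_real d)) / (cos (of_real t + \<i> * of_real d))\<^sup>2) (at (of_real t))"
      by (simp add: divide_inverse)
    from has_vector_derivative_real_field[OF this] show ?thesis unfolding C .
  qed
  then show "((\<lambda>t. h (tan (Complex t d)) / (cos (Complex t d))\<^sup>2) has_integral
      G (tan (Complex b d)) - G (tan (Complex a d))) {a..b}"
    by (intro fundamental_theorem_of_calculus ab) (auto intro: has_vector_derivative_at_within)
qed auto

lemma tan_path_closed: "tan (Complex (pi / 2) d) = tan (Complex (- (pi / 2)) d)"
proof -
  have "Complex (pi / 2) d = Complex (- (pi / 2)) d + of_real pi" by (simp add: complex_eq_iff)
  then show ?thesis by (simp only: tan_def sin_add cos_add sin_of_real cos_of_real) simp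
qed

lemma upper_half_plane_primitive:
  assumes "h holomorphic_on {z. Im z > 0}"
  obtains G where "\<And>z. Im z > 0 \<Longrightarrow> (G has_field_derivative h z) (at z)"
proof -
  have op: "open {z. Im z > 0}" by (rule open_halfspace_Im_gt)
  from holomorphic_convex_primitive'[OF convex_halfspace_Im_gt op assms]
  obtain G where "\<And>z. z \<in> {z. Im z > 0} \<Longrightarrow> (G has_field_derivative h z) (at z within {z. Im z > 0})"
    by blast
  then show ?thesis using op that at_within_open[OF _ op] by (metis (mono_tags) mem_Collect_eq)
qed

lemma phi_integrals:
  assumes p: "p \<le> g - 1" and q: "q \<le> g - 1"
  shows "phi p integrable_on {-(pi / 2)..pi / 2}" "integral {-(pi / 2)..pi / 2} (phi p) = 0"
    "((\<lambda>t. integral {-(pi / 2)..t} (phi p) * phi q t) has_integral 0) {-(pi / 2)..pi / 2}"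
proof -
  let ?I = "{-(pi / 2)..pi / 2}"
  define d where "d = (\<lambda>n. 1 / real (Suc n))"
  have d: "0 < d n" "d n \<le> 1" for n by (auto simp: d_def)
  obtain F where F: "\<And>z. Im z > 0 \<Longrightarrow> (F has_field_derivative diff_form p z) (at z)"
    using upper_half_plane_primitive[OF diff_form_holomorphic] by blast
  have psi_int: "(psi (d n) p has_integral F (tan (Complex t (d n))) - F (tan (Complex (-(pi / 2)) (d n)))) {-(pi / 2)..t}"
    if "t \<in> ?I" for n t
    unfolding psi_def using tan_path_has_integral[OF d(1) _ F] that by auto
  have z1: "(psi (d n) p has_integral 0) ?I" for n
    using psi_int[of "pi / 2" n] unfolding tan_path_closed[of "d n"] by simp
  have z2: "((\<lambda>t. integral {-(pi / 2)..t} (psi (d n) p) * psi (d n) q t) has_integral 0) ?I" for n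
  proof -
    \<comment> \<open>Along the path the inner integral is F - c with a holomorphic primitive
      \<open>F\<close>. The iterated integrand is therefore again the pullback of a holomorphic
      form, which integrates to 0 over the closed path.\<close>
    define c where "c = F (tan (Complex (-(pi / 2)) (d n)))"
    have "(\<lambda>z. (F z - c) * diff_form q z) holomorphic_on {z. Im z > 0}"
      using F by (intro holomorphic_intros diff_form_holomorphic)
        (auto simp: holomorphic_on_open open_halfspace_Im_gt)
    then obtain G where G: "\<And>z. Im z > 0 \<Longrightarrow> (G has_field_derivative (F z - c) * diff_form q z) (at z)"
      using upper_half_plane_primitive by blast
    have "((\<lambda>t. if t \<in> ths then 0 else (F (tan (Complex t (d n))) - c) * diff_form q (tan (Complex t (d n))) / (cos (Complex t (d n)))\<^sup>2)
        has_integral 0) ?I"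
      using tan_path_has_integral[OF d(1) _ G, of "- (pi / 2)" "pi / 2" n]
      unfolding tan_path_closed[of "d n"] by simp
    then show ?thesis
    proof (rule has_integral_eq[rotated])
      fix t assume "t \<in> ?I"
      from integral_unique[OF psi_int[OF this, of n]]
      show "(if t \<in> ths then 0 else (F (tan (Complex t (d n))) - c) * diff_form q (tan (Complex t (d n))) / (cos (Complex t (d n)))\<^sup>2) =
        integral {-(pi / 2)..t} (psi (d n) p) * psi (d n) q t"
        by (simp add: c_def psi_def)
    qed
  qed
  have K: "(\<lambda>t. cosh 1 ^ (g - 1) * majorant t) integrable_on ?I"
    by (intro integrable_on_mult_right majorant_integrable)
  have "psi (d n) p integrable_on ?I" "integral ?I (psi (d n) p) = 0" for n
    using z1[of n] by (auto intro: integral_unique)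
  moreover have "(\<lambda>n. psi (d n) r t) \<longlonglongrightarrow> phi r t" if "t \<in> ?I" for r t
    using psi_limit[OF that] by (simp add: d_def)
  ultimately have int: "\<And>n. psi (d n) p integrable_on ?I" "\<And>n. integral ?I (psi (d n) p) = 0"
    and conv: "\<And>r t. t \<in> ?I \<Longrightarrow> (\<lambda>n. psi (d n) r t) \<longlonglongrightarrow> phi r t"
    by auto
  note lim = iterated_integral_limit[OF K int(1) psi_bound[OF d _ p] conv psi_bound[OF d _ q] conv int(2) z2]
  show "phi p integrable_on ?I" "integral ?I (phi p) = 0"
    "((\<lambda>t. integral {-(pi / 2)..t} (phi p) * phi q t) has_integral 0) ?I"
    by (rule lim; assumption)+
qed

lemma phi_norm_le:
  assumes t: "t \<in> {-(pi / 2)..pi / 2}" and p: "p \<le> g - 1"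
  shows "norm (phi p t) \<le> cosh 1 ^ (g - 1) * majorant t"
proof (rule LIMSEQ_le_const2[OF tendsto_norm[OF psi_limit[OF t]]])
  show "\<exists>N. \<forall>n\<ge>N. norm (psi (1 / real (Suc n)) p t) \<le> cosh 1 ^ (g - 1) * majorant t"
    using psi_bound[OF _ _ t p] by simp
qed

lemma phi_absolutely_integrable:
  assumes "p \<le> g - 1"
  shows "phi p absolutely_integrable_on {-(pi / 2)..pi / 2}"
  using phi_integrals(1)[OF assms assms] phi_norm_le[OF _ assms]
  by (intro absolutely_integrable_integrable_bound[OF _ _ integrable_on_mult_right[OF majorant_integrable]]) auto

text \<open>To the right of exactly \<open>i\<close> branch points, 2g+1-i factors of the product
  are negative. The parity of that number is the sign of the square of \<open>y\<close>.\<close>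

lemma y_sign:
  assumes "i \<le> 2 * g + 1" and x: "\<And>k. k \<in> {1..i} \<Longrightarrow> e k < x" "\<And>k. k \<in> {i<..2 * g + 1} \<Longrightarrow> x < e k"
  shows "y (of_real x) \<noteq> 0" "odd i \<Longrightarrow> y (of_real x) \<in> \<real>" "even i \<Longrightarrow> Re (y (of_real x)) = 0"
proof -
  define r where "r = (\<Prod>k\<in>{1..2 * g + 1}. x - e k)"
  have yr: "(y (of_real x))\<^sup>2 = of_real r"
    using y_squared[of "of_real x"] by (simp add: r_def)
  have sgn: "sgn r = (- 1) ^ (2 * g + 1 - i)"
    unfolding r_def by (rule sgn_prod_diff) (use assms in auto)
  show "y (of_real x) \<noteq> 0" using yr sgn by (auto simp: sgn_0_0)
  show "y (of_real x) \<in> \<real>" if "odd i"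
  proof (rule square_eq_pos_imp_real[OF yr])
    have "even (2 * g + 1 - i)" using that assms(1) by auto
    with sgn show "r > 0" by (simp add: sgn_1_pos)
  qed
  show "Re (y (of_real x)) = 0" if "even i"
  proof (rule square_eq_neg_imp_imag[OF yr])
    have "odd (2 * g + 1 - i)" using that assms(1) by auto
    with sgn show "r < 0" by (simp add: sgn_1_neg)
  qed
qed

end


section \<open>Period relations\<close>

context real_curve
begin

lemma tan_th: "k \<in> {1..2 * g + 1} \<Longrightarrow> tan (th k) = e k"
  by (simp add: th_def tan_arctan)

lemma th_bounds:
  assumes "i \<le> 2 * g + 2"
  shows "- (pi / 2) \<le> th i" "th i \<le> pi / 2"
  using th_mono[of 0 i] th_mono[of i "2 * g + 2"] assms unfolding th_ends by auto

lemma tan_between: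
  assumes i: "i \<le> 2 * g + 1" and t: "th i < t" "t < th (i + 1)"
  shows "\<And>k. k \<in> {1..i} \<Longrightarrow> e k < tan t" "\<And>k. k \<in> {i<..2 * g + 1} \<Longrightarrow> tan t < e k"
proof -
  have tb: "- (pi / 2) < t" "t < pi / 2"
    using t th_bounds(1)[of i] th_bounds(2)[of "i + 1"] i by auto
  show "e k < tan t" if k: "k \<in> {1..i}" for k
  proof -
    have "th k \<le> th i" "- (pi / 2) < th k" using k i th_mono[of k i] th_less[of 0 k] unfolding th_ends by auto
    then have "tan (th k) < tan t" using t tb by (intro tan_monotone) auto
    then show ?thesis using tan_th[of k] k i by simp
  qed
  show "tan t < e k" if k: "k \<in> {i<..2 * g + 1}" for k
  proof -
    have "th (i + 1) \<le> th k" "th k < pi / 2"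
      using k i th_mono[of "i + 1" k] th_less[of k "2 * g + 2"] unfolding th_ends by auto
    then have "tan t < tan (th k)" using t tb by (intro tan_monotone) auto
    then show ?thesis using tan_th[of k] k i by simp
  qed
qed

lemma diff_form_sign:
  assumes "i \<le> 2 * g + 1" and "\<And>k. k \<in> {1..i} \<Longrightarrow> e k < x" "\<And>k. k \<in> {i<..2 * g + 1} \<Longrightarrow> x < e k"
  shows "odd i \<Longrightarrow> diff_form p (of_real x) \<in> \<real>" "even i \<Longrightarrow> Re (diff_form p (of_real x)) = 0"
proof -
  show "diff_form p (of_real x) \<in> \<real>" if "odd i"
    using y_sign(2)[OF assms that] unfolding diff_form_def by simp
  show "Re (diff_form p (of_real x)) = 0" if "even i"
  proof -
    have "\<i> * y (of_real x) \<in> \<real>" using y_sign(3)[OF assms that] by (simp add: complex_is_Real_iff)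
    then have "of_real x ^ p / (- 2 * (\<i> * y (of_real x))) \<in> \<real>" by simp
    moreover have "\<i> * (of_real x ^ p / (- 2 * (\<i> * y (of_real x)))) = diff_form p (of_real x)"
      by (simp add: diff_form_def)
    ultimately show ?thesis
      unfolding complex_is_Real_iff using Re_i_times by (metis neg_equal_0_iff_equal)
  qed
qed

lemma phi_sign:
  assumes i: "i \<le> 2 * g + 1" and t: "t \<in> {th i..th (i + 1)}"
  shows "odd i \<Longrightarrow> phi p t \<in> \<real>" "even i \<Longrightarrow> Re (phi p t) = 0"
proof -
  have "(odd i \<longrightarrow> phi p t \<in> \<real>) \<and> (even i \<longrightarrow> Re (phi p t) = 0)"
  proof (cases "t \<in> ths")
    case True
    then show ?thesis by (simp add: phi_eq_0)
  next
    case False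
    have "th i \<in> ths" "th (i + 1) \<in> ths" using i by (auto simp: ths_def)
    then have "th i < t" "t < th (i + 1)" using t False by (auto simp: order.order_iff_strict)
    from diff_form_sign[OF i tan_between[OF i this]] show ?thesis
      by (auto simp: phi_def Re_divide_of_real simp del: of_real_power)
  qed
  then show "odd i \<Longrightarrow> phi p t \<in> \<real>" "even i \<Longrightarrow> Re (phi p t) = 0" by auto
qed

text \<open>Only the bounded edges 1 to 2g are translated back to the variable x, because the
  matrices \<open>omega\<close> and \<open>omega'\<close> involve no others. The passage uses
  absolute integrability of \<open>phi\<close>, supplied by the majorant.\<close>

lemma phi_edge_integral:
  assumes i: "i \<in> {1..2 * g}" and p: "p \<le> g - 1"
  shows "(\<lambda>x. diff_form p (of_real x)) integrable_on {e i..e (i + 1)}"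
    "edge_integral e (diff_form p) i = integral {th i..th (i + 1)} (phi p)"
proof -
  let ?S = "{th i<..<th (i + 1)}"
  let ?T = "{e i<..<e (i + 1)}"
  have thb: "- (pi / 2) < th i" "th (i + 1) < pi / 2"
    using i th_less[of 0 i] th_less[of "i + 1" "2 * g + 2"] unfolding th_ends by auto
  have the: "tan (th i) = e i" "tan (th (i + 1)) = e (i + 1)" using i tan_th by auto
  have img: "tan ` ?S = ?T"
  proof (intro set_eqI iffI)
    fix x assume "x \<in> tan ` ?S"
    then obtain t where t: "t \<in> ?S" "x = tan t" by auto
    then have "tan (th i) < x" "x < tan (th (i + 1))" using thb by (auto intro!: tan_monotone)
    then show "x \<in> ?T" unfolding the by simp
  next
    fix x assume x: "x \<in> ?T"
    have "th i = arctan (e i)" "th (i + 1) = arctan (e (i + 1))" using i by (auto simp: th_def)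
    then have "arctan x \<in> ?S" using x by (simp add: arctan_less_iff)
    then show "x \<in> tan ` ?S" by (metis image_eqI tan_arctan)
  qed
  have cosS: "cos t \<noteq> 0" if "t \<in> ?S" for t
    using cos_gt_zero_pi[of t] that thb by auto
  have inj: "inj_on tan ?S"
  proof (rule linorder_inj_onI)
    fix s t assume "s < t" "s \<in> ?S" "t \<in> ?S"
    then have "tan s < tan t" using thb by (intro tan_monotone) auto
    then show "tan s \<noteq> tan t" by simp
  qed auto
  have der: "(tan has_field_derivative inverse ((cos t)\<^sup>2)) (at t within ?S)" if "t \<in> ?S" for t
    using cosS[OF that] by (intro DERIV_subset[OF DERIV_tan]) auto
  have absint: "phi p absolutely_integrable_on ?S"
    by (rule set_integrable_subset[OF phi_absolutely_integrable[OF p]])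
      (use thb in \<open>auto\<close>)
  \<comment> \<open>The substitution is carried out for real-valued functions; \<open>L\<close> is
    taken to be \<open>Re\<close> and then \<open>Im\<close>.\<close>
  have sub: "(L \<circ> (\<lambda>x. diff_form p (of_real x))) absolutely_integrable_on ?T \<and>
      integral ?T (L \<circ> (\<lambda>x. diff_form p (of_real x))) = integral ?S (L \<circ> phi p)"
    if L: "bounded_linear L" for L :: "complex \<Rightarrow> real"
  proof -
    interpret L: bounded_linear L by fact
    have eq: "\<bar>inverse ((cos t)\<^sup>2)\<bar> * L (diff_form p (of_real (tan t))) = (L \<circ> phi p) t" for t
    proof -
      have "phi p t = inverse ((cos t)\<^sup>2) *\<^sub>R diff_form p (of_real (tan t))"
        by (simp add: phi_def scaleR_conv_of_real divide_inverse)
      then show ?thesis by (simp add: L.scaleR)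
    qed
    have "(L \<circ> phi p) absolutely_integrable_on ?S"
      using absolutely_integrable_linear[OF absint L] .
    moreover have "(\<lambda>t. \<bar>inverse ((cos t)\<^sup>2)\<bar> * (L \<circ> (\<lambda>x. diff_form p (of_real x))) (tan t)) = L \<circ> phi p"
      using eq by auto
    ultimately show ?thesis
      using has_absolute_integral_change_of_variables_1'[OF _ der inj, of "L \<circ> (\<lambda>x. diff_form p (of_real x))"
        "integral ?S (L \<circ> phi p)"]
      unfolding img by simp
  qed
  have phiS: "integral {th i..th (i + 1)} (phi p) = integral ?S (phi p)"
    by (rule integral_open_interval_real)
  note Re = sub[OF bounded_linear_Re] and Im = sub[OF bounded_linear_Im]
  have "(\<lambda>x. diff_form p (of_real x)) integrable_on ?T"
  proof -
    have "(\<lambda>x. Re (diff_form p (of_real x))) integrable_on ?T" "(\<lambda>x. Im (diff_form p (of_real x))) integrable_on ?T"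
      using Re Im set_lebesgue_integral_eq_integral(1) by (auto simp: o_def)
    then show ?thesis
      by (subst integrable_componentwise_iff) (auto simp: Basis_complex_def inner_complex_def)
  qed
  then show int: "(\<lambda>x. diff_form p (of_real x)) integrable_on {e i..e (i + 1)}"
    by (simp add: integrable_on_open_interval_real)
  have phi_int: "phi p integrable_on ?S" using absint set_lebesgue_integral_eq_integral(1) by blast
  have "edge_integral e (diff_form p) i = integral ?T (\<lambda>x. diff_form p (of_real x))"
    unfolding edge_integral_def by (rule integral_open_interval_real)
  also have "\<dots> = integral ?S (phi p)"
  proof (rule complex_eqI)
    have int': "(\<lambda>x. diff_form p (of_real x)) integrable_on ?T" by fact
    show "Re (integral ?T (\<lambda>x. diff_form p (of_real x))) = Re (integral ?S (phi p))"
      using Re integral_linear[OF int' bounded_linear_Re] integral_linear[OF phi_int bounded_linear_Re] by simp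
    show "Im (integral ?T (\<lambda>x. diff_form p (of_real x))) = Im (integral ?S (phi p))"
      using Im integral_linear[OF int' bounded_linear_Im] integral_linear[OF phi_int bounded_linear_Im] by simp
  qed
  finally show "edge_integral e (diff_form p) i = integral {th i..th (i + 1)} (phi p)"
    unfolding phiS .
qed

lemma edge_sign:
  assumes i: "i \<in> {1..2 * g}" and x: "x \<in> {e i<..<e (i + 1)}"
  shows "\<And>k. k \<in> {1..i} \<Longrightarrow> e k < x" "\<And>k. k \<in> {i<..2 * g + 1} \<Longrightarrow> x < e k"
proof -
  have mono: "e k \<le> e j" if "k \<in> {1..2 * g + 1}" "j \<in> {1..2 * g + 1}" "k \<le> j" for j k
    using that e_strict_mono[of k j] by (cases "k = j") auto
  show "e k < x" if "k \<in> {1..i}" for k using mono[of k i] that i x by auto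
  show "x < e k" if "k \<in> {i<..2 * g + 1}" for k using mono[of "i + 1" k] that i x by auto
qed

text \<open>The increments \<open>c\<close> run over all 2g+2 intervals of the line, including the
  two unbounded ones; the vanishing totals let \<open>alternating_pairing\<close> express everything
  by the bounded edges.\<close>

lemma riemann_bilinear:
  assumes p: "p \<le> g - 1" and q: "q \<le> g - 1"
  shows "(\<Sum>k=1..g. edge_integral e (diff_form p) (2 * k - 1) * (\<Sum>j=k..g. edge_integral e (diff_form q) (2 * j))) =
         (\<Sum>k=1..g. edge_integral e (diff_form q) (2 * k - 1) * (\<Sum>j=k..g. edge_integral e (diff_form p) (2 * j)))"
proof -
  define c where "c = (\<lambda>r i. integral {th i..th (i + 1)} (phi r))"
  note P = phi_integrals[OF p q] and Q = phi_integrals[OF q p]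
  have "(\<Sum>i<2 * g + 2. Im ((\<Sum>j<i. c p j) * c q i)) = 0"
    unfolding c_def
  proof (rule Im_iterated_integral_partition)
    show "phi p integrable_on {th 0..th (2 * g + 2)}" "phi q integrable_on {th 0..th (2 * g + 2)}"
      "((\<lambda>t. integral {th 0..t} (phi p) * phi q t) has_integral 0) {th 0..th (2 * g + 2)}"
      unfolding th_ends by (fact P(1) Q(1) P(3))+
    show "(\<forall>t\<in>{th i..th (i + 1)}. phi p t \<in> \<real> \<and> phi q t \<in> \<real>) \<or>
          (\<forall>t\<in>{th i..th (i + 1)}. Re (phi p t) = 0 \<and> Re (phi q t) = 0)" if "i < 2 * g + 2" for i
      using that phi_sign[of i] by (cases "odd i") auto
  qed (rule th_mono)
  moreover have "(\<Sum>i<2 * g + 2. c r i) = 0" if "phi r integrable_on {-(pi / 2)..pi / 2}"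
      "integral {-(pi / 2)..pi / 2} (phi r) = 0" for r
    using integral_partition[of "phi r" th "2 * g + 2" "2 * g + 2"] th_mono that
    unfolding c_def th_ends by simp
  note this[OF P(1,2)] this[OF Q(1,2)]
  moreover have "Re (c r (2 * k)) = 0" if "k \<le> g" for r k
    unfolding c_def using that phi_sign(2)[of "2 * k" _ r] by (intro Re_integral_eq_0) auto
  moreover have "Im (c r (2 * k + 1)) = 0" if "k \<le> g" for r k
    unfolding complex_is_Real_iff[symmetric] c_def
    using that phi_sign(1)[of "2 * k + 1" _ r] by (intro integral_in_Reals) auto
  ultimately have "(\<Sum>k=1..g. c p (2 * k - 1) * (\<Sum>j=k..g. c q (2 * j))) =
      (\<Sum>k=1..g. c q (2 * k - 1) * (\<Sum>j=k..g. c p (2 * j)))"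
    by (intro alternating_pairing) auto
  moreover have "(\<Sum>k=1..g. c r (2 * k - 1) * (\<Sum>j=k..g. c s (2 * j))) =
      (\<Sum>k=1..g. edge_integral e (diff_form r) (2 * k - 1) * (\<Sum>j=k..g. edge_integral e (diff_form s) (2 * j)))"
    if "r \<le> g - 1" "s \<le> g - 1" for r s
  proof (intro sum.cong refl)
    fix k assume k: "k \<in> {1..g}"
    have "c r (2 * k - 1) = edge_integral e (diff_form r) (2 * k - 1)"
      unfolding c_def by (rule phi_edge_integral(2)[symmetric]) (use k that in auto)
    moreover have "(\<Sum>j=k..g. c s (2 * j)) = (\<Sum>j=k..g. edge_integral e (diff_form s) (2 * j))"
      unfolding c_def by (intro sum.cong refl phi_edge_integral(2)[symmetric]) (use k that in auto)
    ultimately show "c r (2 * k - 1) * (\<Sum>j=k..g. c s (2 * j)) =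
      edge_integral e (diff_form r) (2 * k - 1) * (\<Sum>j=k..g. edge_integral e (diff_form s) (2 * j))" by simp
  qed
  note this[OF p q] this[OF q p]
  ultimately show ?thesis by metis
qed

text \<open>Without a root the numerator would keep its sign on the edge, and so would the form,
  since \<open>y\<close> has no zero there. The integral of a continuous function of constant strict
  sign cannot vanish. The factor \<open>u\<close> makes the form real on the gaps, where it is
  imaginary.\<close>

lemma root_in_edge:
  assumes i: "i \<in> {1..2 * g}"
    and zero: "(\<Sum>p<g. of_real (c p) * edge_integral e (diff_form p) i) = 0"
  shows "\<exists>x\<in>{e i<..<e (i + 1)}. (\<Sum>p<g. c p * x ^ p) = 0"
proof (rule ccontr)
  assume contra: "\<not> ?thesis"
  let ?T = "{e i<..<e (i + 1)}"
  define P where "P = (\<lambda>x. \<Sum>p<g. c p * x ^ p)"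
  define F where "F = (\<lambda>x::real. \<Sum>p<g. of_real (c p) * diff_form p (of_real x))"
  have i': "i \<le> 2 * g + 1" and ei: "e i < e (i + 1)" using i e_strict_mono[of i "i + 1"] by auto
  have F_eq: "F x = of_real (P x) / (- 2 * y (of_real x))" for x
    by (simp add: F_def P_def diff_form_def sum_divide_distrib sum_negf)
  define u where "u = (if odd i then 1 else \<i>)"
  define R where "R = (\<lambda>x. Re (u * F x))"
  have ynz: "y (of_real x) \<noteq> 0" if "x \<in> ?T" for x
    by (rule y_sign(1)[OF i' edge_sign[OF i that]])
  have uF: "u * F x \<in> \<real>" if "x \<in> ?T" for x
  proof (cases "odd i")
    case True
    then have "F x \<in> \<real>"
      unfolding F_def using diff_form_sign(1)[OF i' edge_sign[OF i that] True]
      by (intro sum_in_Reals Reals_mult) auto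
    then show ?thesis using True by (simp add: u_def)
  next
    case False
    then have "Re (F x) = 0"
      unfolding F_def using diff_form_sign(2)[OF i' edge_sign[OF i that]] by (simp add: Re_sum)
    then show ?thesis using False by (simp add: u_def complex_is_Real_iff)
  qed
  have Rnz: "R x \<noteq> 0" if "x \<in> ?T" for x
  proof -
    have "P x \<noteq> 0" using contra that by (auto simp: P_def)
    then have "u * F x \<noteq> 0" using ynz[OF that] by (auto simp: F_eq u_def)
    then show ?thesis using uF[OF that] by (auto simp: R_def complex_is_Real_iff complex_eq_iff)
  qed
  have "continuous_on ?T (\<lambda>x. y (of_real x))"
  proof (rule continuous_on_compose2[of "{z. 0 \<le> Im z}" y])
    show "continuous_on {z. 0 \<le> Im z} y" using branch by (simp add: upper_branch_def)
  qed (auto intro!: continuous_intros)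
  then have "continuous_on ?T F"
    unfolding F_eq P_def using ynz by (intro continuous_intros) auto
  then have cont: "continuous_on ?T R"
    unfolding R_def by (intro continuous_intros)
  have Fint: "(F has_integral 0) {e i..e (i + 1)}"
  proof -
    have "((\<lambda>x. diff_form p (of_real x)) has_integral edge_integral e (diff_form p) i) {e i..e (i + 1)}" if "p < g" for p
      using phi_edge_integral(1)[OF i, of p] that unfolding edge_integral_def by (simp add: integrable_integral)
    then have "(F has_integral (\<Sum>p<g. of_real (c p) * edge_integral e (diff_form p) i)) {e i..e (i + 1)}"
      unfolding F_def by (intro has_integral_sum has_integral_mult_right) auto
    then show ?thesis using zero by simp
  qed
  have Rint: "(R has_integral 0) {e i..e (i + 1)}"
    using has_integral_Re[OF has_integral_mult_right[OF Fint, of u]] by (simp add: R_def)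
  have key: False if S: "\<And>x. x \<in> ?T \<Longrightarrow> s * R x > 0" for s
  proof -
    \<comment> \<open>The middle third of the edge: \<open>R\<close> is continuous only on the open
      edge, and strict positivity of the integral needs a compact subinterval.\<close>
    define a b where "a = (2 * e i + e (i + 1)) / 3" and "b = (e i + 2 * e (i + 1)) / 3"
    have ab: "e i < a" "a < b" "b < e (i + 1)" using ei by (auto simp: a_def b_def)
    have sR: "((\<lambda>x. s * R x) has_integral 0) ?T"
      using has_integral_mult_right[OF Rint, of s] by (simp add: has_integral_Icc_iff_Ioo)
    have csub: "continuous_on {a..b} (\<lambda>x. s * R x)"
      by (intro continuous_intros continuous_on_subset[OF cont]) (use ab in auto)
    have "integral {a..b} (\<lambda>x. s * R x) \<le> integral ?T (\<lambda>x. s * R x)"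
    proof (rule integral_subset_le)
      show "{a..b} \<subseteq> ?T" using ab by auto
      show "(\<lambda>x. s * R x) integrable_on {a..b}" using csub by (rule integrable_continuous_real)
      show "(\<lambda>x. s * R x) integrable_on ?T" using sR by blast
    qed (use S less_imp_le in blast)
    also have "\<dots> = 0" using sR by (rule integral_unique)
    finally have "integral {a..b} (\<lambda>x. s * R x) \<le> 0" .
    moreover have pos: "s * R x > 0" if "x \<in> {a..b}" for x using S that ab by auto
    then have "0 \<le> integral {a..b} (\<lambda>x. s * R x)"
      using csub by (intro integral_nonneg integrable_continuous_real) (auto intro: less_imp_le)
    ultimately have "integral {a..b} (\<lambda>x. s * R x) = 0" by (rule antisym)
    then have "\<forall>x\<in>{a..b}. s * R x = 0"
      using integral_eq_0_iff[OF csub ab(2)] pos less_imp_le by blast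
    then show False using pos[of a] ab by auto
  qed
  have conn: "connected (R ` ?T)"
    by (intro connected_continuous_image cont connected_Ioo)
  have "0 \<notin> R ` ?T" using Rnz by auto
  then have "(\<forall>x\<in>?T. R x > 0) \<or> (\<forall>x\<in>?T. R x < 0)"
    using conn unfolding connected_iff_interval by (smt (verit, best) image_eqI)
  then show False using key[of 1] key[of "-1"] by auto
qed

text \<open>A polynomial of degree less than \<open>g\<close> cannot have a zero in each of \<open>g\<close> disjoint intervals.\<close>

lemma edge_periods_nondegenerate:
  fixes c :: "nat \<Rightarrow> real" and I :: "nat \<Rightarrow> nat"
  assumes I: "\<And>k. k \<in> {1..g} \<Longrightarrow> I k \<in> {1..2 * g}" "strict_mono_on {1..g} I"
    and zero: "\<And>k. k \<in> {1..g} \<Longrightarrow> (\<Sum>p<g. of_real (c p) * edge_integral e (diff_form p) (I k)) = 0"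
    and p: "p < g"
  shows "c p = 0"
proof -
  have "\<exists>x. \<forall>k\<in>{1..g}. x k \<in> {e (I k)<..<e (I k + 1)} \<and> (\<Sum>p<g. c p * x k ^ p) = 0"
    using root_in_edge[OF I(1) zero] by (intro bchoice) blast
  then obtain x where x: "\<And>k. k \<in> {1..g} \<Longrightarrow> x k \<in> {e (I k)<..<e (I k + 1)}"
      "\<And>k. k \<in> {1..g} \<Longrightarrow> (\<Sum>p<g. c p * x k ^ p) = 0" by blast
  have mono: "e i \<le> e j" if "i \<in> {1..2 * g + 1}" "j \<in> {1..2 * g + 1}" "i \<le> j" for i j
    using that e_strict_mono[of i j] by (cases "i = j") auto
  have "inj_on x {1..g}"
  proof (rule linorder_inj_onI)
    fix k l assume kl: "k < l" "k \<in> {1..g}" "l \<in> {1..g}"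
    then have "I k + 1 \<le> I l" using I(2) by (simp add: strict_mono_on_def Suc_le_eq)
    then have "e (I k + 1) \<le> e (I l)" using I(1)[OF kl(2)] I(1)[OF kl(3)] by (intro mono) auto
    then show "x k \<noteq> x l" using x(1)[OF kl(2)] x(1)[OF kl(3)] by auto
  qed auto
  then have card: "card (x ` {1..g}) = g" by (simp add: card_image)
  define P where "P = (\<Sum>p<g. monom (c p) p)"
  have "P = 0"
  proof (rule ccontr)
    assume "P \<noteq> 0"
    then have "card {x. poly P x = 0} \<le> degree P" "finite {x. poly P x = 0}"
      by (auto intro: card_poly_roots_bound poly_roots_finite)
    moreover have "x ` {1..g} \<subseteq> {x. poly P x = 0}"
      using x(2) by (auto simp: P_def poly_sum poly_monom)
    ultimately have "g \<le> degree P" using card card_mono le_trans by metis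
    moreover have "degree P < g"
      unfolding P_def using genus_pos by (intro degree_sum_less) (auto intro: le_less_trans[OF degree_monom_le])
    ultimately show False by simp
  qed
  moreover have "coeff P p = c p" using p by (simp add: P_def coeff_sum coeff_monom)
  ultimately show ?thesis by simp
qed

end


section \<open>Logarithmic derivatives of exponential series\<close>

text \<open>Differentiability at every point is part of the relation, whereas
  \<open>partial_deriv\<close> has an arbitrary value where the derivative does not exist.\<close>

definition has_partial :: "'g \<Rightarrow> (complex ^ 'g \<Rightarrow> complex) \<Rightarrow> (complex ^ 'g \<Rightarrow> complex) \<Rightarrow> bool" where
  "has_partial i f f' \<longleftrightarrow> (\<forall>u. ((\<lambda>z. f (u + axis i z)) has_field_derivative f' u) (at 0))"

lemma has_partialD: "has_partial i f f' \<Longrightarrow> ((\<lambda>z. f (u + axis i z)) has_field_derivative f' u) (at 0)"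
  by (simp add: has_partial_def)

lemma has_partial_real:
  fixes f :: "complex ^ 'g::finite \<Rightarrow> complex"
  assumes f: "has_partial i f f'" and real: "\<And>u. f (real_vec u) \<in> \<real>"
  shows "f' (real_vec u) \<in> \<real>"
proof -
  define h where "h = (\<lambda>n. 1 / real (Suc n))"
  have shift: "real_vec u + axis i (of_real t) = real_vec (u + axis i t)" for t
    by (simp add: vec_eq_iff real_vec_def axis_def)
  have "((\<lambda>z. (f (real_vec u + axis i (0 + z)) - f (real_vec u + axis i 0)) / z) \<longlongrightarrow> f' (real_vec u)) (at 0)"
    using has_partialD[OF f, of "real_vec u"] unfolding DERIV_def .
  moreover have "filterlim (\<lambda>n. complex_of_real (h n)) (at 0) sequentially"
    unfolding filterlim_at
  proof
    have "(\<lambda>n. complex_of_real (h n)) \<longlonglongrightarrow> of_real 0"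
      unfolding h_def by (intro tendsto_of_real LIMSEQ_Suc[OF lim_1_over_n])
    then show "(\<lambda>n. complex_of_real (h n)) \<longlonglongrightarrow> 0" by simp
  qed (simp add: h_def del: of_nat_Suc)
  ultimately have lim: "(\<lambda>n. (f (real_vec u + axis i (0 + of_real (h n))) - f (real_vec u + axis i 0)) / of_real (h n))
      \<longlonglongrightarrow> f' (real_vec u)"
    by (rule filterlim_compose)
  show ?thesis
  proof (rule Lim_in_closed_set[OF closed_complex_Reals _ _ lim])
    have "(f (real_vec u + axis i (0 + of_real (h n))) - f (real_vec u + axis i 0)) / of_real (h n) \<in> \<real>" for n
      unfolding add_0 shift using real shift[of 0] by (intro Reals_divide Reals_diff) (auto simp: axis_def[of i 0])
    then show "\<forall>\<^sub>F n in sequentially. (f (real_vec u + axis i (0 + of_real (h n))) - f (real_vec u + axis i 0)) / of_real (h n) \<in> \<real>"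
      by simp
  qed simp
qed

text \<open>Since \<open>R\<close> is arbitrary, the weight controls the series at all arguments
  \<open>u\<close> and also absorbs polynomial factors in \<open>b n\<close>. The condition is
  therefore preserved by termwise differentiation.\<close>

definition exp_summable :: "('n \<Rightarrow> complex) \<Rightarrow> ('n \<Rightarrow> complex ^ 'g::finite) \<Rightarrow> bool" where
  "exp_summable A b \<longleftrightarrow> (\<forall>R. (\<lambda>n. norm (A n) * exp (R * norm (b n))) summable_on UNIV)"

definition exp_series :: "('n \<Rightarrow> complex) \<Rightarrow> ('n \<Rightarrow> complex ^ 'g::finite) \<Rightarrow> complex ^ 'g \<Rightarrow> complex" where
  "exp_series A b u = (\<Sum>\<^sub>\<infinity>n. A n * exp (bdot (b n) u))"

lemma exp_remainder: "norm (exp w - 1 - w) \<le> (norm w)\<^sup>2 * exp (norm w)" for w :: complex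
proof -
  have "norm (exp w - (1 + w)) \<le> exp \<bar>Re w\<bar> * (norm w)\<^sup>2"
    using Taylor_exp[of w 1] by (simp add: power2_eq_square)
  also have "\<dots> \<le> exp (norm w) * (norm w)\<^sup>2"
    by (intro mult_right_mono) (auto simp: abs_Re_le_cmod)
  finally show ?thesis by (simp add: algebra_simps)
qed

lemma square_le_two_exp: "x\<^sup>2 \<le> 2 * exp x" if "0 \<le> x" for x :: real
  using exp_lower_Taylor_quadratic[OF that] that by (simp add: field_simps)

lemma has_field_derivative_exp_sum:
  fixes a b :: "'n \<Rightarrow> complex"
  assumes summ: "\<And>R. (\<lambda>n. norm (a n) * exp (R * norm (b n))) summable_on UNIV"
  shows "((\<lambda>z. \<Sum>\<^sub>\<infinity>n. a n * exp (b n * z)) has_field_derivative (\<Sum>\<^sub>\<infinity>n. a n * b n)) (at 0)"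
proof -
  let ?f = "\<lambda>z. \<Sum>\<^sub>\<infinity>n. a n * exp (b n * z)"
  \<comment> \<open>For |h| \<le> 1 the remainder of exp at b h is at most |h|^2 |b|^2 exp |b|, and
    |b|^2 \<le> 2 exp |b|. This explains the leading 2 and the doubled exponent.\<close>
  define M where "M = 2 * (\<Sum>\<^sub>\<infinity>n. norm (a n) * exp (2 * norm (b n)))"
  have s: "(\<lambda>n. a n * exp (b n * z)) summable_on UNIV" for z
  proof (rule abs_summable_summable[OF Infinite_Sum.abs_summable_on_comparison_test'[OF summ[of "norm z"]]])
    fix n
    have "norm (exp (b n * z)) \<le> exp (norm (b n * z))" by (rule norm_exp)
    then show "norm (a n * exp (b n * z)) \<le> norm (a n) * exp (norm z * norm (b n))"
      by (simp add: norm_mult mult_left_mono mult.commute[of "norm z"] del: norm_exp_eq_Re)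
  qed
  have s1: "(\<lambda>n. a n * b n) summable_on UNIV"
  proof (rule abs_summable_summable[OF Infinite_Sum.abs_summable_on_comparison_test'[OF summ[of 1]]])
    fix n
    have "norm (b n) \<le> exp (norm (b n))" using exp_ge_add_one_self[of "norm (b n)"] by linarith
    then show "norm (a n * b n) \<le> norm (a n) * exp (1 * norm (b n))"
      by (simp add: norm_mult mult_left_mono)
  qed
  have est: "norm ((?f h - ?f 0) / h - (\<Sum>\<^sub>\<infinity>n. a n * b n)) \<le> M * norm h" if h: "h \<noteq> 0" "norm h \<le> 1" for h
  proof -
    have "((\<lambda>n. a n * exp (b n * h) - a n * exp (b n * 0) - (a n * b n) * h) has_sum
        (?f h - ?f 0 - (\<Sum>\<^sub>\<infinity>n. a n * b n) * h)) UNIV"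
      unfolding diff_conv_add_uminus
      by (intro has_sum_add has_sum_uminusI has_sum_cmult_left has_sum_infsum s s1)
    then have eq: "?f h - ?f 0 - (\<Sum>\<^sub>\<infinity>n. a n * b n) * h =
        (\<Sum>\<^sub>\<infinity>n. a n * exp (b n * h) - a n * exp (b n * 0) - (a n * b n) * h)"
      by (simp add: infsumI)
    have bnd: "norm (a n * exp (b n * h) - a n * exp (b n * 0) - (a n * b n) * h) \<le>
        (2 * (norm h)\<^sup>2) * (norm (a n) * exp (2 * norm (b n)))" for n
    proof -
      have "norm (b n * h) \<le> norm (b n)" using h mult_left_mono[of "norm h" 1 "norm (b n)"] by (simp add: norm_mult)
      then have "norm (exp (b n * h) - 1 - b n * h) \<le> (norm (b n * h))\<^sup>2 * exp (norm (b n))"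
        using exp_remainder[of "b n * h"] by (meson exp_le_cancel_iff mult_left_mono order_trans zero_le_power2)
      also have "\<dots> \<le> (norm h)\<^sup>2 * (2 * exp (norm (b n))) * exp (norm (b n))"
        using square_le_two_exp[of "norm (b n)"]
        by (intro mult_right_mono) (auto simp: norm_mult power_mult_distrib mult.commute[of "(norm (b n))\<^sup>2"] intro!: mult_left_mono)
      also have "\<dots> = 2 * (norm h)\<^sup>2 * exp (2 * norm (b n))"
        by (simp add: exp_double power2_eq_square)
      finally have "norm (a n) * norm (exp (b n * h) - 1 - b n * h) \<le> norm (a n) * (2 * (norm h)\<^sup>2 * exp (2 * norm (b n)))"
        by (rule mult_left_mono) simp
      moreover have "a n * exp (b n * h) - a n * exp (b n * 0) - (a n * b n) * h = a n * (exp (b n * h) - 1 - b n * h)"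
        by (simp add: algebra_simps)
      ultimately show ?thesis by (simp add: norm_mult mult_ac)
    qed
    have ss: "(\<lambda>n. (2 * (norm h)\<^sup>2) * (norm (a n) * exp (2 * norm (b n)))) summable_on UNIV"
      by (intro summable_on_cmult_right summ)
    have abs: "(\<lambda>n. norm (a n * exp (b n * h) - a n * exp (b n * 0) - (a n * b n) * h)) summable_on UNIV"
      by (rule Infinite_Sum.abs_summable_on_comparison_test'[OF ss bnd])
    have "norm (?f h - ?f 0 - (\<Sum>\<^sub>\<infinity>n. a n * b n) * h) \<le>
        (\<Sum>\<^sub>\<infinity>n. norm (a n * exp (b n * h) - a n * exp (b n * 0) - (a n * b n) * h))"
      unfolding eq by (rule norm_infsum_bound[OF abs])
    also have "\<dots> \<le> (\<Sum>\<^sub>\<infinity>n. (2 * (norm h)\<^sup>2) * (norm (a n) * exp (2 * norm (b n))))"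
      by (rule infsum_mono[OF abs ss bnd])
    also have "\<dots> = M * (norm h)\<^sup>2"
      by (simp add: infsum_cmult_right' M_def)
    finally have "norm (?f h - ?f 0 - (\<Sum>\<^sub>\<infinity>n. a n * b n) * h) \<le> M * norm h * norm h"
      by (simp add: power2_eq_square)
    moreover have "(?f h - ?f 0) / h - (\<Sum>\<^sub>\<infinity>n. a n * b n) = (?f h - ?f 0 - (\<Sum>\<^sub>\<infinity>n. a n * b n) * h) / h"
      using h by (simp add: field_simps)
    ultimately show ?thesis using h by (simp add: norm_divide divide_le_eq)
  qed
  have "((\<lambda>h. (?f h - ?f 0) / h - (\<Sum>\<^sub>\<infinity>n. a n * b n)) \<longlongrightarrow> 0) (at 0)"
  proof (rule Lim_null_comparison)
    show "\<forall>\<^sub>F h in at 0. norm ((?f h - ?f 0) / h - (\<Sum>\<^sub>\<infinity>n. a n * b n)) \<le> M * norm h"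
      unfolding eventually_at using est by (intro exI[of _ 1]) (auto simp: dist_norm less_imp_le)
    show "((\<lambda>h. M * norm h) \<longlongrightarrow> 0) (at (0::complex))"
      by (auto intro!: tendsto_eq_intros)
  qed
  then have "((\<lambda>h. (?f (0 + h) - ?f 0) / h) \<longlongrightarrow> (\<Sum>\<^sub>\<infinity>n. a n * b n)) (at 0)"
    unfolding add_0 by (rule LIM_zero_cancel)
  then show ?thesis unfolding DERIV_def .
qed

lemma norm_bdot_le: "norm (bdot b u) \<le> norm b * (\<Sum>i\<in>UNIV. norm (u $ i))"
proof -
  have "norm (bdot b u) \<le> (\<Sum>i\<in>UNIV. norm (b $ i) * norm (u $ i))"
    unfolding bdot_def by (rule sum_norm_le) (simp add: norm_mult)
  also have "\<dots> \<le> (\<Sum>i\<in>UNIV. norm b * norm (u $ i))"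
    by (intro sum_mono mult_right_mono Finite_Cartesian_Product.norm_nth_le) auto
  finally show ?thesis by (simp add: sum_distrib_left)
qed

lemma bdot_axis: "bdot b (u + axis i z) = bdot b u + b $ i * z"
proof -
  have "(\<Sum>j\<in>UNIV. b $ j * axis i z $ j) = b $ i * z"
    by (simp add: axis_def if_distrib[of "(*) _"] cong: if_cong)
  then show ?thesis by (simp add: bdot_def distrib_left sum.distrib)
qed

lemma exp_summable_component:
  assumes "exp_summable A b"
  shows "exp_summable (\<lambda>n. A n * b n $ i) b"
  unfolding exp_summable_def
proof
  fix R
  have "(\<lambda>n. norm (norm (A n * b n $ i) * exp (R * norm (b n)))) summable_on UNIV"
  proof (rule Infinite_Sum.abs_summable_on_comparison_test')
    show "(\<lambda>n. norm (A n) * exp ((R + 1) * norm (b n))) summable_on UNIV"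
      using assms by (simp add: exp_summable_def)
    fix n
    have "norm (b n $ i) \<le> exp (norm (b n))"
      using Finite_Cartesian_Product.norm_nth_le[of "b n" i] exp_ge_add_one_self[of "norm (b n)"] by linarith
    then have "norm (A n) * norm (b n $ i) * exp (R * norm (b n)) \<le> norm (A n) * exp (norm (b n)) * exp (R * norm (b n))"
      by (intro mult_right_mono mult_left_mono) auto
    then show "norm (norm (A n * b n $ i) * exp (R * norm (b n))) \<le> norm (A n) * exp ((R + 1) * norm (b n))"
      by (simp add: norm_mult distrib_right exp_add mult_ac)
  qed
  then show "(\<lambda>n. norm (A n * b n $ i) * exp (R * norm (b n))) summable_on UNIV" by simp
qed

lemma has_partial_exp_series:
  fixes b :: "'n \<Rightarrow> complex ^ 'g::finite"
  assumes summ: "exp_summable A b"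
  shows "has_partial i (exp_series A b) (exp_series (\<lambda>n. A n * b n $ i) b)"
  unfolding has_partial_def
proof
  fix u :: "complex ^ 'g"
  define a where "a = (\<lambda>n. A n * exp (bdot (b n) u))"
  let ?C = "\<Sum>i\<in>UNIV. norm (u $ i)"
  have "(\<lambda>n. norm (a n) * exp (R * norm (b n $ i))) summable_on UNIV" for R
  proof -
    have "(\<lambda>n. norm (norm (a n) * exp (R * norm (b n $ i)))) summable_on UNIV"
    proof (rule Infinite_Sum.abs_summable_on_comparison_test')
      show "(\<lambda>n. norm (A n) * exp ((?C + \<bar>R\<bar>) * norm (b n))) summable_on UNIV"
        using summ by (simp add: exp_summable_def)
      fix n
      have "norm (exp (bdot (b n) u)) \<le> exp (norm (bdot (b n) u))" by (rule norm_exp)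
      also have "\<dots> \<le> exp (?C * norm (b n))"
        using norm_bdot_le[of "b n" u] by (simp add: mult.commute)
      finally have 1: "norm (exp (bdot (b n) u)) \<le> exp (?C * norm (b n))" .
      have 2: "exp (R * norm (b n $ i)) \<le> exp (\<bar>R\<bar> * norm (b n))"
        by (auto intro!: order_trans[OF mult_right_mono[OF abs_ge_self]] mult_left_mono Finite_Cartesian_Product.norm_nth_le)
      have "norm (a n) * exp (R * norm (b n $ i)) \<le> norm (A n) * exp (?C * norm (b n)) * exp (\<bar>R\<bar> * norm (b n))"
        unfolding a_def norm_mult by (intro mult_mono mult_left_mono 1 2) auto
      then show "norm (norm (a n) * exp (R * norm (b n $ i))) \<le> norm (A n) * exp ((?C + \<bar>R\<bar>) * norm (b n))"
        by (simp add: algebra_simps exp_add)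
    qed
    then show ?thesis by simp
  qed
  from has_field_derivative_exp_sum[OF this]
  show "((\<lambda>z. exp_series A b (u + axis i z)) has_field_derivative exp_series (\<lambda>n. A n * b n $ i) b u) (at 0)"
    by (simp add: exp_series_def bdot_axis exp_add a_def mult_ac)
qed

text \<open>Formulas for logarithmic derivatives hold where the function is nonzero. To
  differentiate them once more they must hold along a whole neighbourhood in the chosen
  direction.\<close>

lemma has_partial_eventually_nonzero:
  assumes "has_partial i f f'" "f u \<noteq> 0"
  shows "\<forall>\<^sub>F z in nhds 0. f (u + axis i z) \<noteq> 0"
proof -
  have ax: "axis i 0 = 0" by (simp add: vec_eq_iff axis_def)
  have "isCont (\<lambda>z. f (u + axis i z)) 0"
    using has_partialD[OF assms(1)] by (rule DERIV_isCont)
  then have "((\<lambda>z. f (u + axis i z)) \<longlongrightarrow> f u) (at 0)"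
    by (simp add: isCont_def ax)
  from tendsto_imp_eventually_ne[OF this assms(2)] show ?thesis
    using assms(2) by (simp add: eventually_nhds_conv_at ax)
qed

lemma partial_deriv_eqI:
  assumes "((\<lambda>z. h (u + axis i z)) has_field_derivative d) (at 0)"
    and "\<forall>\<^sub>F z in nhds 0. f (w + u + axis i z) = h (u + axis i z)"
  shows "partial_deriv i f (w + u) = d"
  unfolding partial_deriv_def using assms DERIV_cong_ev[OF refl assms(2) refl] DERIV_imp_deriv by blast

text \<open>The factor \<open>exp \<circ> Q\<close> with \<open>Q\<close> quadratic changes the second logarithmic derivatives by constants only.\<close>

lemma wp_of_quadratic_multiple:
  assumes s: "\<And>u. s (w + u) = D * exp (Q u) * T u" and D: "D \<noteq> 0"
    and Q: "\<And>i. has_partial i Q (Q1 i)" "\<And>i j. has_partial i (Q1 j) (\<lambda>_. Q2 i j)"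
    and T: "\<And>i. has_partial i T (T1 i)" "\<And>i j. has_partial i (T1 j) (T2 i j)"
           "\<And>i j k. has_partial i (T2 j k) (T3 i j k)"
    and u: "T u \<noteq> 0"
  shows "wp2 s i k (w + u) = - (Q2 i k + (T2 i k u * T u - T1 k u * T1 i u) / (T u)\<^sup>2)"
    "wp3 s i j k (w + u) =
      - (((T3 i j k u * T u + T2 j k u * T1 i u - (T2 i k u * T1 j u + T1 k u * T2 i j u)) * (T u)\<^sup>2
          - (T2 j k u * T u - T1 k u * T1 j u) * (2 * T u * T1 i u)) / (T u) ^ 4)"
proof -
  have ax: "axis i 0 = 0" for i by (simp add: vec_eq_iff axis_def)
  have d1: "dlog k s (w + u) = Q1 k u + T1 k u / T u" if "T u \<noteq> 0" for u k
  proof -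
    have "((\<lambda>z. D * exp (Q (u + axis k z)) * T (u + axis k z)) has_field_derivative
        D * exp (Q u) * (Q1 k u * T u + T1 k u)) (at 0)"
      using has_partialD[OF Q(1)[of k], of u] has_partialD[OF T(1)[of k], of u]
      by (auto intro!: derivative_eq_intros simp: ax algebra_simps)
    then have pd: "partial_deriv k s (w + u) = D * exp (Q u) * (Q1 k u * T u + T1 k u)"
      by (rule partial_deriv_eqI) (simp add: s[symmetric] add.assoc)
    show ?thesis unfolding dlog_def s pd using that D by (simp add: field_simps)
  qed
  have d2: "partial_deriv i (dlog k s) (w + u) = Q2 i k + (T2 i k u * T u - T1 k u * T1 i u) / (T u)\<^sup>2"
    if "T u \<noteq> 0" for u i k
  proof (rule partial_deriv_eqI)
    show "((\<lambda>z. Q1 k (u + axis i z) + T1 k (u + axis i z) / T (u + axis i z)) has_field_derivative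
        Q2 i k + (T2 i k u * T u - T1 k u * T1 i u) / (T u)\<^sup>2) (at 0)"
      using has_partialD[OF Q(2)[of i k], of u] has_partialD[OF T(1)[of i], of u] has_partialD[OF T(2)[of i k], of u] that
      by (auto intro!: derivative_eq_intros simp: ax power2_eq_square)
    show "\<forall>\<^sub>F z in nhds 0. dlog k s (w + u + axis i z) = Q1 k (u + axis i z) + T1 k (u + axis i z) / T (u + axis i z)"
      using has_partial_eventually_nonzero[OF T(1)[of i] that]
      by eventually_elim (simp add: add.assoc d1)
  qed
  show "wp2 s i k (w + u) = - (Q2 i k + (T2 i k u * T u - T1 k u * T1 i u) / (T u)\<^sup>2)"
    by (simp add: wp2_def d2[OF u])
  have "partial_deriv i (partial_deriv j (dlog k s)) (w + u) =
     ((T3 i j k u * T u + T2 j k u * T1 i u - (T2 i k u * T1 j u + T1 k u * T2 i j u)) * (T u)\<^sup>2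
          - (T2 j k u * T u - T1 k u * T1 j u) * (2 * T u * T1 i u)) / (T u) ^ 4"
  proof (rule partial_deriv_eqI)
    let ?v = "\<lambda>z. u + axis i z"
    show "((\<lambda>z. Q2 j k + (T2 j k (?v z) * T (?v z) - T1 k (?v z) * T1 j (?v z)) / (T (?v z))\<^sup>2) has_field_derivative
       ((T3 i j k u * T u + T2 j k u * T1 i u - (T2 i k u * T1 j u + T1 k u * T2 i j u)) * (T u)\<^sup>2
          - (T2 j k u * T u - T1 k u * T1 j u) * (2 * T u * T1 i u)) / (T u) ^ 4) (at 0)"
      using has_partialD[OF T(1)[of i], of u] has_partialD[OF T(2)[of i k], of u] has_partialD[OF T(2)[of i j], of u]
        has_partialD[OF T(3)[of i j k], of u] u
      by (auto intro!: derivative_eq_intros simp: ax power2_eq_square power4_eq_xxxx algebra_simps)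
    show "\<forall>\<^sub>F z in nhds 0. partial_deriv j (dlog k s) (w + u + axis i z) =
        Q2 j k + (T2 j k (?v z) * T (?v z) - T1 k (?v z) * T1 j (?v z)) / (T (?v z))\<^sup>2"
      using has_partial_eventually_nonzero[OF T(1)[of i] u]
      by eventually_elim (simp add: add.assoc d2)
  qed
  then show "wp3 s i j k (w + u) =
      - (((T3 i j k u * T u + T2 j k u * T1 i u - (T2 i k u * T1 j u + T1 k u * T2 i j u)) * (T u)\<^sup>2
          - (T2 j k u * T u - T1 k u * T1 j u) * (2 * T u * T1 i u)) / (T u) ^ 4)"
    by (simp add: wp3_def)
qed


section \<open>Theta series with imaginary period matrix\<close>

definition real_mat :: "real ^ 'n ^ 'm \<Rightarrow> complex ^ 'n ^ 'm" where
  "real_mat M = (\<chi> i j. of_real (M $ i $ j))"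

definition imag_mat :: "real ^ 'n ^ 'm \<Rightarrow> complex ^ 'n ^ 'm" where
  "imag_mat M = (\<chi> i j. \<i> * of_real (M $ i $ j))"

lemma real_mat_mult: "real_mat M ** real_mat N = real_mat (M ** N)"
  by (simp add: real_mat_def matrix_matrix_mult_def vec_eq_iff)

lemma real_mat_imag_mat_mult: "real_mat M ** imag_mat N = imag_mat (M ** N)"
  by (simp add: real_mat_def imag_mat_def matrix_matrix_mult_def vec_eq_iff sum_distrib_left mult_ac)

lemma real_mat_id: "real_mat (mat 1) = mat 1"
  by (simp add: real_mat_def mat_def vec_eq_iff)

lemma real_mat_vec: "real_mat M *v real_vec x = real_vec (M *v x)"
  by (simp add: real_mat_def real_vec_def matrix_vector_mult_def vec_eq_iff)

lemma bdot_real_vec: "bdot (real_vec x) (real_vec z) = of_real (x \<bullet> z)"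
  by (simp add: bdot_def real_vec_def inner_vec_def)

lemma bdot_imag_mat: "bdot (real_vec x) (imag_mat M *v real_vec z) = \<i> * of_real (x \<bullet> (M *v z))"
  by (simp add: bdot_def real_vec_def imag_mat_def inner_vec_def matrix_vector_mult_def sum_distrib_left mult_ac)

lemma bdot_commute: "bdot x z = bdot z x"
  by (simp add: bdot_def mult.commute)

lemma bdot_add_left: "bdot (x + x') z = bdot x z + bdot x' z"
  by (simp add: bdot_def distrib_right sum.distrib)

lemma bdot_add_right: "bdot x (z + z') = bdot x z + bdot x z'"
  by (simp add: bdot_def distrib_left sum.distrib)

lemma bdot_scale_left: "bdot (c *s x) z = c * bdot x z"
  by (simp add: bdot_def sum_distrib_left mult_ac)

lemma bdot_scale_right: "bdot x (c *s z) = c * bdot x z"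
  by (simp add: bdot_def sum_distrib_left mult_ac)

lemma bdot_matrix: "bdot x (M *v z) = bdot (transpose M *v x) z"
  unfolding bdot_def matrix_vector_mult_def transpose_def
  by (simp add: sum_distrib_left sum_distrib_right mult_ac) (rule sum.swap)

lemma matrix_inv_eqI:
  fixes M :: "'a::semiring_1 ^ 'n ^ 'n"
  assumes "M ** N = mat 1" "N ** M = mat 1"
  shows "matrix_inv M = N"
  unfolding matrix_inv_def
proof (rule some_equality)
  fix N' assume "M ** N' = mat 1 \<and> N' ** M = mat 1"
  then show "N' = N" using assms by (metis matrix_mul_assoc matrix_mul_lid matrix_mul_rid)
qed (use assms in auto)

definition int_real_vec :: "int ^ 'n \<Rightarrow> real ^ 'n" where
  "int_real_vec n = (\<chi> i. of_int (n $ i))"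

lemma int_vec_eq: "int_vec n = real_vec (int_real_vec n)"
  by (simp add: int_vec_def real_vec_def int_real_vec_def vec_eq_iff)

section \<open>Summability over the integer lattice\<close>

lemma exp_minus_abs_int_summable: "(\<lambda>k::int. exp (- \<bar>real_of_int k\<bar>)) summable_on UNIV"
proof -
  have "summable (\<lambda>n. exp (- 1 :: real) ^ n)"
    by (rule summable_geometric) simp
  then have s: "(\<lambda>n::nat. exp (- real n)) summable_on UNIV"
    by (intro summable_nonneg_imp_summable_on) (auto simp: exp_of_nat_mult[symmetric])
  have "(\<lambda>k::int. exp (- \<bar>real_of_int k\<bar>)) summable_on range int"
    by (subst summable_on_reindex) (use s in \<open>auto simp: o_def inj_on_def\<close>)
  moreover have "(\<lambda>k::int. exp (- \<bar>real_of_int k\<bar>)) summable_on range (\<lambda>n. - int n)"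
    by (subst summable_on_reindex) (use s in \<open>auto simp: o_def inj_on_def\<close>)
  moreover have "range int \<union> range (\<lambda>n. - int n) = UNIV"
  proof -
    have "k \<in> range int \<union> range (\<lambda>n. - int n)" for k
      by (cases k rule: int_cases2) auto
    then show ?thesis by auto
  qed
  ultimately show ?thesis using summable_on_union by metis
qed

text \<open>The summand is a product over the coordinates, so the lattice sum is a product of g
  copies of the sum over the integers.\<close>

lemma exp_lattice_summable:
  "(\<lambda>n :: int ^ 'g::finite. exp (- (\<Sum>i\<in>UNIV. \<bar>real_of_int (n $ i)\<bar>))) summable_on UNIV"
proof -
  have "Infinite_Set_Sum.abs_summable_on (\<lambda>k::int. exp (- \<bar>real_of_int k\<bar>)) UNIV"
    using exp_minus_abs_int_summable by (simp add: abs_summable_equivalent[symmetric])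
  then have "Infinite_Set_Sum.abs_summable_on (\<lambda>f. \<Prod>i\<in>(UNIV::'g set). exp (- \<bar>real_of_int (f i)\<bar>)) (PiE UNIV (\<lambda>_. UNIV))"
    by (intro abs_summable_on_prod_PiE) auto
  then have "(\<lambda>f. \<Prod>i\<in>(UNIV::'g set). exp (- \<bar>real_of_int (f i)\<bar>)) summable_on UNIV"
    by (simp add: abs_summable_equivalent[symmetric] abs_prod PiE_UNIV_domain)
  moreover have "bij_betw (\<lambda>n :: int ^ 'g. ($) n) UNIV UNIV"
    by (rule bij_betw_byWitness[where f' = vec_lambda]) auto
  ultimately have "(\<lambda>n :: int ^ 'g. \<Prod>i\<in>UNIV. exp (- \<bar>real_of_int (n $ i)\<bar>)) summable_on UNIV"
    using summable_on_reindex_bij_betw[of "\<lambda>n :: int ^ 'g. ($) n" UNIV UNIV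
      "\<lambda>f. \<Prod>i\<in>(UNIV::'g set). exp (- \<bar>real_of_int (f i)\<bar>)"] by simp
  then show ?thesis by (simp add: exp_sum sum_negf[symmetric])
qed

section \<open>Positivity of the quadratic form\<close>

lemma floor_div_tendsto: "(\<lambda>k. of_int \<lfloor>real (Suc k) * x\<rfloor> / real (Suc k)) \<longlonglongrightarrow> x"
proof (rule tendsto_sandwich)
  show "(\<lambda>k. x - 1 / real (Suc k)) \<longlonglongrightarrow> x"
    using tendsto_diff[OF tendsto_const LIMSEQ_Suc[OF lim_1_over_n], of x] by simp
  show "(\<lambda>k. x) \<longlonglongrightarrow> x" by simp
  show "\<forall>\<^sub>F k in sequentially. x - 1 / real (Suc k) \<le> of_int \<lfloor>real (Suc k) * x\<rfloor> / real (Suc k)"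
  proof (intro always_eventually allI)
    fix k
    have "real (Suc k) * x - 1 \<le> of_int \<lfloor>real (Suc k) * x\<rfloor>" by linarith
    then have "(real (Suc k) * x - 1) / real (Suc k) \<le> of_int \<lfloor>real (Suc k) * x\<rfloor> / real (Suc k)"
      by (intro divide_right_mono) auto
    then show "x - 1 / real (Suc k) \<le> of_int \<lfloor>real (Suc k) * x\<rfloor> / real (Suc k)"
      by (simp add: diff_divide_distrib del: of_nat_Suc)
  qed
  show "\<forall>\<^sub>F k in sequentially. of_int \<lfloor>real (Suc k) * x\<rfloor> / real (Suc k) \<le> x"
    by (intro always_eventually allI) (simp add: divide_le_eq mult.commute del: of_nat_Suc)
qed

text \<open>
  A sum that is not absolutely summable has the junk value 0. Hence a single nonzero value of
  \<open>theta\<close> already forces the quadratic form to be nonnegative on the integers.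
\<close>

lemma theta_nonzero_imp_nonneg_int:
  fixes Y :: "real ^ 'g::finite ^ 'g"
  assumes "theta z (imag_mat Y) \<noteq> 0"
  shows "0 \<le> int_real_vec n \<bullet> (Y *v int_real_vec n)"
proof (rule ccontr)
  let ?N = "int_real_vec :: int ^ 'g \<Rightarrow> real ^ 'g"
  let ?q = "\<lambda>n. ?N n \<bullet> (Y *v ?N n)"
  let ?l = "\<lambda>n. ?N n \<bullet> (\<chi> i. Im (z $ i))"
  let ?t = "\<lambda>n :: int ^ 'g. exp (\<i> * of_real pi * bdot (int_vec n) (imag_mat Y *v int_vec n) +
             2 * \<i> * of_real pi * bdot (int_vec n) z)"
  have N: "?N (k *s n) = of_int k *\<^sub>R ?N n" for k n
    by (simp add: int_real_vec_def vec_eq_iff)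
  assume neg: "\<not> 0 \<le> ?q n"
  \<comment> \<open>Replacing n by its negative, if necessary, makes the linear term nonpositive and
    keeps the quadratic one. Along the multiples of \<open>m\<close> all terms then have norm at
    least 1, which contradicts summability.\<close>
  obtain m where qm: "?q m < 0" and lm: "?l m \<le> 0"
  proof (cases "?l n \<le> 0")
    case True
    then show ?thesis using that[of n] neg by linarith
  next
    case False
    have "?q ((-1) *s n) = ?q n" unfolding N matrix_vector_mult_scaleR inner_scaleR_left inner_scaleR_right by simp
    moreover have "?l ((-1) *s n) = - ?l n" unfolding N inner_scaleR_left by simp
    ultimately show ?thesis using that[of "(-1) *s n"] neg False by linarith
  qed
  have nt: "norm (?t n) = exp (- pi * ?q n - 2 * pi * ?l n)" for n
  proof -
    have "Im (bdot (int_vec n) z) = ?l n"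
      by (simp add: bdot_def int_vec_def int_real_vec_def inner_vec_def Im_sum)
    then show ?thesis
      unfolding norm_exp_eq_Re by (simp add: int_vec_eq bdot_imag_mat)
  qed
  have "?t summable_on UNIV"
    using assms unfolding theta_def by (meson infsum_not_exists)
  then have "(\<lambda>n. norm (?t n)) summable_on UNIV"
    by (simp add: summable_on_iff_abs_summable_on_complex)
  then have "(\<lambda>n. norm (?t n)) summable_on range (\<lambda>k::nat. int k *s m)"
    by (rule summable_on_subset_banach) auto
  moreover have "inj (\<lambda>k::nat. int k *s m)"
  proof (rule injI)
    fix j k :: nat assume "int j *s m = int k *s m"
    moreover have "m \<noteq> 0" using qm by (auto simp: int_real_vec_def zero_vec_def[symmetric])
    ultimately show "j = k" by (auto simp: vec_eq_iff)
  qed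
  ultimately have "(\<lambda>k::nat. norm (?t (int k *s m))) summable_on UNIV"
    by (subst (asm) summable_on_reindex) (auto simp: o_def)
  then have "(\<lambda>k::nat. norm (?t (int k *s m))) \<longlonglongrightarrow> 0"
    by (intro summable_LIMSEQ_zero summable_on_imp_summable)
  then have "\<forall>\<^sub>F k in sequentially. norm (?t (int k *s m)) < 1"
    by (rule order_tendstoD) simp
  then obtain k where "norm (?t (int k *s m)) < 1" by (auto simp: eventually_sequentially)
  moreover have "norm (?t (int k *s m)) \<ge> 1"
  proof -
    have "?q (int k *s m) = real k ^ 2 * ?q m" "?l (int k *s m) = real k * ?l m"
      by (simp_all add: N matrix_vector_mult_scaleR power2_eq_square)
    moreover have "real k ^ 2 * ?q m \<le> 0" "real k * ?l m \<le> 0"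
      using qm lm by (auto simp: mult_le_0_iff)
    ultimately have "0 \<le> - pi * ?q (int k *s m) - 2 * pi * ?l (int k *s m)"
      using mult_nonneg_nonpos[of pi "?q (int k *s m)"] mult_nonneg_nonpos[of pi "?l (int k *s m)"] by simp
    then show ?thesis unfolding nt by simp
  qed
  ultimately show False by simp
qed

text \<open>By homogeneity the bound passes from integer to rational vectors, and by continuity to
  real ones; \<open>X k\<close> approximates x with denominator k + 1.\<close>

lemma theta_nonzero_imp_nonneg:
  fixes Y :: "real ^ 'g::finite ^ 'g"
  assumes "theta z (imag_mat Y) \<noteq> 0"
  shows "0 \<le> x \<bullet> (Y *v x)"
proof -
  define X where "X = (\<lambda>k. \<chi> i. of_int \<lfloor>real (Suc k) * x $ i\<rfloor> / real (Suc k))"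
  have "X \<longlonglongrightarrow> x"
    unfolding X_def by (rule vec_tendstoI) (simp add: floor_div_tendsto del: of_nat_Suc)
  moreover have "isCont (\<lambda>x. x \<bullet> (Y *v x)) x"
    by (intro continuous_intros linear_continuous_at) (auto simp: linear_conv_bounded_linear[symmetric])
  ultimately have lim: "(\<lambda>k. X k \<bullet> (Y *v X k)) \<longlonglongrightarrow> x \<bullet> (Y *v x)"
    by (rule isCont_tendsto_compose[rotated])
  have "0 \<le> X k \<bullet> (Y *v X k)" for k
  proof -
    have "X k = (1 / real (Suc k)) *\<^sub>R int_real_vec (\<chi> i. \<lfloor>real (Suc k) * x $ i\<rfloor>)"
      by (simp add: X_def int_real_vec_def vec_eq_iff)
    then show ?thesis
      using theta_nonzero_imp_nonneg_int[OF assms] by (simp add: matrix_vector_mult_scaleR)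
  qed
  then show ?thesis
    by (intro LIMSEQ_le_const[OF lim]) auto
qed

text \<open>A nonnegative symmetric form can vanish at x only if Y x = 0, since otherwise a small
  step from x in the direction - Y x would make it negative. Positivity off the origin then has a
  minimum on the compact unit sphere, and that minimum serves as \<open>l\<close>.\<close>

lemma nonneg_invertible_imp_coercive:
  fixes Y :: "real ^ 'g::finite ^ 'g"
  assumes nonneg: "\<And>x. 0 \<le> x \<bullet> (Y *v x)" and sym: "transpose Y = Y" and inv: "invertible Y"
  obtains l where "0 < l" "\<And>x. l * (norm x)\<^sup>2 \<le> x \<bullet> (Y *v x)"
proof -
  let ?q = "\<lambda>x. x \<bullet> (Y *v x)"
  have symb: "x \<bullet> (Y *v w) = w \<bullet> (Y *v x)" for x w
    using dot_lmul_matrix[of x Y w] sym by (metis inner_commute transpose_matrix_vector)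
  have pos: "?q x > 0" if "x \<noteq> 0" for x
  proof (rule ccontr)
    assume "\<not> 0 < ?q x"
    then have q0: "?q x = 0" using nonneg[of x] by simp
    define w where "w = Y *v x"
    have "w \<noteq> 0"
      using inv that unfolding w_def by (metis invertible_left_inverse matrix_left_invertible_ker)
    then have a: "w \<bullet> w > 0" by simp
    \<comment> \<open>Along w the form is t (2 w.w + t q(w)). This \<open>t\<close> is negative, yet
      small enough for the bracket to stay positive; the added 1 keeps the denominator positive when
      q(w) = 0.\<close>
    define t where "t = - (w \<bullet> w) / (?q w + 1)"
    have "?q (x + t *\<^sub>R w) = ?q x + t * (x \<bullet> (Y *v w)) + t * (w \<bullet> (Y *v x)) + t * t * ?q w"
      by (simp add: matrix_vector_right_distrib matrix_vector_mult_scaleR inner_add_left inner_add_right algebra_simps)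
    also have "\<dots> = t * (2 * (w \<bullet> w) + t * ?q w)"
      using symb[of x w] by (simp add: q0 w_def algebra_simps)
    finally have "0 \<le> t * (2 * (w \<bullet> w) + t * ?q w)" using nonneg[of "x + t *\<^sub>R w"] by simp
    moreover have "t < 0" using a nonneg[of w] by (simp add: t_def)
    moreover have "2 * (w \<bullet> w) + t * ?q w > 0"
    proof -
      have "?q w / (?q w + 1) \<le> 1" using nonneg[of w] by simp
      then have "(w \<bullet> w) * (?q w / (?q w + 1)) \<le> (w \<bullet> w) * 1" using a by (intro mult_left_mono) auto
      moreover have "t * ?q w = - ((w \<bullet> w) * (?q w / (?q w + 1)))" by (simp add: t_def)
      ultimately show ?thesis using a by linarith
    qed
    ultimately show False using mult_neg_pos by fastforce
  qed
  have "continuous_on (sphere 0 1) ?q"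
    by (intro continuous_intros linear_continuous_on) (auto simp: linear_conv_bounded_linear[symmetric])
  moreover have "sphere (0 :: real ^ 'g) 1 \<noteq> {}" by simp
  ultimately obtain x0 where x0: "x0 \<in> sphere 0 1" "\<And>x. x \<in> sphere 0 1 \<Longrightarrow> ?q x0 \<le> ?q x"
    using continuous_attains_inf[of "sphere 0 1" ?q] by auto
  show ?thesis
  proof
    show "0 < ?q x0" using x0(1) by (intro pos) auto
    show "?q x0 * (norm x)\<^sup>2 \<le> ?q x" for x
    proof (cases "x = 0")
      case False
      then have "?q x0 \<le> ?q ((1 / norm x) *\<^sub>R x)" by (intro x0(2)) simp
      also have "\<dots> = ?q x / (norm x)\<^sup>2" by (simp add: matrix_vector_mult_scaleR power2_eq_square)
      finally show ?thesis using False by (simp add: field_simps)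
    qed simp
  qed
qed

text \<open>The Gaussian decay outweighs both the weight exp (R |b|) and the factor needed for
  comparison with the summable exp (- |n_1| - ... - |n_g|); completing the square bounds what
  remains by a constant.\<close>

lemma gaussian_exp_summable:
  fixes Y :: "real ^ 'g::finite ^ 'g" and N :: "int ^ 'g \<Rightarrow> real ^ 'g" and b :: "int ^ 'g \<Rightarrow> complex ^ 'h::finite"
  assumes l: "0 < l" "\<And>x. l * (norm x)\<^sup>2 \<le> x \<bullet> (Y *v x)"
    and N: "\<And>n i. \<bar>real_of_int (n $ i)\<bar> \<le> \<bar>N n $ i\<bar> + d $ i"
    and A: "\<And>n. norm (A n) = exp (- pi * (N n \<bullet> (Y *v N n)))"
    and b: "0 \<le> B" "\<And>n. norm (b n) \<le> B * norm (N n)"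
  shows "exp_summable A b"
  unfolding exp_summable_def
proof
  fix R
  \<comment> \<open>The total linear rate in the norm of \<open>N n\<close>: the weight contributes
    |R| B, and the sum of the |n_i| contributes g up to the shift \<open>d\<close>. The maximum of S
    x - pi l x^2 is S^2 / (4 pi l), the first term of \<open>K\<close>.\<close>
  define S where "S = \<bar>R\<bar> * B + real CARD('g)"
  define K where "K = S\<^sup>2 / (4 * (pi * l)) + (\<Sum>i\<in>UNIV. d $ i)"
  have "(\<lambda>n. norm (norm (A n) * exp (R * norm (b n)))) summable_on UNIV"
  proof (rule Infinite_Sum.abs_summable_on_comparison_test')
    show "(\<lambda>n :: int ^ 'g. exp K * exp (- (\<Sum>i\<in>UNIV. \<bar>real_of_int (n $ i)\<bar>))) summable_on UNIV"
      by (intro summable_on_cmult_right exp_lattice_summable)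
    fix n
    let ?x = "norm (N n)"
    have "R * norm (b n) \<le> \<bar>R\<bar> * (B * ?x)"
      using b by (intro mult_mono) auto
    moreover have "- pi * (N n \<bullet> (Y *v N n)) \<le> - (pi * l * ?x\<^sup>2)"
      using l(2)[of "N n"] by (simp add: mult.assoc)
    moreover have "- (pi * l * ?x\<^sup>2) + S * ?x \<le> S\<^sup>2 / (4 * (pi * l))"
    proof -
      have "0 \<le> (2 * (pi * l) * ?x - S)\<^sup>2" by simp
      then have "4 * (pi * l) * (- (pi * l * ?x\<^sup>2) + S * ?x) \<le> S\<^sup>2"
        by (simp add: power2_eq_square algebra_simps)
      then show ?thesis using l(1) by (simp add: field_simps)
    qed
    moreover have "(\<Sum>i\<in>UNIV. \<bar>real_of_int (n $ i)\<bar>) \<le> real CARD('g) * ?x + (\<Sum>i\<in>UNIV. d $ i)"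
    proof -
      have "(\<Sum>i\<in>UNIV. \<bar>real_of_int (n $ i)\<bar>) \<le> (\<Sum>i\<in>UNIV. ?x + d $ i)"
        using N by (intro sum_mono) (meson add_mono component_le_norm_cart order_refl order_trans)
      then show ?thesis by (simp add: sum.distrib)
    qed
    moreover have "S * ?x = \<bar>R\<bar> * (B * ?x) + real CARD('g) * ?x" by (simp add: S_def algebra_simps)
    ultimately have "- pi * (N n \<bullet> (Y *v N n)) + R * norm (b n) \<le> K - (\<Sum>i\<in>UNIV. \<bar>real_of_int (n $ i)\<bar>)"
      unfolding K_def by linarith
    then show "norm (norm (A n) * exp (R * norm (b n))) \<le> exp K * exp (- (\<Sum>i\<in>UNIV. \<bar>real_of_int (n $ i)\<bar>))"
      by (simp add: A exp_add[symmetric])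
  qed
  then show "(\<lambda>n. norm (A n) * exp (R * norm (b n))) summable_on UNIV" by simp
qed

text \<open>
  After completing the square, theta at a half-integral shift is, up to an exponential factor, the
  following sum over the shifted lattice, which is invariant under \<open>n \<mapsto> - n - d\<close>.
\<close>

definition shifted_theta :: "real ^ 'g::finite ^ 'g \<Rightarrow> int ^ 'g \<Rightarrow> real ^ 'g \<Rightarrow> real ^ 'g ^ 'g \<Rightarrow> complex ^ 'g \<Rightarrow> complex" where
  "shifted_theta Y d r W =
     (let N = (\<lambda>n. int_real_vec n + (1 / 2) *\<^sub>R int_real_vec d)
      in exp_series
          (\<lambda>n. exp (of_real (- pi * (N n \<bullet> (Y *v N n))) + 2 * \<i> * of_real pi * of_real (N n \<bullet> r)))
          (\<lambda>n. (2 * \<i> * of_real pi) *s real_vec (transpose W *v N n)))"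

lemma shifted_theta_summable:
  fixes Y W :: "real ^ 'g::finite ^ 'g" and d :: "int ^ 'g"
  assumes "0 < l" "\<And>x. l * (norm x)\<^sup>2 \<le> x \<bullet> (Y *v x)"
  defines "N \<equiv> \<lambda>n. int_real_vec n + (1 / 2) *\<^sub>R int_real_vec d"
  shows "exp_summable (\<lambda>n. exp (of_real (- pi * (N n \<bullet> (Y *v N n))) + 2 * \<i> * of_real pi * of_real (N n \<bullet> r)))
          (\<lambda>n. (2 * \<i> * of_real pi) *s real_vec (transpose W *v N n))"
proof -
  obtain B where B: "0 < B" "\<And>x. norm (transpose W *v x) \<le> norm x * B"
    using bounded_linear.pos_bounded[OF matrix_vector_mul_bounded_linear[of "transpose W"]] by blast
  have nrv: "norm (real_vec x) = norm x" for x :: "real ^ 'g"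
    by (simp add: norm_vec_def real_vec_def)
  have nsc: "norm (c *s x) = norm c * norm x" for c and x :: "complex ^ 'g"
    by (simp add: norm_vec_def norm_mult L2_set_right_distrib)
  show ?thesis
  proof (rule gaussian_exp_summable[OF assms(1,2)])
    show "\<bar>real_of_int (n $ i)\<bar> \<le> \<bar>N n $ i\<bar> + (\<chi> i. \<bar>real_of_int (d $ i)\<bar>) $ i" for n i
      by (simp add: N_def int_real_vec_def)
    show "norm (exp (of_real (- pi * (N n \<bullet> (Y *v N n))) + 2 * \<i> * of_real pi * of_real (N n \<bullet> r))) =
        exp (- pi * (N n \<bullet> (Y *v N n)))" for n
      by simp
    show "0 \<le> 2 * pi * B" using B by simp
    show "norm ((2 * \<i> * of_real pi) *s real_vec (transpose W *v N n)) \<le> 2 * pi * B * norm (N n)" for n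
      unfolding nsc nrv using B(2)[of "N n"] by (simp add: norm_mult mult_ac)
  qed
qed

lemma shifted_theta_real: "shifted_theta Y d r W (real_vec u) \<in> \<real>"
proof -
  define N where "N = (\<lambda>n. int_real_vec n + (1 / 2) *\<^sub>R int_real_vec d)"
  define f where "f = (\<lambda>x. exp (of_real (- pi * (x \<bullet> (Y *v x))) + 2 * \<i> * of_real pi * of_real (x \<bullet> (r + W *v u))))"
  have eq: "shifted_theta Y d r W (real_vec u) = (\<Sum>\<^sub>\<infinity>n. f (N n))"
  proof -
    have "exp (of_real (- pi * (N n \<bullet> (Y *v N n))) + 2 * \<i> * of_real pi * of_real (N n \<bullet> r)) *
        exp (bdot ((2 * \<i> * of_real pi) *s real_vec (transpose W *v N n)) (real_vec u)) = f (N n)" for n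
      unfolding f_def exp_add[symmetric] bdot_scale_left bdot_real_vec
      by (simp add: inner_add_right algebra_simps dot_lmul_matrix[symmetric] transpose_matrix_vector)
    then show ?thesis unfolding shifted_theta_def Let_def exp_series_def N_def by simp
  qed
  have Nneg: "N (- n - d) = - N n" for n
    by (simp add: N_def int_real_vec_def vec_eq_iff)
  have cf: "cnj (f x) = f (- x)" for x
    using matrix_vector_mult_scaleR[of Y "-1" x] by (simp add: f_def exp_cnj)
  have "cnj (\<Sum>\<^sub>\<infinity>n. f (N n)) = (\<Sum>\<^sub>\<infinity>n. f (N (- n - d)))"
    by (simp add: infsum_cnj[symmetric] cf Nneg del: infsum_cnj)
  also have "\<dots> = (\<Sum>\<^sub>\<infinity>n. f (N n))"
    by (rule infsum_reindex_bij_betw) (rule bij_betw_byWitness[where f' = "\<lambda>n. - n - d"], auto)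
  finally show ?thesis unfolding eq by (simp add: Reals_cnj_iff)
qed

lemma theta_half_shift:
  fixes Y W :: "real ^ 'g::finite ^ 'g" and d :: "int ^ 'g"
  assumes sym: "transpose Y = Y"
  defines "c \<equiv> (1 / 2) *\<^sub>R int_real_vec d"
  shows "theta (real_mat W *v u + real_vec r + imag_mat Y *v real_vec c) (imag_mat Y) =
    exp (- (\<i> * of_real pi * bdot (real_vec c) (imag_mat Y *v real_vec c))
         - 2 * \<i> * of_real pi * bdot (real_vec c) (real_mat W *v u + real_vec r)) * shifted_theta Y d r W u"
proof -
  define N where "N = (\<lambda>n. int_real_vec n + c)"
  let ?T = "imag_mat Y"
  let ?z = "real_mat W *v u + real_vec r"
  \<comment> \<open>Symmetry of \<open>Y\<close> identifies the two mixed terms, which is what makes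
    the square complete to N^t T N with N = n + c.\<close>
  have symT: "bdot (real_vec c) (?T *v x) = bdot x (?T *v real_vec c)" for x
  proof -
    have "transpose ?T = ?T"
      using sym unfolding imag_mat_def transpose_def vec_eq_iff by simp
    then show ?thesis by (metis bdot_commute bdot_matrix)
  qed
  have rvN: "real_vec (N n) = int_vec n + real_vec c" for n
    by (simp add: N_def int_vec_eq real_vec_def vec_eq_iff)
  have termwise: "exp (\<i> * of_real pi * bdot (int_vec n) (?T *v int_vec n) +
             2 * \<i> * of_real pi * bdot (int_vec n) (?z + ?T *v real_vec c)) =
    exp (- (\<i> * of_real pi * bdot (real_vec c) (?T *v real_vec c)) - 2 * \<i> * of_real pi * bdot (real_vec c) ?z) *
    (exp (of_real (- pi * (N n \<bullet> (Y *v N n))) + 2 * \<i> * of_real pi * of_real (N n \<bullet> r)) *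
     exp (bdot ((2 * \<i> * of_real pi) *s real_vec (transpose W *v N n)) u))" for n
  proof -
    have 1: "of_real (- pi * (N n \<bullet> (Y *v N n))) = \<i> * of_real pi * bdot (real_vec (N n)) (?T *v real_vec (N n))"
      by (simp add: bdot_imag_mat complex_eq_iff)
    have 2: "of_real (N n \<bullet> r) = bdot (real_vec (N n)) (real_vec r)" by (simp add: bdot_real_vec)
    have 3: "bdot ((2 * \<i> * of_real pi) *s real_vec (transpose W *v N n)) u =
      2 * \<i> * of_real pi * bdot (real_vec (N n)) (real_mat W *v u)"
    proof -
      have "transpose (real_mat W) = real_mat (transpose W)"
        by (simp add: real_mat_def transpose_def vec_eq_iff)
      then show ?thesis unfolding bdot_scale_left bdot_matrix[of _ "real_mat W"] by (simp add: real_mat_vec)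
    qed
    show ?thesis
      unfolding exp_add[symmetric] 1 2 3 rvN matrix_vector_right_distrib bdot_add_left bdot_add_right
      by (rule arg_cong[of _ _ exp]) (simp add: symT[of "int_vec n"] algebra_simps)
  qed
  show ?thesis
    unfolding theta_def termwise infsum_cmult_right'
    unfolding shifted_theta_def Let_def exp_series_def N_def c_def ..
qed


section \<open>The period matrices\<close>

text \<open>For a general matrix the gradient involves its symmetrization. The result has the form
  treated by \<open>has_partial_affine\<close>, so that the second derivatives are the constants
  \<open>- (1 / 2) * (K + transpose K) $ j $ i\<close>.\<close>

lemma has_partial_quadratic:
  fixes K :: "complex ^ 'g::finite ^ 'g"
  shows "has_partial i (\<lambda>u. - (1 / 2) * bdot (w + u) (K *v (w + u)) + bdot m u + k)
    (\<lambda>u. - (1 / 2) * ((K + transpose K) *v (w + u)) $ i + m $ i)"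
  unfolding has_partial_def
proof
  fix u
  let ?x = "w + u"
  have ax: "bdot (axis i z) x = z * x $ i" "bdot x (axis i z) = x $ i * z" for z and x :: "complex ^ 'g"
    using bdot_axis[of x 0 i z] bdot_commute[of "axis i z" x] by (simp_all add: bdot_def mult.commute)
  have Ki: "bdot x (K *v axis i z) = z * (transpose K *v x) $ i" for x z
    by (simp add: bdot_matrix ax mult.commute)
  have expand: "bdot (w + (u + axis i z)) (K *v (w + (u + axis i z))) =
      bdot ?x (K *v ?x) + z * ((K + transpose K) *v ?x) $ i + z * (z * (transpose K *v axis i 1) $ i)" for z
  proof -
    have "axis i z = z *s axis i 1" by (simp add: vec_eq_iff axis_def)
    then have "bdot (axis i z) (K *v axis i z) = z * (z * (transpose K *v axis i 1) $ i)"
      by (simp only: bdot_scale_left bdot_scale_right vector_scalar_commute Ki mult_1 vector_smult_component)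
    moreover have "bdot (?x + axis i z) (K *v (?x + axis i z)) =
        bdot ?x (K *v ?x) + (bdot (axis i z) (K *v ?x) + bdot ?x (K *v axis i z)) + bdot (axis i z) (K *v axis i z)"
      by (simp only: matrix_vector_right_distrib bdot_add_left bdot_add_right add_ac)
    moreover have "((K + transpose K) *v ?x) $ i = (K *v ?x) $ i + (transpose K *v ?x) $ i"
      by (simp only: matrix_vector_mult_add_rdistrib vector_add_component)
    ultimately show ?thesis
      by (simp only: add.assoc[symmetric] ax(1) Ki distrib_left)
  qed
  show "((\<lambda>z. - (1 / 2) * bdot (w + (u + axis i z)) (K *v (w + (u + axis i z))) + bdot m (u + axis i z) + k)
      has_field_derivative - (1 / 2) * ((K + transpose K) *v (w + u)) $ i + m $ i) (at 0)"
    unfolding expand bdot_axis by (auto intro!: derivative_eq_intros)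
qed

lemma has_partial_affine:
  fixes M :: "complex ^ 'g::finite ^ 'g"
  shows "has_partial i (\<lambda>u. c * (M *v (w + u)) $ j + k) (\<lambda>_. c * M $ j $ i)"
  unfolding has_partial_def
proof
  fix u
  have "(M *v (w + (u + axis i z))) $ j = (M *v (w + u)) $ j + M $ j $ i * z" for z
    using bdot_axis[of "M $ j" "w + u" i z] by (simp add: bdot_def matrix_vector_mult_def add.assoc)
  then show "((\<lambda>z. c * (M *v (w + (u + axis i z))) $ j + k) has_field_derivative c * M $ j $ i) (at 0)"
    by (auto intro!: derivative_eq_intros)
qed

context real_curve
begin

section \<open>Reality of the edge integrals\<close>

lemma edge_integral_odd_real:
  assumes "k \<in> {1..g}" "p \<le> g - 1"
  shows "edge_integral e (diff_form p) (2 * k - 1) \<in> \<real>"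
proof -
  have "odd (2 * k - 1)" "2 * k - 1 \<le> 2 * g + 1" using assms by auto
  moreover have "edge_integral e (diff_form p) (2 * k - 1) = integral {th (2 * k - 1)..th (2 * k - 1 + 1)} (phi p)"
    by (rule phi_edge_integral(2)) (use assms in auto)
  ultimately show ?thesis using phi_sign(1)[of "2 * k - 1" _ p] by (simp only:) (rule integral_in_Reals, blast)
qed

lemma edge_integral_even_imag:
  assumes "k \<in> {1..g}" "p \<le> g - 1"
  shows "Re (edge_integral e (diff_form p) (2 * k)) = 0"
proof -
  have "edge_integral e (diff_form p) (2 * k) = integral {th (2 * k)..th (2 * k + 1)} (phi p)"
    by (rule phi_edge_integral(2)) (use assms in auto)
  then show ?thesis using phi_sign(2)[of "2 * k" _ p] assms by (simp only:) (rule Re_integral_eq_0, simp)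
qed

lemma dr_edge_integral_real:
  assumes lam0: "lam 0 = 1" and k: "k \<in> {1..g}" and n: "n \<in> {1..g}"
  shows "edge_integral e (dr_coeff g lam y n) (2 * k - 1) \<in> \<real>"
  unfolding edge_integral_def
proof (rule integral_in_Reals)
  let ?i = "2 * k - 1"
  fix x assume x: "x \<in> {e ?i..e (?i + 1)}"
  have i: "?i \<in> {1..2 * g}" "?i \<le> 2 * g + 1" "odd ?i" using k by auto
  have "y (of_real x) \<in> \<real>"
  proof (cases "x \<in> {e ?i<..<e (?i + 1)}")
    case True
    show ?thesis by (rule y_sign(2)[OF i(2) edge_sign[OF i(1) True] i(3)])
  next
    case False
    then have "x = e ?i \<or> x = e (?i + 1)" using x by auto
    then show ?thesis using y_at_branch_point[of ?i] y_at_branch_point[of "?i + 1"] i by auto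
  qed
  moreover have "lam (2 * j) \<in> \<real>" if "j \<in> {0..2 * n - 2}" for j
  proof (cases j)
    case 0
    then show ?thesis using lam0 by simp
  next
    case (Suc l)
    then show ?thesis using lam_in_Reals[OF branch_points, of l] that n by auto
  qed
  ultimately show "dr_coeff g lam y n (of_real x) \<in> \<real>"
    unfolding dr_coeff_def by (intro Reals_mult Reals_divide sum_in_Reals Reals_power) auto
qed

end

lemma du_coeff_eq_diff_form: "du_coeff g y n = real_curve.diff_form y (g - n)"
  if "real_curve g lam e y" for g lam e y n
  by (rule ext) (simp add: du_coeff_def real_curve.diff_form_def[OF that])

lemma sum_over_pos:
  "(\<Sum>i\<in>(UNIV :: 'g::{finite,linorder} set). f (pos i)) = (\<Sum>k=1..CARD('g). f k)"
  by (rule sum.reindex_bij_betw[OF bij_betw_pos])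

lemma pos_surj:
  assumes "k \<in> {1..CARD('g::{finite,linorder})}"
  obtains k' :: "'g::{finite,linorder}" where "k = pos k'"
  using assms bij_betw_pos[where 'g = 'g] unfolding bij_betw_def by (metis imageE)

lemma pos_range: "pos (i :: 'g::{finite,linorder}) \<in> {1..CARD('g)}"
  using bij_betw_pos[where 'g = 'g] by (auto simp: bij_betw_def)

section \<open>Invertibility and symmetry of the real period matrices\<close>

definition omega_re :: "(nat \<Rightarrow> real) \<Rightarrow> (complex \<Rightarrow> complex) \<Rightarrow> real ^ 'g::{finite,linorder} ^ 'g::{finite,linorder}" where
  "omega_re e y = (\<chi> i k. Re (omega e y $ i $ k))"

definition omega'_im :: "(nat \<Rightarrow> real) \<Rightarrow> (complex \<Rightarrow> complex) \<Rightarrow> real ^ 'g::{finite,linorder} ^ 'g::{finite,linorder}" where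
  "omega'_im e y = (\<chi> i k. Im (omega' e y $ i $ k))"

text \<open>Rows belong to differentials and columns to cycles. A left kernel vector is thus a real
  combination of differentials with all the given periods zero, the situation excluded by counting
  roots.\<close>

lemma invertible_if_row_kernel_trivial:
  fixes M :: "real ^ 'g::finite ^ 'g"
  assumes "\<And>c. (\<And>k. (\<Sum>i\<in>UNIV. c $ i * M $ i $ k) = 0) \<Longrightarrow> c = 0"
  shows "invertible M"
proof -
  have "\<forall>c. transpose M *v c = 0 \<longrightarrow> c = 0"
  proof (intro allI impI, rule assms)
    fix c k assume "transpose M *v c = 0"
    then have "(c v* M) $ k = 0" by simp
    then show "(\<Sum>i\<in>UNIV. c $ i * M $ i $ k) = 0"
      unfolding vector_matrix_mult_def by (simp add: mult.commute)
  qed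
  then have "invertible (transpose M)"
    unfolding invertible_left_inverse matrix_left_invertible_ker .
  then show ?thesis using transpose_invertible[of "transpose M"] by simp
qed

lemma symmetric_quotient:
  fixes A B :: "real ^ 'g::finite ^ 'g"
  assumes AB: "A ** transpose B = B ** transpose A" and A: "A ** A' = mat 1" "A' ** A = mat 1"
  shows "transpose (A' ** B) = A' ** B"
proof -
  have "A ** transpose (A' ** B) = A ** transpose B ** transpose A'"
    by (simp add: matrix_transpose_mul matrix_mul_assoc)
  also have "\<dots> = B ** transpose (A' ** A)"
    unfolding AB matrix_transpose_mul by (simp add: matrix_mul_assoc)
  also have "\<dots> = B" by (simp add: A transpose_mat)
  finally have "A' ** (A ** transpose (A' ** B)) = A' ** B" by simp
  then show ?thesis by (simp add: matrix_mul_assoc A)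
qed

locale period_matrices = real_curve "CARD('g)" lam e y
  for lam e y and g_type :: "'g::{finite,linorder} itself"
begin

abbreviation "A \<equiv> omega_re e y :: real ^ 'g::{finite,linorder} ^ 'g::{finite,linorder}"
abbreviation "B \<equiv> omega'_im e y :: real ^ 'g::{finite,linorder} ^ 'g::{finite,linorder}"

lemma row_exponent: "CARD('g) - pos (i :: 'g) \<le> CARD('g) - 1" "CARD('g) - pos (i :: 'g) < CARD('g)"
  using pos_range[of i] by auto

lemma omega_entry:
  "omega e y $ i $ k = 2 * edge_integral e (diff_form (CARD('g) - pos (i :: 'g))) (2 * pos (k :: 'g) - 1)"
  by (simp add: omega_def du_coeff_eq_diff_form[OF real_curve_axioms])

lemma omega'_entry:
  "omega' e y $ i $ k = 2 * (\<Sum>j=pos k..CARD('g). edge_integral e (diff_form (CARD('g) - pos (i :: 'g))) (2 * j))"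
  for k :: 'g
  by (simp add: omega'_def du_coeff_eq_diff_form[OF real_curve_axioms])

lemma omega_eq: "omega e y = real_mat A"
  unfolding vec_eq_iff
proof (intro allI)
  fix i k :: 'g
  have "omega e y $ i $ k \<in> \<real>"
    unfolding omega_entry using edge_integral_odd_real[OF pos_range[of k] row_exponent(1)[of i]] by simp
  then show "omega e y $ i $ k = real_mat A $ i $ k"
    by (simp add: real_mat_def omega_re_def complex_is_Real_iff complex_eq_iff)
qed

lemma omega'_eq: "omega' e y = imag_mat B"
  unfolding vec_eq_iff
proof (intro allI)
  fix i k :: 'g
  have "Re (omega' e y $ i $ k) = 0"
    unfolding omega'_entry using edge_integral_even_imag[OF _ row_exponent(1)[of i]] pos_range[of k]
    by (auto simp: Re_sum intro!: sum.neutral)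
  then show "omega' e y $ i $ k = imag_mat B $ i $ k"
    by (simp add: imag_mat_def omega'_im_def complex_eq_iff)
qed

text \<open>Row i carries the monomial of exponent g - pos i, so the entries of \<open>c\<close> are
  polynomial coefficients in reversed order. The choice I k = 2k - 1 serves for \<open>A\<close>,
  and I k = 2k for \<open>B\<close>.\<close>

lemma row_combination_trivial:
  fixes c :: "real ^ 'g::{finite,linorder}" and I :: "nat \<Rightarrow> nat"
  assumes I: "\<And>k. k \<in> {1..CARD('g)} \<Longrightarrow> I k \<in> {1..2 * CARD('g)}" "strict_mono_on {1..CARD('g)} I"
    and zero: "\<And>k. k \<in> {1..CARD('g)} \<Longrightarrow>
      (\<Sum>i\<in>UNIV. of_real (c $ i) * edge_integral e (diff_form (CARD('g) - pos i)) (I k)) = 0"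
  shows "c = 0"
proof -
  define h where "h = (\<lambda>i :: 'g. CARD('g) - pos i)"
  have h: "bij_betw h UNIV {..<CARD('g)}"
  proof -
    have "bij_betw (\<lambda>k. CARD('g) - k) {1..CARD('g)} {..<CARD('g)}"
      by (rule bij_betw_byWitness[where f' = "\<lambda>p. CARD('g) - p"]) auto
    from bij_betw_trans[OF bij_betw_pos this] show ?thesis by (simp add: h_def o_def)
  qed
  define c' where "c' = (\<lambda>p. c $ inv_into UNIV h p)"
  have "c' (h i) = c $ i" for i
    using h by (simp add: c'_def bij_betw_def)
  then have c': "c' (CARD('g) - pos i) = c $ i" for i
    by (simp add: h_def)
  have "(\<Sum>p<CARD('g). of_real (c' p) * edge_integral e (diff_form p) (I k)) = 0" if "k \<in> {1..CARD('g)}" for k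
    using zero[OF that] sum.reindex_bij_betw[OF h, of "\<lambda>p. of_real (c' p) * edge_integral e (diff_form p) (I k)"]
    by (simp add: c' h_def)
  then have "c' p = 0" if "p < CARD('g)" for p
    using edge_periods_nondegenerate[OF I] that by blast
  then have "c $ i = 0" for i
    using c'[of i] row_exponent(2)[of i] by simp
  then show ?thesis by (simp add: vec_eq_iff)
qed

lemma A_invertible: "invertible A"
proof (rule invertible_if_row_kernel_trivial)
  fix c :: "real ^ 'g::{finite,linorder}" assume c: "\<And>k. (\<Sum>i\<in>UNIV. c $ i * A $ i $ k) = 0"
  show "c = 0"
  proof (rule row_combination_trivial[of "\<lambda>k. 2 * k - 1"])
    fix k assume "k \<in> {1..CARD('g)}"
    then obtain k' :: 'g where k: "k = pos k'"
      by (rule pos_surj)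
    have "(\<Sum>i\<in>UNIV. of_real (c $ i) * omega e y $ i $ k') = of_real (\<Sum>i\<in>UNIV. c $ i * A $ i $ k')"
      by (simp add: omega_eq real_mat_def)
    then have "2 * (\<Sum>i\<in>UNIV. of_real (c $ i) * edge_integral e (diff_form (CARD('g) - pos i)) (2 * k - 1)) = 0"
      unfolding c omega_entry k by (simp add: sum_distrib_left mult_ac)
    then show "(\<Sum>i\<in>UNIV. of_real (c $ i) * edge_integral e (diff_form (CARD('g) - pos i)) (2 * k - 1)) = 0"
      by simp
  qed (auto simp: strict_mono_on_def)
qed

text \<open>The columns of \<open>omega'\<close> are tail sums over the gaps. Subtracting
  consecutive tails isolates the single gaps, to which the root count applies.\<close>

lemma B_invertible: "invertible B"
proof (rule invertible_if_row_kernel_trivial)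
  fix c :: "real ^ 'g::{finite,linorder}" assume c: "\<And>k. (\<Sum>i\<in>UNIV. c $ i * B $ i $ k) = 0"
  define X where "X = (\<lambda>j. \<Sum>i\<in>UNIV. of_real (c $ i) * edge_integral e (diff_form (CARD('g) - pos (i :: 'g))) (2 * j))"
  have tail: "(\<Sum>j=k..CARD('g). X j) = 0" if kr: "k \<in> {1..CARD('g)}" for k
  proof -
    obtain k' :: 'g where k: "k = pos k'"
      by (rule pos_surj[OF kr])
    have "(\<Sum>i\<in>UNIV. of_real (c $ i) * omega' e y $ i $ k') = \<i> * of_real (\<Sum>i\<in>UNIV. c $ i * B $ i $ k')"
      by (simp add: omega'_eq imag_mat_def sum_distrib_left mult_ac)
    then have "(\<Sum>i\<in>UNIV. of_real (c $ i) * omega' e y $ i $ k') = 0" by (simp add: c)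
    moreover have "(\<Sum>i\<in>UNIV. of_real (c $ i) * omega' e y $ i $ k') = 2 * (\<Sum>j=k..CARD('g). X j)"
    proof -
      have "(\<Sum>i\<in>UNIV. of_real (c $ i) * omega' e y $ i $ k') =
          (\<Sum>i\<in>UNIV. \<Sum>j=k..CARD('g). 2 * (of_real (c $ i) * edge_integral e (diff_form (CARD('g) - pos i)) (2 * j)))"
        by (simp add: omega'_entry k sum_distrib_left mult.left_commute)
      also have "\<dots> = (\<Sum>j=k..CARD('g). \<Sum>i\<in>UNIV. 2 * (of_real (c $ i) * edge_integral e (diff_form (CARD('g) - pos i)) (2 * j)))"
        by (rule sum.swap)
      finally show ?thesis by (simp add: X_def sum_distrib_left)
    qed
    ultimately show ?thesis by simp
  qed
  show "c = 0"
  proof (rule row_combination_trivial[of "\<lambda>k. 2 * k"])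
    fix k assume k: "k \<in> {1..CARD('g)}"
    have "(\<Sum>j=k..CARD('g). X j) = X k + (\<Sum>j=k+1..CARD('g). X j)"
      using k by (simp add: sum.atLeast_Suc_atMost)
    moreover have "(\<Sum>j=k+1..CARD('g). X j) = 0"
      using tail[of "k + 1"] k by (cases "k = CARD('g)") auto
    ultimately have "X k = 0" using tail[OF k] by simp
    then show "(\<Sum>i\<in>UNIV. of_real (c $ i) * edge_integral e (diff_form (CARD('g) - pos i)) (2 * k)) = 0"
      by (simp add: X_def)
  qed (auto simp: strict_mono_on_def)
qed

lemma A_B_symmetric: "A ** transpose B = B ** transpose A"
  unfolding vec_eq_iff
proof (intro allI)
  fix i j :: 'g
  have prod: "\<i> * of_real ((A ** transpose B) $ i $ j) =
      4 * (\<Sum>k=1..CARD('g). edge_integral e (diff_form (CARD('g) - pos i)) (2 * k - 1) *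
         (\<Sum>l=k..CARD('g). edge_integral e (diff_form (CARD('g) - pos j)) (2 * l)))" for i j :: 'g
  proof -
    have "\<i> * of_real ((A ** transpose B) $ i $ j) = (\<Sum>k\<in>UNIV. real_mat A $ i $ k * imag_mat B $ j $ k)"
      by (simp add: matrix_matrix_mult_def transpose_def real_mat_def imag_mat_def sum_distrib_left mult_ac)
    also have "\<dots> = (\<Sum>k\<in>(UNIV :: 'g set). 4 * (edge_integral e (diff_form (CARD('g) - pos i)) (2 * pos k - 1) *
         (\<Sum>l=pos k..CARD('g). edge_integral e (diff_form (CARD('g) - pos j)) (2 * l))))"
      unfolding omega_eq[symmetric] omega'_eq[symmetric] omega_entry omega'_entry by simp
    also have "\<dots> = (\<Sum>k=1..CARD('g). 4 * (edge_integral e (diff_form (CARD('g) - pos i)) (2 * k - 1) *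
         (\<Sum>l=k..CARD('g). edge_integral e (diff_form (CARD('g) - pos j)) (2 * l))))"
      by (rule sum_over_pos)
    finally show ?thesis by (simp add: sum_distrib_left)
  qed
  have "\<i> * complex_of_real ((A ** transpose B) $ i $ j) = \<i> * of_real ((A ** transpose B) $ j $ i)"
    unfolding prod using riemann_bilinear[OF row_exponent(1)[of i] row_exponent(1)[of j]] by simp
  then have "(A ** transpose B) $ i $ j = (A ** transpose B) $ j $ i" by simp
  also have "\<dots> = (B ** transpose A) $ i $ j"
    by (simp add: matrix_matrix_mult_def transpose_def mult.commute)
  finally show "(A ** transpose B) $ i $ j = (B ** transpose A) $ i $ j" .
qed

end


section \<open>Reality on the shifted real space\<close>

lemma wp_real_of_exp_series:
  fixes b :: "'n \<Rightarrow> complex ^ 'g::finite"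
  assumes s: "\<And>u. s (w + u) = D * exp (Q u) * exp_series A b u" and D: "D \<noteq> 0"
    and Q: "\<And>i. has_partial i Q (Q1 i)" "\<And>i j. has_partial i (Q1 j) (\<lambda>_. Q2 i j)" "\<And>i j. Q2 i j \<in> \<real>"
    and summ: "exp_summable A b" and real: "\<And>u. exp_series A b (real_vec u) \<in> \<real>"
    and nz: "exp_series A b (real_vec u) \<noteq> 0"
  shows "wp2 s i k (w + real_vec u) \<in> \<real>" "wp3 s i j k (w + real_vec u) \<in> \<real>"
proof -
  define T1 where "T1 = (\<lambda>i. exp_series (\<lambda>n. A n * b n $ i) b)"
  define T2 where "T2 = (\<lambda>i j. exp_series (\<lambda>n. A n * b n $ j * b n $ i) b)"
  define T3 where "T3 = (\<lambda>i j k. exp_series (\<lambda>n. A n * b n $ k * b n $ j * b n $ i) b)"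
  have T: "has_partial i (exp_series A b) (T1 i)" "has_partial i (T1 j) (T2 i j)" "has_partial i (T2 j k) (T3 i j k)" for i j k
    unfolding T1_def T2_def T3_def by (intro has_partial_exp_series exp_summable_component summ)+
  have "T1 i (real_vec u) \<in> \<real>" for i u
    by (rule has_partial_real[OF T(1) real])
  moreover from this have "T2 i j (real_vec u) \<in> \<real>" for i j u
    by (rule has_partial_real[OF T(2)])
  moreover from this have "T3 i j k (real_vec u) \<in> \<real>" for i j k u
    by (rule has_partial_real[OF T(3)])
  moreover note Q(3) real
  ultimately have "- (Q2 i k + (T2 i k (real_vec u) * exp_series A b (real_vec u) - T1 k (real_vec u) * T1 i (real_vec u)) / (exp_series A b (real_vec u))\<^sup>2) \<in> \<real>"
    "- (((T3 i j k (real_vec u) * exp_series A b (real_vec u) + T2 j k (real_vec u) * T1 i (real_vec u) - (T2 i k (real_vec u) * T1 j (real_vec u) + T1 k (real_vec u) * T2 i j (real_vec u))) * (exp_series A b (real_vec u))\<^sup>2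
          - (T2 j k (real_vec u) * exp_series A b (real_vec u) - T1 k (real_vec u) * T1 j (real_vec u)) * (2 * exp_series A b (real_vec u) * T1 i (real_vec u))) / (exp_series A b (real_vec u)) ^ 4) \<in> \<real>"
    by (intro Reals_minus Reals_add Reals_divide Reals_diff Reals_mult Reals_power Reals_numeral; blast)+
  then show "wp2 s i k (w + real_vec u) \<in> \<real>" "wp3 s i j k (w + real_vec u) \<in> \<real>"
    using wp_of_quadratic_multiple[OF s D Q(1,2) T nz] by simp_all
qed

context period_matrices
begin

definition Y :: "real ^ 'g::{finite,linorder} ^ 'g::{finite,linorder}" where
  "Y = matrix_inv A ** B"

lemma A_inverse: "A ** matrix_inv A = mat 1" "matrix_inv A ** A = mat 1"
  using A_invertible matrix_inv_eqI[of A] unfolding invertible_def by metis+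

lemma matrix_inv_omega: "matrix_inv (omega e y) = real_mat (matrix_inv A)"
  unfolding omega_eq by (rule matrix_inv_eqI) (simp_all add: real_mat_mult A_inverse real_mat_id)

lemma tau_eq: "tau e y = imag_mat Y"
  by (simp add: tau_def matrix_inv_omega omega'_eq real_mat_imag_mat_mult Y_def)

lemma Y_symmetric: "transpose Y = Y"
  unfolding Y_def by (rule symmetric_quotient[OF A_B_symmetric A_inverse])

lemma Y_invertible: "invertible Y"
proof -
  have "invertible (matrix_inv A)" using A_inverse unfolding invertible_def by blast
  then show ?thesis unfolding Y_def using B_invertible by (rule invertible_mult)
qed

lemma kappa_real:
  assumes "lam 0 = 1"
  shows "kappa lam e y $ i $ (k :: 'g) \<in> \<real>"
proof -
  have "eta lam e y $ i $ (k :: 'g) \<in> \<real>" for i k :: 'g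
    using dr_edge_integral_real[OF assms pos_range pos_range] by (simp add: eta_def)
  then show ?thesis
    unfolding kappa_def matrix_inv_omega by (auto simp: matrix_matrix_mult_def real_mat_def intro!: sum_in_Reals)
qed

text \<open>In the variable of theta the half-period is (m1 + T m2) / 2, so it merely shifts the two
  halves of the characteristic: \<open>d\<close> and \<open>r\<close> are formed from the sums. The
  second conclusion hands on a nonzero value of theta, from which the positivity of \<open>Y\<close>
  is drawn.\<close>

lemma sigma_at_half_period:
  fixes eps eps' m1 m2 :: "int ^ 'g::{finite,linorder}"
  assumes w: "w = (1 / 2) *s (omega e y *v int_vec m1) + (1 / 2) *s (omega' e y *v int_vec m2)"
  defines "d \<equiv> m2 + eps'" and "r \<equiv> (1 / 2) *\<^sub>R int_real_vec (m1 + eps)"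
  obtains m k where
    "\<And>u. sigma_fun lam e y C eps' eps (w + u) =
      C * exp (- (1 / 2) * bdot (w + u) (kappa lam e y *v (w + u)) + bdot m u + k) *
      shifted_theta Y d r (matrix_inv A) u"
    "\<And>u. sigma_fun lam e y C eps' eps (w + u) \<noteq> 0 \<Longrightarrow> \<exists>z. theta z (imag_mat Y) \<noteq> 0"
proof -
  define W where "W = real_mat (matrix_inv A)"
  define T where "T = imag_mat Y"
  define a where "a = (1 / 2) *s int_vec eps'"
  define b where "b = (1 / 2) *s int_vec eps"
  define c where "c = real_vec ((1 / 2) *\<^sub>R int_real_vec d)"
  have W: "W ** omega e y = mat 1" "W ** omega' e y = T"
    unfolding W_def T_def omega_eq omega'_eq Y_def
    by (simp_all add: real_mat_mult A_inverse real_mat_id real_mat_imag_mat_mult)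
  have Ww: "W *v w = (1 / 2) *s int_vec m1 + T *v ((1 / 2) *s int_vec m2)"
    unfolding w by (simp add: matrix_vector_right_distrib vector_scalar_commute matrix_vector_mul_assoc W)
  have halves: "(1 / 2) *s int_vec m1 + b = real_vec r" "(1 / 2) *s int_vec m2 + a = c"
    by (simp_all add: b_def r_def a_def c_def d_def int_vec_def real_vec_def int_real_vec_def vec_eq_iff field_simps)
  have arg: "W *v (w + u) + b + T *v a = W *v u + real_vec r + T *v c" for u
  proof -
    have "W *v (w + u) + b + T *v a = W *v u + ((1 / 2) *s int_vec m1 + b) + (T *v ((1 / 2) *s int_vec m2) + T *v a)"
      by (simp only: matrix_vector_right_distrib Ww add_ac)
    then show ?thesis by (simp only: halves matrix_vector_right_distrib[symmetric])
  qed
  \<comment> \<open>The terms linear in u come from two sources, the exponential in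
    \<open>theta_char\<close> and the factor split off in completing the square; \<open>k\<close>
    collects the constants.\<close>
  define m where "m = (2 * \<i> * of_real pi) *s (transpose W *v a) + (- (2 * \<i> * of_real pi)) *s (transpose W *v c)"
  define k where "k = \<i> * of_real pi * bdot a (T *v a) + 2 * \<i> * of_real pi * bdot (W *v w + b) a
     - \<i> * of_real pi * bdot c (T *v c) - 2 * \<i> * of_real pi * bdot c (real_vec r)"
  have exponent: "\<i> * of_real pi * bdot a (T *v a) + 2 * \<i> * of_real pi * bdot (W *v (w + u) + b) a +
      (- (\<i> * of_real pi * bdot c (T *v c)) - 2 * \<i> * of_real pi * bdot c (W *v u + real_vec r)) = bdot m u + k" for u
  proof -
    have "bdot (W *v u) a = bdot (transpose W *v a) u" "bdot c (W *v u) = bdot (transpose W *v c) u"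
      by (simp_all only: bdot_matrix[symmetric] bdot_commute[of "W *v u"])
    then show ?thesis
      by (simp only: m_def k_def matrix_vector_right_distrib bdot_add_left bdot_add_right bdot_scale_left ring_distribs)
        (simp only: diff_conv_add_uminus minus_add_distrib mult_minus_left add_ac)
  qed
  have "sigma_fun lam e y C eps' eps (w + u) =
      C * exp (- (1 / 2) * bdot (w + u) (kappa lam e y *v (w + u)) + bdot m u + k) *
      shifted_theta Y d r (matrix_inv A) u" for u
  proof -
    have "theta (W *v (w + u) + b + T *v a) T =
        exp (- (\<i> * of_real pi * bdot c (T *v c)) - 2 * \<i> * of_real pi * bdot c (W *v u + real_vec r)) *
        shifted_theta Y d r (matrix_inv A) u"
      unfolding arg unfolding T_def W_def c_def by (rule theta_half_shift[OF Y_symmetric])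
    then show ?thesis
      unfolding sigma_fun_def theta_char_def Let_def tau_eq matrix_inv_omega
        a_def[symmetric] b_def[symmetric] W_def[symmetric] T_def[symmetric] add.assoc[of _ "bdot m u" k] exponent[symmetric] exp_add
      by (simp only: mult.assoc)
  qed
  moreover have "\<exists>z. theta z (imag_mat Y) \<noteq> 0" if "sigma_fun lam e y C eps' eps (w + u) \<noteq> 0" for u
    using that unfolding sigma_fun_def theta_char_def Let_def tau_eq by auto
  ultimately show ?thesis using that by blast
qed

lemma wp_real_at_half_period:
  fixes eps eps' :: "int ^ 'g::{finite,linorder}" and u :: "real ^ 'g::{finite,linorder}"
  assumes lam0: "lam 0 = 1" and C: "C \<noteq> 0" and hp: "half_period e y w"
  defines "s \<equiv> sigma_fun lam e y C eps' eps"
  assumes nz: "s (w + real_vec u) \<noteq> 0"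
  shows "wp2 s i k (w + real_vec u) \<in> \<real>" "wp3 s i j k (w + real_vec u) \<in> \<real>"
proof -
  obtain m1 m2 :: "int ^ 'g::{finite,linorder}"
    where w: "w = (1 / 2) *s (omega e y *v int_vec m1) + (1 / 2) *s (omega' e y *v int_vec m2)"
    using hp unfolding half_period_def by blast
  define d where "d = m2 + eps'"
  define r where "r = (1 / 2) *\<^sub>R int_real_vec (m1 + eps)"
  define K :: "complex ^ 'g::{finite,linorder} ^ 'g::{finite,linorder}" where "K = kappa lam e y"
  obtain m q where s: "\<And>u. s (w + u) = C * exp (- (1 / 2) * bdot (w + u) (K *v (w + u)) + bdot m u + q) *
      shifted_theta Y d r (matrix_inv A) u"
    and theta: "\<exists>z. theta z (imag_mat Y) \<noteq> 0"
    using sigma_at_half_period[OF w, of C eps' eps] nz unfolding s_def d_def r_def K_def by metis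
  obtain l where l: "0 < l" "\<And>x. l * (norm x)\<^sup>2 \<le> x \<bullet> (Y *v x)"
    using theta theta_nonzero_imp_nonneg nonneg_invertible_imp_coercive[OF _ Y_symmetric Y_invertible] by metis
  have Q2: "- (1 / 2) * (K + transpose K) $ j $ i \<in> \<real>" for i j :: 'g
    using kappa_real[OF lam0] unfolding K_def transpose_def by (intro Reals_mult) auto
  note summ = shifted_theta_summable[OF l, of d r "matrix_inv A"]
  have eq: "shifted_theta Y d r (matrix_inv A) = exp_series
      (\<lambda>n. exp (of_real (- pi * ((int_real_vec n + (1 / 2) *\<^sub>R int_real_vec d) \<bullet> (Y *v (int_real_vec n + (1 / 2) *\<^sub>R int_real_vec d)))) +
           2 * \<i> * of_real pi * of_real ((int_real_vec n + (1 / 2) *\<^sub>R int_real_vec d) \<bullet> r)))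
      (\<lambda>n. (2 * \<i> * of_real pi) *s real_vec (transpose (matrix_inv A) *v (int_real_vec n + (1 / 2) *\<^sub>R int_real_vec d)))"
    by (simp only: shifted_theta_def Let_def)
  have nz': "shifted_theta Y d r (matrix_inv A) (real_vec u) \<noteq> 0"
    using nz s[of "real_vec u"] by auto
  note real = wp_real_of_exp_series[OF s[unfolded eq] C has_partial_quadratic has_partial_affine Q2 summ
      shifted_theta_real[of Y d r "matrix_inv A", unfolded eq] nz'[unfolded eq]]
  show "wp2 s i k (w + real_vec u) \<in> \<real>" "wp3 s i j k (w + real_vec u) \<in> \<real>"
    by (rule real)+
qed

end

text \<open>The points at which the functions are defined are those where \<open>s\<close> does not
  vanish. The same condition ensures that the theta series does not merely have its default
  value.\<close>

theorem proposition4: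
  fixes lam :: "nat \<Rightarrow> complex" and e :: "nat \<Rightarrow> real" and y :: "complex \<Rightarrow> complex"
    and C :: complex and eps' eps :: "int ^ 'g::{finite,linorder}" and v :: "real ^ 'g::{finite,linorder}"
  assumes "lam 0 = 1"
    and "real_branch_points CARD('g) lam e"
    and "upper_branch (Lambda CARD('g) lam) y"
    and "C \<noteq> 0"
    and "riemann_char eps' eps"
    and "half_period e y (\<i> *s real_vec v)"
  defines "s \<equiv> sigma_fun lam e y C eps' eps"
  shows "\<forall>u :: real ^ 'g::{finite,linorder}. s (real_vec u + \<i> *s real_vec v) \<noteq> 0 \<longrightarrow>
           (\<forall>k :: 'g. wp2 s first_ix k (real_vec u + \<i> *s real_vec v) \<in> \<real> \<and>
                     wp3 s first_ix first_ix k (real_vec u + \<i> *s real_vec v) \<in> \<real>)"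
proof (intro allI impI)
  fix u :: "real ^ 'g::{finite,linorder}" and k :: 'g
  assume nz: "s (real_vec u + \<i> *s real_vec v) \<noteq> 0"
  interpret period_matrices lam e y "TYPE('g)"
    by unfold_locales (use assms in \<open>auto simp: Suc_le_eq\<close>)
  from nz show "wp2 s first_ix k (real_vec u + \<i> *s real_vec v) \<in> \<real> \<and>
      wp3 s first_ix first_ix k (real_vec u + \<i> *s real_vec v) \<in> \<real>"
    using wp_real_at_half_period[OF assms(1,4,6), of eps' eps u]
    unfolding s_def add.commute[of "real_vec u"] by blast
qed

end
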